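(* Let $\Sigma\subseteq\mathbb{R}^N$ be a convex cone with vertex at the origin, and let $\Omega\subset\mathbb{R}^N$ be a smooth bounded domain such that $\Sigma\cap\Omega$ is a bounded domain and $\Gamma_0:=\Sigma\cap\partial\Omega$ is smooth. Set $\Gamma_1:=\partial(\Sigma\cap\Omega)\setminus\overline{\Gamma}_0$ and assume that $\partial(\Sigma\cap\Omega)\setminus\overline{\Gamma}_0$ contains a vertex $x_0$ of the cone $\Sigma$. Let $v\in C^0(\overline{\Sigma}\cap\Omega)$ satisfy $$\Delta v=0\ \text{ in }\Sigma\cap\Omega,\qquad v_\nu=0\ \text{ on }\Gamma_1 .$$ Then the following mean value properties hold: $$v(x_0)=\frac{1}{|\Sigma\cap\partial B_r(x_0)|}\int_{\Sigma\cap\partial B_r(x_0)}v(y)\,dS_y\qquad\text{for any } 0<r<\delta_{\Gamma_0}(x_0),$$ $$v(x_0)=\frac{1}{|\Sigma\cap B_r(x_0)|}\int_{\Sigma\cap B_r(x_0)}v(y)\,dy\qquad\text{for any } 0<r\le\delta_{\Gamma_0}(x_0).$$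
   Context: A convex cone with vertex at the origin is here a convex set of the form $\Sigma=\{tx:\ x\in\omega,\ t\in(0,+\infty)\}$ for some open domain $\omega\subseteq\mathbb{S}^{N-1}$. A point $x_0$ is a vertex of $\Sigma$ if, translating $x_0$ to the origin, $\Sigma$ is again a cone with vertex at the origin (a cone may have more than one vertex, e.g. a half-space). $\delta_{\Gamma_0}(x_0)$ is the distance of $x_0$ to $\Gamma_0$. $B_r(x_0)$ is the ball of radius $r$ centered at $x_0$; $|\cdot|$ denotes Lebesgue measure for $N$-dimensional sets and surface measure for subsets of spheres. $\nu$ is the exterior unit normal and $v_\nu$ the normal derivative. The mixed problem for $v$ is understood in the weak sense: $v\in W^{1,2}_{loc}((\Sigma\cap\Omega)\cup\Gamma_1)$ and $\int_{\Sigma\cap\Omega}\langle\nabla v,\nabla\varphi\rangle\,dx=0$ for all $\varphi\in C^1$ with compact support in $(\Sigma\cap\Omega)\cup\Gamma_1$; it is known that such weak solutions belong to $W^{2,2}_{loc}((\Sigma\cap\Omega)\cup\Gamma_1)$.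
   Formalization: In the ball formula at r = δ_{Γ0}(x0), v is assumed Lebesgue integrable on Σ∩B_r(x0), since that integral may fail to exist there; without this assumption the formula at r = δ is proved as the limit of the integrals over smaller balls. *)

theory Defs
  imports "HOL-Analysis.Analysis"
begin

definition open_domain :: "'a::euclidean_space set \<Rightarrow> bool" where
  "open_domain D \<longleftrightarrow> open D \<and> connected D \<and> D \<noteq> {}"

text \<open>The cone is open and does not contain its vertex.\<close>

definition convex_cone_at_origin :: "'a::euclidean_space set \<Rightarrow> bool" where
  "convex_cone_at_origin C \<longleftrightarrow>
     convex C \<and>
     (\<exists>\<omega>. openin (top_of_set (sphere 0 1)) \<omega> \<and> connected \<omega> \<and> \<omega> \<noteq> {} \<and>
          C = {t *\<^sub>R x |t x. x \<in> \<omega> \<and> 0 < t})"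

definition cone_vertex :: "'a::euclidean_space set \<Rightarrow> 'a \<Rightarrow> bool" where
  "cone_vertex C x0 \<longleftrightarrow> convex_cone_at_origin ((\<lambda>x. x - x0) ` C)"

text \<open>To be used for open \<open>U\<close>, where the gradient \<open>df\<close> is determined by \<open>f\<close>:
  \<open>f\<close> is $C^{k+1}$ iff it is differentiable with partial derivatives of class $C^k$.\<close>

primrec Ck_on :: "nat \<Rightarrow> 'a::euclidean_space set \<Rightarrow> ('a \<Rightarrow> real) \<Rightarrow> bool" where
  "Ck_on 0 U f \<longleftrightarrow> continuous_on U f"
| "Ck_on (Suc k) U f \<longleftrightarrow>
     (\<exists>df. (\<forall>x\<in>U. GDERIV f x :> df x) \<and> (\<forall>b\<in>Basis. Ck_on k U (\<lambda>x. df x \<bullet> b)))"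

definition regular_smooth_on :: "'a::euclidean_space set \<Rightarrow> ('a \<Rightarrow> real) \<Rightarrow> bool" where
  "regular_smooth_on U g \<longleftrightarrow>
     (\<forall>k. Ck_on k U g) \<and> (\<forall>x\<in>U. \<exists>d. GDERIV g x :> d \<and> d \<noteq> 0)"

text \<open>Smooth domains lie locally on one side of their boundary, which is given there by a
  regular smooth defining function.\<close>

definition smooth_domain :: "'a::euclidean_space set \<Rightarrow> bool" where
  "smooth_domain D \<longleftrightarrow>
     open_domain D \<and>
     (\<forall>p\<in>frontier D. \<exists>U g. open U \<and> p \<in> U \<and> regular_smooth_on U g \<and>
        D \<inter> U = {x \<in> U. g x < 0} \<and> frontier D \<inter> U = {x \<in> U. g x = 0})"

definition smooth_hypersurface :: "'a::euclidean_space set \<Rightarrow> bool" where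
  "smooth_hypersurface S \<longleftrightarrow>
     (\<forall>p\<in>S. \<exists>U g. open U \<and> p \<in> U \<and> regular_smooth_on U g \<and> S \<inter> U = {x \<in> U. g x = 0})"

text \<open>\<open>C1_test A \<phi> d\<phi>\<close>: \<open>\<phi>\<close> is $C^1$ with gradient \<open>d\<phi>\<close>, and its restriction to \<open>A\<close>
  has compact support in \<open>A\<close>. When \<open>A\<close> contains boundary points, \<open>\<phi>\<close> need not vanish
  there, and its values off \<open>A\<close> are irrelevant.\<close>

definition C1_test :: "'a::euclidean_space set \<Rightarrow> ('a \<Rightarrow> real) \<Rightarrow> ('a \<Rightarrow> 'a) \<Rightarrow> bool" where
  "C1_test A \<phi> d\<phi> \<longleftrightarrow>
     (\<forall>x. GDERIV \<phi> x :> d\<phi> x) \<and> continuous_on UNIV d\<phi> \<and>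
     compact (closure {x \<in> A. \<phi> x \<noteq> 0}) \<and> closure {x \<in> A. \<phi> x \<noteq> 0} \<subseteq> A"

definition weak_gradient ::
  "'a::euclidean_space set \<Rightarrow> ('a \<Rightarrow> real) \<Rightarrow> ('a \<Rightarrow> 'a) \<Rightarrow> bool" where
  "weak_gradient D v g \<longleftrightarrow>
     (\<forall>K. compact K \<and> K \<subseteq> D \<longrightarrow>
        v absolutely_integrable_on K \<and> g absolutely_integrable_on K) \<and>
     (\<forall>\<phi> d\<phi>. C1_test D \<phi> d\<phi> \<longrightarrow>
        (LINT x:D|lebesgue. v x *\<^sub>R d\<phi> x) = - (LINT x:D|lebesgue. \<phi> x *\<^sub>R g x))"

definition L2_on ::
  "'a::euclidean_space set \<Rightarrow> ('a \<Rightarrow> 'b::euclidean_space) \<Rightarrow> bool" where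
  "L2_on S f \<longleftrightarrow>
     set_borel_measurable lebesgue S f \<and> (\<lambda>x. (norm (f x))\<^sup>2) absolutely_integrable_on S"

text \<open>\<open>v\<close> belongs to $W^{1,2}_{loc}(D \cup \Gamma)$ with weak gradient \<open>g\<close>, where \<open>D\<close> is open
  and \<open>\<Gamma>\<close> is a part of its boundary: square integrability holds up to \<open>\<Gamma>\<close>.\<close>

definition W12_loc ::
  "'a::euclidean_space set \<Rightarrow> 'a set \<Rightarrow> ('a \<Rightarrow> real) \<Rightarrow> ('a \<Rightarrow> 'a) \<Rightarrow> bool" where
  "W12_loc D \<Gamma> v g \<longleftrightarrow>
     weak_gradient D v g \<and>
     (\<forall>K. compact K \<and> K \<subseteq> D \<union> \<Gamma> \<longrightarrow> L2_on (K \<inter> D) v \<and> L2_on (K \<inter> D) g)"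

text \<open>Weak form of $\Delta v = 0$ in \<open>D\<close>, $v_\nu = 0$ on \<open>\<Gamma>\<close>.\<close>

definition weak_harmonic_neumann ::
  "'a::euclidean_space set \<Rightarrow> 'a set \<Rightarrow> ('a \<Rightarrow> real) \<Rightarrow> bool" where
  "weak_harmonic_neumann D \<Gamma> v \<longleftrightarrow>
     (\<exists>g. W12_loc D \<Gamma> v g \<and>
       (\<forall>\<phi> d\<phi>. C1_test (D \<union> \<Gamma>) \<phi> d\<phi> \<longrightarrow> (LINT x:D|lebesgue. g x \<bullet> d\<phi> x) = 0))"

text \<open>Surface measure of the sphere of radius \<open>r > 0\<close> about \<open>c\<close>, as a Borel measure on the
  whole space. On the unit sphere it is the measure of polar coordinates,
  $\sigma(E) = N\,|\{tx : x \in E,\ 0 < t < 1\}|$, that is, $N$ times the image of Lebesgue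
  measure on the unit ball under $x \mapsto x/|x|$; the factor $r^{N-1}$ accounts for the radius.
  For $N = 1$ it is counting measure on $\{c - r, c + r\}$.\<close>

definition sphere_measure :: "'a::euclidean_space \<Rightarrow> real \<Rightarrow> 'a measure" where
  "sphere_measure c r =
     scale_measure (ennreal (real DIM('a) * r ^ (DIM('a) - 1)))
       (distr (restrict_space lborel (ball 0 1)) borel (\<lambda>x. c + (r / norm x) *\<^sub>R x))"

end

theory Submission imports Defs begin

text \<open>Write $y = x - x_0$, let \<open>C\<close> be the cone translated to the origin, and let $N$ be the dimension. Within the
distance \<open>\<delta>\<close> of \<open>x0\<close> the domain is \<open>C\<close>, because the cone can leave \<open>\<Omega>\<close> only through \<open>\<Gamma>0\<close>. For a smooth
solution the argument is classical: the integral of $v(x_0 + \rho\theta)$ over the directions \<open>\<theta>\<close> in \<open>C\<close> has the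
$\rho$-derivative $\rho^{1-N}$ times the flux of $\nabla v$ through the spherical part of the boundary of the
sector of radius \<open>\<rho>\<close>. The flux through the lateral part is zero by the Neumann condition, so the
divergence theorem makes this derivative vanish. Hence the spherical integral is constant, and letting \<open>\<rho>\<close>
tend to 0 identifies the constant. Averages over balls follow by integrating in polar coordinates
(\<open>polar_coordinates\<close>).

For weak solutions on an arbitrary convex cone two families of test functions take the place of Green's
formula. First, the definition of the weak gradient is tested with
the components of the fields $A(|y|)\,f(y/|y|)\,y$, where \<open>f\<close> has compact support in the cone. As the
angular factor is homogeneous of degree zero and the field is radial, the divergence contains no derivative
of \<open>f\<close> (\<open>weak_gradient_product\<close>). With $|y|^N A$ approaching the indicator of a shell, this expresses the
difference of two spherical integrals with weight \<open>f\<close> as a flux of the gradient with weight \<open>f\<close> through the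
shell (\<open>weighted_sphere_integral_difference\<close>). Second, the equation is tested with radial functions, which
need not vanish on the lateral boundary; this shows that the flux with weight 1 is zero (\<open>flux_one\<close>).

It remains to let \<open>f\<close> tend to 1. Continuity of \<open>v\<close> is not available where the boundary of \<open>\<Omega>\<close> touches that of
\<open>\<Sigma>\<close>, so \<open>v\<close> may be unbounded near such points and even its integrability on each single sphere needs an
argument. Tested against all \<open>f\<close> with values in $[-1, 1]$, the difference of \<open>v\<close> on two spheres is bounded
by the $L^1$ norm of the radial part of the gradient on the shell between them, so this difference is
integrable (\<open>shell_gap_weighted_bound\<close>, \<open>shell_gap_integrable\<close>). On one of the two spheres \<open>v\<close> is integrable by
Fubini's theorem, hence it is on the other (\<open>sphere_integrable\<close>), and dominated convergence applies
(\<open>sphere_integral_constant\<close>).\<close>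

section \<open>Polar coordinates\<close>

abbreviation unit_sphere_measure :: "'a::euclidean_space measure" where
  "unit_sphere_measure \<equiv> sphere_measure 0 1"

lemma borel_measurable_sgn_vector [measurable]:
  "(sgn :: 'a::euclidean_space \<Rightarrow> 'a) \<in> borel \<rightarrow>\<^sub>M borel"
  unfolding sgn_div_norm[abs_def] by measurable

lemma sets_sphere_measure [simp, measurable_cong]: "sets (sphere_measure c r) = sets borel"
  by (simp add: sphere_measure_def)

lemma space_sphere_measure [simp]: "space (sphere_measure c r) = UNIV"
  by (simp add: sphere_measure_def space_scale_measure)

lemma emeasure_unit_sphere_measure:
  fixes B :: "'a::euclidean_space set"
  assumes [measurable]: "B \<in> sets borel"
  shows "emeasure unit_sphere_measure B =
    ennreal (real DIM('a)) * emeasure lborel {x \<in> ball 0 1. sgn x \<in> B}"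
proof -
  have "emeasure (distr (restrict_space lborel (ball 0 1)) borel sgn) B =
      emeasure (restrict_space lborel (ball 0 1)) (sgn -` B \<inter> ball 0 (1::real))"
    by (subst emeasure_distr) (auto simp: space_restrict_space intro!: measurable_restrict_space1)
  also have "\<dots> = emeasure lborel (sgn -` B \<inter> ball 0 (1::real))"
    by (subst emeasure_restrict_space) auto
  finally show ?thesis
    by (simp add: sphere_measure_def sgn_div_norm[abs_def] Int_def vimage_def conj_commute divide_inverse)
qed

lemma finite_unit_sphere_measure: "finite_measure (unit_sphere_measure :: 'a::euclidean_space measure)"
proof
  have "emeasure lborel {x \<in> ball 0 1. sgn x \<in> (UNIV :: 'a set)} = emeasure lborel (ball (0::'a) 1)"
    by (rule arg_cong[where f="emeasure lborel"]) auto
  then have "emeasure lborel {x \<in> ball 0 1. sgn x \<in> (UNIV :: 'a set)} \<noteq> \<infinity>"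
    using emeasure_lborel_ball_finite[of "0::'a" 1] by (simp only: infinity_ennreal_def less_top)
  then show "emeasure (unit_sphere_measure :: 'a measure) (space unit_sphere_measure) \<noteq> \<infinity>"
    by (simp add: emeasure_unit_sphere_measure ennreal_mult_eq_top_iff)
qed

text \<open>Projection along rays sends all of the unit ball except its centre to the unit sphere.\<close>

lemma AE_unit_sphere_measure: "AE \<theta> in (unit_sphere_measure :: 'a::euclidean_space measure). norm \<theta> = 1"
proof -
  have "emeasure unit_sphere_measure (- sphere (0::'a) 1) =
     ennreal (real DIM('a)) * emeasure lborel {x \<in> ball 0 1. sgn x \<in> - sphere (0::'a) 1}"
    by (rule emeasure_unit_sphere_measure) auto
  also have "{x \<in> ball 0 1. sgn x \<in> - sphere (0::'a) 1} = {0}"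
    by (auto simp: norm_sgn)
  finally have "emeasure unit_sphere_measure (- sphere (0::'a) 1) = 0" by simp
  then show ?thesis
    by (intro AE_I[where N="- sphere 0 1"]) auto
qed

text \<open>A nonempty open cone cuts a nonempty open set out of the unit ball.\<close>

lemma measure_unit_sphere_pos:
  fixes C :: "'a::euclidean_space set"
  assumes "open C" "C \<noteq> {}" and cone: "\<And>t x. 0 < t \<Longrightarrow> x \<in> C \<Longrightarrow> t *\<^sub>R x \<in> C" and "0 \<notin> C"
  shows "0 < measure unit_sphere_measure C"
proof -
  interpret finite_measure "unit_sphere_measure :: 'a measure" by (rule finite_unit_sphere_measure)
  have [measurable]: "C \<in> sets borel" using assms(1) by simp
  have sgn_C: "sgn x \<in> C" if "x \<in> C" for x
    using cone[of "inverse (norm x)" x] that assms(4) by (cases "x = 0") (auto simp: sgn_div_norm)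
  obtain x where x: "x \<in> C" using assms(2) by blast
  then have "x \<noteq> 0" using assms(4) by auto
  then have "(1 / (2 * norm x)) *\<^sub>R x \<in> C \<inter> ball 0 1" using cone[of "1 / (2 * norm x)" x] x by simp
  then have "\<not> negligible (C \<inter> ball 0 1)"
    using assms(1) by (intro open_not_negligible) auto
  then have "emeasure lborel (C \<inter> ball 0 1) \<noteq> 0"
    by (auto simp: negligible_iff_null_sets null_sets_def)
  moreover have "emeasure lborel (C \<inter> ball 0 1) \<le> emeasure lborel {x \<in> ball 0 1. sgn x \<in> C}"
    using sgn_C by (intro emeasure_mono) auto
  ultimately have "emeasure unit_sphere_measure C \<noteq> 0"
    by (auto simp: emeasure_unit_sphere_measure)
  then show ?thesis by (simp add: emeasure_eq_measure zero_less_measure_iff)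
qed

text \<open>Dilation by \<open>b\<close> carries the sector of the unit ball onto that of the ball of radius \<open>b\<close>.\<close>

lemma emeasure_ball_sector:
  fixes B :: "'a::euclidean_space set"
  assumes [measurable]: "B \<in> sets borel" and "b > 0"
  shows "emeasure lborel {x \<in> ball 0 b. sgn x \<in> B} =
    ennreal (b ^ DIM('a)) * emeasure lborel {x \<in> ball 0 1. sgn x \<in> B}"
proof -
  have "emeasure lborel {x \<in> ball 0 b. sgn x \<in> B} =
    emeasure (density (distr lborel borel (\<lambda>x. 0 + b *\<^sub>R x)) (\<lambda>_. ennreal (\<bar>b\<bar> ^ DIM('a)))) {x \<in> ball 0 b. sgn x \<in> B}"
    using lborel_affine[of b "0::'a"] \<open>b > 0\<close> by simp
  also have "\<dots> = ennreal (b ^ DIM('a)) * emeasure lborel ((\<lambda>x. b *\<^sub>R x) -` {x \<in> ball 0 b. sgn x \<in> B})"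
    using \<open>b > 0\<close> by (simp add: emeasure_density_const emeasure_distr)
  also have "(\<lambda>x. b *\<^sub>R x) -` {x \<in> ball 0 b. sgn x \<in> B} = {x \<in> ball 0 1. sgn x \<in> B}"
    using \<open>b > 0\<close> by (auto simp: sgn_scaleR)
  finally show ?thesis .
qed

text \<open>The radial factor $\rho^{n-1}\,d\rho$ of Lebesgue measure in dimension \<open>n\<close>.\<close>

definition radial_measure :: "nat \<Rightarrow> real measure" where
  "radial_measure n = density lborel (\<lambda>\<rho>. ennreal (indicator {0<..} \<rho> * \<rho> ^ (n - 1)))"

lemma sets_radial_measure [simp, measurable_cong]: "sets (radial_measure n) = sets borel"
  by (simp add: radial_measure_def)

lemma space_radial_measure [simp]: "space (radial_measure n) = UNIV"
  by (simp add: radial_measure_def)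

lemma emeasure_radial_measure:
  assumes "n > 0"
  shows "emeasure (radial_measure n) {..<b} = ennreal (max 0 b ^ n / n)"
proof (cases "b > 0")
  case True
  have "emeasure (radial_measure n) {..<b} =
    (\<integral>\<^sup>+ \<rho>. ennreal (indicator {0<..} \<rho> * \<rho> ^ (n - 1)) * indicator {..<b} \<rho> \<partial>lborel)"
    by (simp add: radial_measure_def emeasure_density)
  also have "\<dots> = (\<integral>\<^sup>+ \<rho>. ennreal (\<rho> ^ (n - 1)) * indicator {0..b} \<rho> \<partial>lborel)"
    by (intro nn_integral_cong_AE)
       (use AE_lborel_singleton[of 0] AE_lborel_singleton[of b] in \<open>auto simp: indicator_def\<close>)
  also have "\<dots> = ennreal (b ^ n / n - 0 ^ n / n)"
    using True assms
    by (intro nn_integral_FTC_Icc)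
       (auto intro!: derivative_eq_intros)
  finally show ?thesis using True assms by (simp add: power_0_left)
next
  case False
  have "emeasure (radial_measure n) {..<b} =
    (\<integral>\<^sup>+ \<rho>. ennreal (indicator {0<..} \<rho> * \<rho> ^ (n - 1)) * indicator {..<b} \<rho> \<partial>lborel)"
    by (simp add: radial_measure_def emeasure_density)
  also have "\<dots> = (\<integral>\<^sup>+ (\<rho>::real). 0 \<partial>lborel)"
    using False by (intro nn_integral_cong) (auto simp: indicator_def)
  finally show ?thesis using False assms by (simp add: max_def power_0_left)
qed

lemma sigma_finite_radial_measure: "sigma_finite_measure (radial_measure n)"
  unfolding radial_measure_def
  by (subst sigma_finite_measure.sigma_finite_iff_density_finite[OF sigma_finite_lborel]) auto

text \<open>For a fixed \<open>B\<close> both sides are measures in \<open>A\<close>, so they need only be compared on half-lines, where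
  the scaling of sectors gives both values.\<close>

lemma polar_emeasure:
  fixes B :: "'a::euclidean_space set"
  assumes [measurable]: "A \<in> sets borel" "B \<in> sets borel"
  shows "emeasure (radial_measure DIM('a)) A * emeasure unit_sphere_measure B =
     emeasure lborel {x. norm x \<in> A \<and> sgn x \<in> B}"
proof -
  define M where "M = distr (restrict_space lborel {x::'a. sgn x \<in> B}) borel norm"
  define N where "N = scale_measure (emeasure unit_sphere_measure B) (radial_measure DIM('a))"
  have M: "emeasure M X = emeasure lborel {x. norm x \<in> X \<and> sgn x \<in> B}"
    if [measurable]: "X \<in> sets borel" for X
  proof -
    have "emeasure M X = emeasure (restrict_space lborel {x::'a. sgn x \<in> B})
        (norm -` X \<inter> {x. sgn x \<in> B})"
      unfolding M_def
      by (subst emeasure_distr) (auto simp: space_restrict_space intro!: measurable_restrict_space1)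
    also have "\<dots> = emeasure lborel (norm -` X \<inter> {x. sgn x \<in> B})"
      by (subst emeasure_restrict_space) auto
    finally show ?thesis by (simp add: Int_def vimage_def)
  qed
  have N: "emeasure N X = emeasure unit_sphere_measure B * emeasure (radial_measure DIM('a)) X" for X
    by (simp add: N_def)
  have "M = N"
  proof (rule measure_eqI_generator_eq[where \<Omega>=UNIV and E="range lessThan" and A="\<lambda>n. {..<real n}"])
    show "Int_stable (range (lessThan :: real \<Rightarrow> _))"
    proof (clarsimp simp: Int_stable_def)
      fix a b :: real
      have "{..<a} \<inter> {..<b} = {..<min a b}" by auto
      then show "{..<a} \<inter> {..<b} \<in> range lessThan" by (metis rangeI)
    qed
    show "sets M = sigma_sets UNIV (range lessThan)" "sets N = sigma_sets UNIV (range lessThan)"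
      by (simp_all add: M_def N_def sets_scale_measure borel_Iio)
    show "(\<Union>i. {..<real i}) = UNIV"
      by (auto intro: reals_Archimedean2)
    fix X :: "real set" assume "X \<in> range lessThan"
    then obtain b where X: "X = {..<b}" by auto
    show "emeasure M X = emeasure N X"
    proof (cases "b > 0")
      case True
      have "emeasure M X = ennreal (b ^ DIM('a)) * emeasure lborel {x \<in> ball 0 1. sgn x \<in> B}"
        using emeasure_ball_sector[of B b] True by (simp add: M X)
      also have "\<dots> = emeasure N X"
        using True
        by (simp add: N X emeasure_radial_measure emeasure_unit_sphere_measure mult.assoc[symmetric]
                ennreal_mult'[symmetric] mult.commute)
      finally show ?thesis .
    next
      case False
      have "\<not> norm x < b" for x :: 'a
        using False norm_ge_zero[of x] by linarith
      then have "emeasure M X = 0" by (simp add: M X)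
      then show ?thesis using False
        by (simp add: N X emeasure_radial_measure max_def)
    qed
  next
    fix i :: nat
    have "emeasure lborel {x \<in> ball (0::'a) (real i). sgn x \<in> B} \<le> emeasure lborel (ball (0::'a) (real i))"
      by (intro emeasure_mono) auto
    then show "emeasure M {..<real i} \<noteq> \<infinity>"
      using emeasure_lborel_ball_finite[of "0::'a" "real i"] by (auto simp: M top_unique)
  qed auto
  then show ?thesis
    using M[of A] N[of A] by (simp add: mult.commute)
qed

text \<open>The map $x \mapsto (|x|, x/|x|)$ carries Lebesgue measure to a measure with the values of the product
  on rectangles, and multiplying its two components gives back \<open>x\<close>.\<close>

theorem polar_coordinates:
  "distr (radial_measure DIM('a) \<Otimes>\<^sub>M unit_sphere_measure) borel (\<lambda>(\<rho>, \<theta>). \<rho> *\<^sub>R \<theta>) =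
    (lborel :: 'a::euclidean_space measure)"
proof -
  let ?M = "radial_measure DIM('a) \<Otimes>\<^sub>M (unit_sphere_measure :: 'a measure)"
  have eq: "?M = distr lborel (borel \<Otimes>\<^sub>M borel) (\<lambda>x. (norm x, sgn x))"
  proof (rule pair_measure_eqI)
    show "sigma_finite_measure (radial_measure DIM('a))" by (rule sigma_finite_radial_measure)
    show "sigma_finite_measure (unit_sphere_measure :: 'a measure)"
      using finite_unit_sphere_measure by (rule finite_measure.axioms)
    show "sets ?M = sets (distr lborel (borel \<Otimes>\<^sub>M borel) (\<lambda>x::'a. (norm x, sgn x)))"
      by (simp cong: sets_pair_measure_cong)
    fix A and B :: "'a set" assume AB: "A \<in> sets (radial_measure DIM('a))" "B \<in> sets unit_sphere_measure"
    then have [measurable]: "A \<in> sets borel" "B \<in> sets borel" by auto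
    show "emeasure (radial_measure DIM('a)) A * emeasure unit_sphere_measure B =
          emeasure (distr lborel (borel \<Otimes>\<^sub>M borel) (\<lambda>x. (norm x, sgn x))) (A \<times> B)"
      by (subst polar_emeasure) (auto simp: emeasure_distr vimage_def)
  qed
  show ?thesis
    unfolding eq
  proof (subst distr_distr)
    have "(\<lambda>(\<rho>, \<theta>). \<rho> *\<^sub>R \<theta>) \<circ> (\<lambda>x::'a. (norm x, sgn x)) = (\<lambda>x. x)"
    proof
      show "((\<lambda>(\<rho>, \<theta>). \<rho> *\<^sub>R \<theta>) \<circ> (\<lambda>x::'a. (norm x, sgn x))) x = x" for x
        by (cases "x = 0") (simp_all add: sgn_div_norm)
    qed
    then show "distr lborel borel ((\<lambda>(\<rho>, \<theta>). \<rho> *\<^sub>R \<theta>) \<circ> (\<lambda>x::'a. (norm x, sgn x))) = lborel"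
      by (simp add: distr_id2)
  qed auto
qed

lemma pair_sigma_finite_polar:
  "pair_sigma_finite (radial_measure n) (unit_sphere_measure :: 'a::euclidean_space measure)"
  using sigma_finite_radial_measure finite_unit_sphere_measure
  by (intro pair_sigma_finite.intro) (auto intro: finite_measure.axioms)

lemma polar_coordinates_centered:
  "distr (radial_measure DIM('a) \<Otimes>\<^sub>M unit_sphere_measure) borel (\<lambda>p. c + fst p *\<^sub>R snd p) =
    (lborel :: 'a::euclidean_space measure)"
proof -
  have "distr (radial_measure DIM('a) \<Otimes>\<^sub>M unit_sphere_measure) borel (\<lambda>p. c + fst p *\<^sub>R snd p) =
     distr (distr (radial_measure DIM('a) \<Otimes>\<^sub>M unit_sphere_measure) borel (\<lambda>(\<rho>, \<theta>). \<rho> *\<^sub>R \<theta>)) borel ((+) c)"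
    by (subst distr_distr) (auto simp: o_def case_prod_unfold)
  then show ?thesis by (simp add: polar_coordinates lborel_distr_plus)
qed

lemma polar_integral:
  fixes F :: "'a::euclidean_space \<Rightarrow> real"
  assumes F: "integrable lborel F"
  shows "integral\<^sup>L lborel F = (LINT \<rho>|radial_measure DIM('a). (LINT \<theta>|unit_sphere_measure. F (c + \<rho> *\<^sub>R \<theta>)))"
    and "integrable (radial_measure DIM('a)) (\<lambda>\<rho>. LINT \<theta>|unit_sphere_measure. F (c + \<rho> *\<^sub>R \<theta>))"
    and "AE \<rho> in radial_measure DIM('a). integrable unit_sphere_measure (\<lambda>\<theta>. F (c + \<rho> *\<^sub>R \<theta>))"
proof -
  let ?M = "radial_measure DIM('a) \<Otimes>\<^sub>M (unit_sphere_measure :: 'a measure)"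
  interpret pair_sigma_finite "radial_measure DIM('a)" "unit_sphere_measure :: 'a measure"
    by (rule pair_sigma_finite_polar)
  have [measurable]: "F \<in> borel_measurable borel" using F by auto
  have "integrable (distr ?M borel (\<lambda>p. c + fst p *\<^sub>R snd p)) F"
    unfolding polar_coordinates_centered by (rule F)
  then have int: "integrable ?M (\<lambda>p. F (c + fst p *\<^sub>R snd p))"
    by (subst (asm) integrable_distr_eq) auto
  have "integral\<^sup>L lborel F = integral\<^sup>L (distr ?M borel (\<lambda>p. c + fst p *\<^sub>R snd p)) F"
    unfolding polar_coordinates_centered by (rule refl)
  also have "\<dots> = (\<integral>p. F (c + fst p *\<^sub>R snd p) \<partial>?M)"
    by (subst integral_distr) auto
  also have "\<dots> = (LINT \<rho>|radial_measure DIM('a). (LINT \<theta>|unit_sphere_measure. F (c + \<rho> *\<^sub>R \<theta>)))"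
    using integral_fst'[OF int] by simp
  finally show "integral\<^sup>L lborel F = (LINT \<rho>|radial_measure DIM('a). (LINT \<theta>|unit_sphere_measure. F (c + \<rho> *\<^sub>R \<theta>)))" .
  show "integrable (radial_measure DIM('a)) (\<lambda>\<rho>. LINT \<theta>|unit_sphere_measure. F (c + \<rho> *\<^sub>R \<theta>))"
    using integrable_fst'[OF int] by simp
  show "AE \<rho> in radial_measure DIM('a). integrable unit_sphere_measure (\<lambda>\<theta>. F (c + \<rho> *\<^sub>R \<theta>))"
    using AE_integrable_fst'[OF int] by simp
qed

lemma integral_radial_measure:
  fixes h :: "real \<Rightarrow> real"
  assumes "h \<in> borel_measurable borel"
  shows "integral\<^sup>L (radial_measure n) h = (LINT \<rho>|lborel. (indicator {0<..} \<rho> * \<rho> ^ (n - 1)) * h \<rho>)"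
  unfolding radial_measure_def using assms
  by (subst integral_density) (auto simp: indicator_def)

text \<open>In polar coordinates only the total mass $r^N/N$ of the radial measure remains.\<close>

lemma ball_integral_of_constant_spheres:
  fixes F :: "'a::euclidean_space \<Rightarrow> real"
  assumes r: "0 < r" and [measurable]: "F \<in> borel_measurable borel"
    and F: "integrable lborel (\<lambda>x. indicator (ball c r) x * F x)"
    and const: "\<And>\<rho>. 0 < \<rho> \<Longrightarrow> \<rho> < r \<Longrightarrow> (LINT \<theta>|unit_sphere_measure. F (c + \<rho> *\<^sub>R \<theta>)) = m"
  shows "(LINT x|lborel. indicator (ball c r) x * F x) = m * (r ^ DIM('a) / real DIM('a))"
proof -
  let ?F = "\<lambda>x. indicator (ball c r) x * F x" and ?R = "radial_measure DIM('a)"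
  have [measurable]: "?F \<in> borel_measurable borel" using F by auto
  have em: "emeasure ?R {..<r} = ennreal (r ^ DIM('a) / real DIM('a))"
    using r by (simp add: emeasure_radial_measure)
  have ball: "\<rho> < r \<longleftrightarrow> c + \<rho> *\<^sub>R \<theta> \<in> ball c r" if "norm \<theta> = 1" "0 < \<rho>" for \<rho> and \<theta> :: 'a
    using that by (simp add: dist_norm)
  have "integral\<^sup>L lborel ?F = (LINT \<rho>|?R. (LINT \<theta>|unit_sphere_measure. ?F (c + \<rho> *\<^sub>R \<theta>)))"
    by (rule polar_integral(1)[OF F])
  also have "\<dots> = (LINT \<rho>|?R. indicator {..<r} \<rho> * m)"
  proof (rule integral_cong_AE)
    show "(\<lambda>\<rho>. LINT \<theta>|unit_sphere_measure. ?F (c + \<rho> *\<^sub>R \<theta>)) \<in> borel_measurable ?R"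
      using polar_integral(2)[OF F, of c] by auto
    have "AE \<rho> in ?R. \<rho> > 0"
      unfolding radial_measure_def by (subst AE_density) (auto simp: indicator_def)
    then show "AE \<rho> in ?R. (LINT \<theta>|unit_sphere_measure. ?F (c + \<rho> *\<^sub>R \<theta>)) = indicator {..<r} \<rho> * m"
    proof eventually_elim
      fix \<rho> :: real assume \<rho>: "\<rho> > 0"
      have AE: "AE \<theta> in unit_sphere_measure. c + \<rho> *\<^sub>R \<theta> \<in> ball c r \<longleftrightarrow> \<rho> < r"
        using AE_unit_sphere_measure by eventually_elim (use ball \<rho> in blast)
      show "(LINT \<theta>|unit_sphere_measure. ?F (c + \<rho> *\<^sub>R \<theta>)) = indicator {..<r} \<rho> * m"
      proof (cases "\<rho> < r")
        case True
        have "(LINT \<theta>|unit_sphere_measure. ?F (c + \<rho> *\<^sub>R \<theta>)) = (LINT \<theta>|unit_sphere_measure. F (c + \<rho> *\<^sub>R \<theta>))"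
        proof (rule integral_cong_AE)
          show "AE \<theta> in unit_sphere_measure. ?F (c + \<rho> *\<^sub>R \<theta>) = F (c + \<rho> *\<^sub>R \<theta>)"
            using AE by eventually_elim (use True in simp)
        qed auto
        then show ?thesis using const[OF \<rho> True] True by simp
      next
        case False
        have "(LINT \<theta>|unit_sphere_measure. ?F (c + \<rho> *\<^sub>R \<theta>)) = (LINT \<theta>|(unit_sphere_measure::'a measure). 0)"
        proof (rule integral_cong_AE)
          show "AE \<theta> in unit_sphere_measure. ?F (c + \<rho> *\<^sub>R \<theta>) = 0"
            using AE by eventually_elim (use False in simp)
        qed auto
        then show ?thesis using False by simp
      qed
    qed
  qed auto
  also have "\<dots> = measure ?R {..<r} * m" by simp
  also have "measure ?R {..<r} = r ^ DIM('a) / real DIM('a)"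
    using em r by (simp add: measure_def)
  finally show ?thesis by (simp add: mult.commute)
qed

text \<open>Since $c + (r/|x|)\,x = c + r\,(x/|x|)$, every sphere measure is an image of the one on the unit sphere.\<close>

lemma sphere_measure_eq_density:
  fixes c :: "'a::euclidean_space"
  assumes "0 < r"
  shows "sphere_measure c r =
    density (distr unit_sphere_measure borel (\<lambda>\<theta>. c + r *\<^sub>R \<theta>)) (\<lambda>_. ennreal (r ^ (DIM('a) - 1)))"
proof (rule measure_eqI)
  fix B assume "B \<in> sets (sphere_measure c r)"
  then have [measurable]: "B \<in> sets borel" by simp
  have T: "(\<lambda>\<theta>. c + r *\<^sub>R \<theta>) -` B \<in> sets borel"
    using measurable_sets_borel[of "\<lambda>\<theta>. c + r *\<^sub>R \<theta>" borel B] by simp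
  have "emeasure (sphere_measure c r) B = ennreal (real DIM('a) * r ^ (DIM('a) - 1)) *
      emeasure (restrict_space lborel (ball 0 1)) ((\<lambda>x. c + (r / norm x) *\<^sub>R x) -` B \<inter> ball 0 (1::real))"
    unfolding sphere_measure_def emeasure_scale_measure
    by (subst emeasure_distr) (auto simp: space_restrict_space intro!: measurable_restrict_space1)
  also have "emeasure (restrict_space lborel (ball 0 1)) ((\<lambda>x. c + (r / norm x) *\<^sub>R x) -` B \<inter> ball 0 (1::real)) =
      emeasure lborel ((\<lambda>x. c + (r / norm x) *\<^sub>R x) -` B \<inter> ball 0 (1::real))"
    by (subst emeasure_restrict_space) auto
  also have "(\<lambda>x. c + (r / norm x) *\<^sub>R x) -` B \<inter> ball 0 1 = {x \<in> ball 0 1. sgn x \<in> (\<lambda>\<theta>. c + r *\<^sub>R \<theta>) -` B}"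
    by (auto simp: sgn_div_norm divide_inverse)
  also have "ennreal (real DIM('a) * r ^ (DIM('a) - 1)) * emeasure lborel {x \<in> ball 0 1. sgn x \<in> (\<lambda>\<theta>. c + r *\<^sub>R \<theta>) -` B} =
      ennreal (r ^ (DIM('a) - 1)) * emeasure unit_sphere_measure ((\<lambda>\<theta>. c + r *\<^sub>R \<theta>) -` B)"
    unfolding emeasure_unit_sphere_measure[OF T]
    using assms by (subst ennreal_mult'') (auto simp: mult_ac)
  also have "\<dots> = emeasure (density (distr unit_sphere_measure borel (\<lambda>\<theta>. c + r *\<^sub>R \<theta>)) (\<lambda>_. ennreal (r ^ (DIM('a) - 1)))) B"
    by (simp add: emeasure_density_const emeasure_distr)
  finally show "emeasure (sphere_measure c r) B =
     emeasure (density (distr unit_sphere_measure borel (\<lambda>\<theta>. c + r *\<^sub>R \<theta>)) (\<lambda>_. ennreal (r ^ (DIM('a) - 1)))) B" .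
qed simp

lemma integral_sphere_measure:
  fixes F :: "'a::euclidean_space \<Rightarrow> real"
  assumes r: "0 < r" and [measurable]: "F \<in> borel_measurable borel"
  shows "integral\<^sup>L (sphere_measure c r) F = r ^ (DIM('a) - 1) * (LINT \<theta>|unit_sphere_measure. F (c + r *\<^sub>R \<theta>))"
    and "integrable (sphere_measure c r) F \<longleftrightarrow> integrable unit_sphere_measure (\<lambda>\<theta>. F (c + r *\<^sub>R \<theta>))"
proof -
  show "integral\<^sup>L (sphere_measure c r) F = r ^ (DIM('a) - 1) * (LINT \<theta>|unit_sphere_measure. F (c + r *\<^sub>R \<theta>))"
    unfolding sphere_measure_eq_density[OF r] using r
    by (subst integral_density) (auto simp: integral_distr)
  show "integrable (sphere_measure c r) F \<longleftrightarrow> integrable unit_sphere_measure (\<lambda>\<theta>. F (c + r *\<^sub>R \<theta>))"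
    unfolding sphere_measure_eq_density[OF r] using r
    by (subst integrable_density) (auto simp: integrable_distr_eq)
qed

section \<open>Smooth steps on the line\<close>

text \<open>A $C^1$ function that is positive exactly on the positive half-line; steps and bumps are made of it.\<close>

definition pos_square :: "real \<Rightarrow> real" where "pos_square t = (max 0 t)\<^sup>2"

lemma pos_square_pos: "0 < pos_square t \<longleftrightarrow> 0 < t"
  by (cases "t \<le> 0") (auto simp: pos_square_def max_def)

lemma DERIV_pos_square: "DERIV pos_square t :> 2 * max 0 t"
proof -
  consider "t > 0" | "t < 0" | "t = 0" by linarith
  then show ?thesis
  proof cases
    case 1
    have "DERIV (\<lambda>t. t\<^sup>2) t :> 2 * max 0 t"
      using 1 by (auto intro!: derivative_eq_intros)
    moreover have "\<forall>\<^sub>F s in nhds t. pos_square s = s\<^sup>2"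
      using 1 by (intro eventually_nhds_in_open[of "{0<..}", THEN eventually_mono]) (auto simp: pos_square_def)
    ultimately show ?thesis by (simp add: DERIV_cong_ev)
  next
    case 2
    have "DERIV (\<lambda>t. 0) t :> 2 * max 0 t" using 2 by simp
    moreover have "\<forall>\<^sub>F s in nhds t. pos_square s = 0"
      using 2 by (intro eventually_nhds_in_open[of "{..<0}", THEN eventually_mono]) (auto simp: pos_square_def)
    ultimately show ?thesis by (subst DERIV_cong_ev[where g="\<lambda>t. 0"]) auto
  next
    case 3
    have "((\<lambda>h. pos_square h / h) \<longlongrightarrow> 0) (at 0)"
    proof (rule Lim_null_comparison[where g="\<lambda>h. \<bar>h\<bar>"])
      show "\<forall>\<^sub>F h in at 0. norm (pos_square h / h) \<le> \<bar>h\<bar>"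
        by (intro always_eventually) (auto simp: pos_square_def max_def power2_eq_square)
      show "((\<lambda>h. \<bar>h\<bar>) \<longlongrightarrow> 0) (at (0::real))"
        by (rule tendsto_eq_intros | simp)+
    qed
    with 3 show ?thesis by (simp add: DERIV_def pos_square_def)
  qed
qed

text \<open>A second difference of \<open>pos_square\<close>, which climbs from 0 to 1 on the unit interval. Its derivative is
  a tent over that interval.\<close>

definition smooth_step :: "real \<Rightarrow> real" where
  "smooth_step t = 2 * pos_square t - 4 * pos_square (t - 1/2) + 2 * pos_square (t - 1)"

definition tent :: "real \<Rightarrow> real" where
  "tent t = 4 * max 0 t - 8 * max 0 (t - 1/2) + 4 * max 0 (t - 1)"

lemma DERIV_smooth_step: "DERIV smooth_step t :> tent t"
  unfolding smooth_step_def[abs_def] tent_def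
  by (auto intro!: derivative_eq_intros DERIV_chain2[OF DERIV_pos_square])

lemma continuous_tent [continuous_intros]: "continuous_on S f \<Longrightarrow> continuous_on S (\<lambda>x. tent (f x))"
  unfolding tent_def by (intro continuous_intros)

lemma tent_nonneg: "0 \<le> tent t"
  by (auto simp: tent_def max_def)

lemma tent_eq_0: "t \<le> 0 \<or> t \<ge> 1 \<Longrightarrow> tent t = 0"
  by (auto simp: tent_def max_def)

lemma smooth_step_eq_0: "t \<le> 0 \<Longrightarrow> smooth_step t = 0"
  by (auto simp: smooth_step_def pos_square_def max_def)

lemma smooth_step_eq_1: "t \<ge> 1 \<Longrightarrow> smooth_step t = 1"
  by (auto simp: smooth_step_def pos_square_def max_def power2_eq_square algebra_simps)

lemma mono_smooth_step: "s \<le> t \<Longrightarrow> smooth_step s \<le> smooth_step t"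
  by (rule DERIV_nonneg_imp_nondecreasing) (use DERIV_smooth_step tent_nonneg in blast)+

lemma smooth_step_bounds: "0 \<le> smooth_step t" "smooth_step t \<le> 1"
  using mono_smooth_step[of "min 0 t" t] mono_smooth_step[of t "max 1 t"]
    smooth_step_eq_0[of "min 0 t"] smooth_step_eq_1[of "max 1 t"] by auto

lemma continuous_smooth_step [continuous_intros]:
  "continuous_on S f \<Longrightarrow> continuous_on S (\<lambda>x. smooth_step (f x))"
  unfolding smooth_step_def pos_square_def by (intro continuous_intros)

lemma tent_integral: "integrable lborel tent" "(LINT t|lborel. tent t) = 1"
proof -
  have "has_bochner_integral lborel (\<lambda>t. tent t * indicator {0..1} t) (smooth_step 1 - smooth_step 0)"
    by (rule has_bochner_integral_FTC_Icc_real)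
       (auto intro: DERIV_smooth_step continuous_on_eq_continuous_at[THEN iffD1, rule_format, OF open_UNIV]
             continuous_tent[OF continuous_on_id])
  moreover have "(\<lambda>t. tent t * indicator {0..1} t) = tent"
  proof
    show "tent t * indicator {0..1} t = tent t" for t
      using tent_eq_0[of t] by (cases "t \<in> {0..1}") auto
  qed
  ultimately have "has_bochner_integral lborel tent 1"
    by (simp add: smooth_step_eq_0 smooth_step_eq_1)
  then show "integrable lborel tent" "(LINT t|lborel. tent t) = 1"
    by (auto simp: has_bochner_integral_iff)
qed

text \<open>The rescaled tents form an approximate identity that sits to the right of \<open>a\<close>, so only values of \<open>M\<close>
  on an interval beginning at \<open>a\<close> matter.\<close>

lemma tent_average_limit:
  fixes M :: "real \<Rightarrow> real"
  assumes [measurable]: "M \<in> borel_measurable borel" and cont: "continuous_on {a..b} M"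
    and m: "m > 0" "a + 1 / real m \<le> b"
  shows "n \<ge> m \<Longrightarrow> integrable lborel (\<lambda>\<rho>. (real n * tent (real n * (\<rho> - a))) * M \<rho>)"
    and "(\<lambda>n. LINT \<rho>|lborel. (real n * tent (real n * (\<rho> - a))) * M \<rho>) \<longlonglongrightarrow> M a"
proof -
  have [measurable]: "tent \<in> borel_measurable borel"
    by (intro borel_measurable_continuous_onI continuous_tent continuous_on_id)
  obtain B where "\<forall>\<rho>\<in>{a..b}. \<bar>M \<rho>\<bar> \<le> B"
    using compact_imp_bounded[OF compact_continuous_image[OF cont compact_Icc]] by (auto simp: bounded_iff)
  then have B: "\<And>\<rho>. \<rho> \<in> {a..b} \<Longrightarrow> \<bar>M \<rho>\<bar> \<le> B" by blast
  \<comment> \<open>In the variable \<open>\<tau> = n (\<rho> - a)\<close> the tent no longer depends on \<open>n\<close>.\<close>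
  define F where "F n \<rho> = (real n * tent (real n * (\<rho> - a))) * M \<rho>" for n \<rho>
  have F: "F n (a + (1 / real n) * \<tau>) = real n * (tent \<tau> * M (a + \<tau> / real n))" if "n \<ge> m" for n \<tau>
    using that m by (simp add: F_def)
  have bound: "norm (tent \<tau> * M (a + \<tau> / real n)) \<le> B * tent \<tau>" if "n \<ge> m" for n \<tau>
  proof (cases "0 < \<tau> \<and> \<tau> < 1")
    case True
    have "\<tau> / real n \<le> 1 / real m" using True that m by (intro frac_le) auto
    then have "a + \<tau> / real n \<in> {a..b}" using True m by auto
    from B[OF this] show ?thesis using tent_nonneg[of \<tau>]
      by (simp add: abs_mult mult.commute[of "tent \<tau>"] mult_right_mono)
  next
    case False
    then show ?thesis by (auto simp: tent_eq_0 not_less)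
  qed
  have int: "integrable lborel (\<lambda>\<tau>. tent \<tau> * M (a + \<tau> / real n))" if "n \<ge> m" for n
  proof (rule Bochner_Integration.integrable_bound)
    show "integrable lborel (\<lambda>\<tau>. B * tent \<tau>)" by (intro integrable_mult_right tent_integral)
    show "AE \<tau> in lborel. norm (tent \<tau> * M (a + \<tau> / real n)) \<le> norm (B * tent \<tau>)"
      using bound[OF that] by (intro AE_I2) (metis abs_ge_self order_trans real_norm_def)
  qed auto
  show "integrable lborel (\<lambda>\<rho>. (real n * tent (real n * (\<rho> - a))) * M \<rho>)" if "n \<ge> m" for n
  proof -
    have "integrable lborel (\<lambda>\<tau>. F n (a + (1 / real n) * \<tau>))"
      unfolding F[OF that] by (intro integrable_mult_right int that)
    then have "integrable lborel (F n)"
      using that m by (subst (asm) lborel_integrable_real_affine_iff) auto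
    then show ?thesis by (simp add: F_def[abs_def])
  qed
  have eq: "integral\<^sup>L lborel (F n) = (LINT \<tau>|lborel. tent \<tau> * M (a + \<tau> / real n))" if "n \<ge> m" for n
  proof -
    have "integral\<^sup>L lborel (F n) = \<bar>1 / real n\<bar> *\<^sub>R (LINT \<tau>|lborel. F n (a + (1 / real n) * \<tau>))"
      using that m by (intro lborel_integral_real_affine) auto
    also have "\<dots> = (LINT \<tau>|lborel. tent \<tau> * M (a + \<tau> / real n))"
      using that m unfolding F[OF that] by simp
    finally show ?thesis .
  qed
  have "(\<lambda>n. LINT \<tau>|lborel. tent \<tau> * M (a + \<tau> / real (n + m))) \<longlonglongrightarrow> (LINT \<tau>|lborel. tent \<tau> * M a)"
  proof (rule integral_dominated_convergence[where w="\<lambda>\<tau>. B * tent \<tau>"])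
    show "integrable lborel (\<lambda>\<tau>. B * tent \<tau>)" by (intro integrable_mult_right tent_integral)
    show "AE \<tau> in lborel. norm (tent \<tau> * M (a + \<tau> / real (n + m))) \<le> B * tent \<tau>" for n
      using bound[of "n + m"] by (intro AE_I2) auto
    show "AE \<tau> in lborel. (\<lambda>n. tent \<tau> * M (a + \<tau> / real (n + m))) \<longlonglongrightarrow> tent \<tau> * M a"
    proof (intro AE_I2)
      fix \<tau>
      show "(\<lambda>n. tent \<tau> * M (a + \<tau> / real (n + m))) \<longlonglongrightarrow> tent \<tau> * M a"
      proof (cases "0 < \<tau> \<and> \<tau> < 1")
        case True
        have lim: "(\<lambda>n. a + \<tau> / real (n + m)) \<longlonglongrightarrow> a"
        proof -
          have "(\<lambda>n. \<tau> / real (n + m)) \<longlonglongrightarrow> 0"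
            by (rule LIMSEQ_ignore_initial_segment[OF lim_const_over_n])
          from tendsto_add[OF tendsto_const[of a] this] show ?thesis by simp
        qed
        have in_ab: "a + \<tau> / real (n + m) \<in> {a..b}" for n
        proof -
          have "\<tau> / real (n + m) \<le> 1 / real m" using True m by (intro frac_le) auto
          then show ?thesis using True m by auto
        qed
        have "0 < 1 / real m" using m by simp
        with m(2) have "a \<le> b" by linarith
        then have "a \<in> {a..b}" by simp
        with cont lim in_ab have "(\<lambda>n. M (a + \<tau> / real (n + m))) \<longlonglongrightarrow> M a"
          unfolding continuous_on_sequentially o_def by (auto simp del: of_nat_add)
        then show ?thesis by (rule tendsto_mult_left)
      next
        case False
        then have "tent \<tau> = 0" by (auto simp: tent_eq_0 not_less)
        then show ?thesis by simp
      qed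
    qed
  qed auto
  moreover have "(LINT \<tau>|lborel. tent \<tau> * M a) = M a"
    by (simp add: tent_integral)
  ultimately have "(\<lambda>n. integral\<^sup>L lborel (F (n + m))) \<longlonglongrightarrow> M a"
    by (simp add: eq tent_integral)
  from LIMSEQ_offset[OF this]
  show "(\<lambda>n. LINT \<rho>|lborel. (real n * tent (real n * (\<rho> - a))) * M \<rho>) \<longlonglongrightarrow> M a"
    by (simp add: F_def[abs_def])
qed

text \<open>A $C^1$ approximation to the indicator of the interval \<open>{s<..r}\<close>: both steps begin at the end point
  and rise to its right.\<close>

definition shell_cutoff :: "real \<Rightarrow> real \<Rightarrow> nat \<Rightarrow> real \<Rightarrow> real" where
  "shell_cutoff s r n \<rho> = smooth_step (real n * (\<rho> - s)) - smooth_step (real n * (\<rho> - r))"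

lemma shell_cutoff_bounds:
  assumes "s < r" shows "0 \<le> shell_cutoff s r n \<rho>" "shell_cutoff s r n \<rho> \<le> 1"
proof -
  have "real n * (\<rho> - r) \<le> real n * (\<rho> - s)" using assms by (intro mult_left_mono) auto
  from mono_smooth_step[OF this] show "0 \<le> shell_cutoff s r n \<rho>"
    by (simp add: shell_cutoff_def)
  show "shell_cutoff s r n \<rho> \<le> 1"
    using smooth_step_bounds(2)[of "real n * (\<rho> - s)"] smooth_step_bounds(1)[of "real n * (\<rho> - r)"]
    by (simp add: shell_cutoff_def)
qed

lemma shell_cutoff_eq_0:
  assumes "s < r" "n > 0" "\<rho> \<le> s \<or> \<rho> \<ge> r + 1 / real n"
  shows "shell_cutoff s r n \<rho> = 0"
  using assms(3)
proof
  assume "\<rho> \<le> s"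
  then have "real n * (\<rho> - s) \<le> 0" "real n * (\<rho> - r) \<le> 0"
    using assms by (auto intro: mult_nonneg_nonpos)
  then show ?thesis by (simp add: shell_cutoff_def smooth_step_eq_0)
next
  assume "\<rho> \<ge> r + 1 / real n"
  then have "1 \<le> real n * (\<rho> - r)" using assms(2) by (simp add: field_simps)
  moreover have "real n * (\<rho> - r) \<le> real n * (\<rho> - s)" using assms by (intro mult_left_mono) auto
  ultimately show ?thesis by (simp add: shell_cutoff_def smooth_step_eq_1)
qed

lemma shell_cutoff_tendsto:
  assumes "s < r"
  shows "(\<lambda>n. shell_cutoff s r n \<rho>) \<longlonglongrightarrow> indicator {s<..r} \<rho>"
proof -
  have step: "\<forall>\<^sub>F n in sequentially. smooth_step (real n * (\<rho> - a)) = indicator {a<..} \<rho>" for a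
  proof (cases "\<rho> > a")
    case True
    obtain m :: nat where m: "1 / (\<rho> - a) < real m" using reals_Archimedean2 by blast
    show ?thesis
    proof (rule eventually_sequentiallyI[of m])
      fix n assume "n \<ge> m"
      have "1 \<le> real m * (\<rho> - a)" using m True by (simp add: field_simps)
      also have "\<dots> \<le> real n * (\<rho> - a)" using \<open>n \<ge> m\<close> True by (intro mult_right_mono) auto
      finally show "smooth_step (real n * (\<rho> - a)) = indicator {a<..} \<rho>"
        using True by (simp add: smooth_step_eq_1)
    qed
  next
    case False
    then have "real n * (\<rho> - a) \<le> 0" for n :: nat by (intro mult_nonneg_nonpos) auto
    with False show ?thesis by (simp add: smooth_step_eq_0)
  qed
  have "\<forall>\<^sub>F n in sequentially. shell_cutoff s r n \<rho> = indicator {s<..r} \<rho>"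
    using step[of s] step[of r]
    by eventually_elim (use assms in \<open>auto simp: shell_cutoff_def indicator_def\<close>)
  then show ?thesis by (rule tendsto_eventually)
qed

lemma DERIV_shell_cutoff:
  "DERIV (shell_cutoff s r n) \<rho> :> real n * tent (real n * (\<rho> - s)) - real n * tent (real n * (\<rho> - r))"
proof -
  have "DERIV (\<lambda>\<rho>. smooth_step (real n * (\<rho> - a))) \<rho> :> real n * tent (real n * (\<rho> - a))" for a
  proof -
    have "DERIV (\<lambda>\<rho>. real n * (\<rho> - a)) \<rho> :> real n" by (auto intro!: derivative_eq_intros)
    from DERIV_chain2[OF DERIV_smooth_step this] show ?thesis by (simp add: mult.commute)
  qed
  from DERIV_diff[OF this[of s] this[of r]] show ?thesis
    by (simp add: shell_cutoff_def[abs_def])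
qed

lemma continuous_shell_cutoff: "continuous_on UNIV (shell_cutoff s r n)"
  unfolding shell_cutoff_def[abs_def] by (intro continuous_intros)

text \<open>The quotient rule fails only at the origin, near which \<open>k\<close> vanishes.\<close>

lemma DERIV_divide_power:
  fixes k k' :: "real \<Rightarrow> real" and N :: nat
  assumes k: "\<And>\<rho>. DERIV k \<rho> :> k' \<rho>" and s: "0 < s" "\<And>\<rho>. \<rho> \<le> s \<Longrightarrow> k \<rho> = 0" "\<And>\<rho>. \<rho> \<le> s \<Longrightarrow> k' \<rho> = 0"
  shows "DERIV (\<lambda>\<rho>. k \<rho> / \<rho> ^ N) \<rho> :> k' \<rho> / \<rho> ^ N - real N * k \<rho> / \<rho> ^ Suc N"
proof (cases "\<rho> < s")
  case True
  have "DERIV (\<lambda>\<rho>. 0) \<rho> :> k' \<rho> / \<rho> ^ N - real N * k \<rho> / \<rho> ^ Suc N"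
    using True s by simp
  moreover have "\<forall>\<^sub>F \<tau> in nhds \<rho>. k \<tau> / \<tau> ^ N = 0"
    using True s(2) by (intro eventually_nhds_in_open[of "{..<s}", THEN eventually_mono]) auto
  ultimately show ?thesis by (subst DERIV_cong_ev[where g="\<lambda>t. 0"]) auto
next
  case False
  then have \<rho>: "\<rho> > 0" using s(1) by simp
  have "DERIV (\<lambda>\<rho>. \<rho> ^ N) \<rho> :> real N * \<rho> ^ (N - 1)" by (auto intro!: derivative_eq_intros)
  from DERIV_divide[OF k this]
  have "DERIV (\<lambda>\<rho>. k \<rho> / \<rho> ^ N) \<rho> :> (k' \<rho> * \<rho> ^ N - k \<rho> * (real N * \<rho> ^ (N - 1))) / (\<rho> ^ N * \<rho> ^ N)"
    using \<rho> by simp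
  moreover have "(k' \<rho> * \<rho> ^ N - k \<rho> * (real N * \<rho> ^ (N - 1))) / (\<rho> ^ N * \<rho> ^ N) = k' \<rho> / \<rho> ^ N - real N * k \<rho> / \<rho> ^ Suc N"
    using \<rho> by (cases N) (auto simp: field_simps)
  ultimately show ?thesis by simp
qed

section \<open>Functions with a continuous gradient\<close>

lemma GDERIV_unique: "GDERIV f x :> d \<Longrightarrow> GDERIV f x :> e \<Longrightarrow> d = e"
  unfolding gderiv_def
  by (drule (1) has_derivative_unique) (metis inner_commute vector_eq_ldot)

lemma GDERIV_transform:
  assumes "GDERIV f x :> d" "open U" "x \<in> U" "\<And>y. y \<in> U \<Longrightarrow> f y = h y"
  shows "GDERIV h x :> d"
  using assms unfolding gderiv_def by (rule has_derivative_transform_within_open)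

lemma GDERIV_eq_0:
  assumes "GDERIV f x :> d" "open U" "x \<in> U" "\<And>y. y \<in> U \<Longrightarrow> f y = 0"
  shows "d = 0"
proof -
  have "GDERIV (\<lambda>_. 0) x :> d" by (rule GDERIV_transform[OF assms])
  then show ?thesis by (rule GDERIV_unique[OF _ GDERIV_const])
qed

lemma GDERIV_continuous: "GDERIV f x :> d \<Longrightarrow> isCont f x"
  unfolding gderiv_def by (rule has_derivative_continuous)

definition C1_gradient :: "('a::euclidean_space \<Rightarrow> real) \<Rightarrow> ('a \<Rightarrow> 'a) \<Rightarrow> bool" where
  "C1_gradient f df \<longleftrightarrow> (\<forall>x. GDERIV f x :> df x) \<and> continuous_on UNIV df"

lemma C1_gradient_continuous: "C1_gradient f df \<Longrightarrow> continuous_on UNIV f"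
  by (auto simp: C1_gradient_def intro!: continuous_at_imp_continuous_on GDERIV_continuous)

lemma C1_gradient_const: "C1_gradient (\<lambda>x. c) (\<lambda>x. 0)"
  by (auto simp: C1_gradient_def GDERIV_const)

lemma C1_gradient_add:
  "C1_gradient f df \<Longrightarrow> C1_gradient g dg \<Longrightarrow> C1_gradient (\<lambda>x. f x + g x) (\<lambda>x. df x + dg x)"
  by (auto simp: C1_gradient_def intro!: GDERIV_add continuous_intros)

lemma C1_gradient_mult:
  assumes "C1_gradient f df" "C1_gradient g dg"
  shows "C1_gradient (\<lambda>x. f x * g x) (\<lambda>x. f x *\<^sub>R dg x + g x *\<^sub>R df x)"
  using assms C1_gradient_continuous[OF assms(1)] C1_gradient_continuous[OF assms(2)]
  by (auto simp: C1_gradient_def intro!: GDERIV_mult continuous_intros)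

lemma C1_gradient_sum:
  assumes "\<And>i. i \<in> I \<Longrightarrow> C1_gradient (f i) (df i)" "finite I"
  shows "C1_gradient (\<lambda>x. \<Sum>i\<in>I. f i x) (\<lambda>x. \<Sum>i\<in>I. df i x)"
  using assms(2,1)
  by (induction rule: finite_induct) (auto intro!: C1_gradient_add C1_gradient_const)

lemma C1_gradient_compose:
  assumes f: "C1_gradient f df" and h: "\<And>t. DERIV h t :> dh t" "continuous_on UNIV dh"
  shows "C1_gradient (\<lambda>x. h (f x)) (\<lambda>x. dh (f x) *\<^sub>R df x)"
  using f h C1_gradient_continuous[OF f]
  unfolding C1_gradient_def
  by (intro conjI allI GDERIV_DERIV_compose[of f _ _ h] continuous_on_scaleR
      continuous_on_compose2[OF h(2)]) auto

lemma C1_gradient_linear: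
  assumes "bounded_linear (f :: 'a::euclidean_space \<Rightarrow> real)"
  shows "C1_gradient f (\<lambda>x. \<Sum>b\<in>Basis. f b *\<^sub>R b)"
proof -
  interpret bounded_linear f by fact
  have "f h = h \<bullet> (\<Sum>b\<in>Basis. f b *\<^sub>R b)" for h
  proof -
    have "f h = f (\<Sum>b\<in>Basis. (h \<bullet> b) *\<^sub>R b)" by (simp add: euclidean_representation)
    also have "\<dots> = (\<Sum>b\<in>Basis. (h \<bullet> b) * f b)" by (simp add: sum scaleR)
    finally show ?thesis by (simp add: inner_sum_right mult.commute)
  qed
  then have "(\<lambda>h. h \<bullet> (\<Sum>b\<in>Basis. f b *\<^sub>R b)) = f"
    by (intro ext) (rule sym)
  then show ?thesis
    using bounded_linear_imp_has_derivative[OF assms] unfolding C1_gradient_def gderiv_def by simp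
qed

lemma C1_gradient_polynomial:
  assumes "real_polynomial_function (p :: 'a::euclidean_space \<Rightarrow> real)"
  shows "\<exists>dp. C1_gradient p dp"
  using assms
  by induction (blast intro: C1_gradient_linear C1_gradient_const C1_gradient_add C1_gradient_mult)+

lemma C1_gradient_shift:
  assumes "C1_gradient f df"
  shows "C1_gradient (\<lambda>x. f (x - c)) (\<lambda>x. df (x - c))"
proof -
  have "GDERIV (\<lambda>x. f (x - c)) x :> df (x - c)" for x
  proof -
    have "((\<lambda>x. x - c) has_derivative (\<lambda>h. h)) (at x)"
      by (auto intro!: derivative_eq_intros)
    moreover have "(f has_derivative (\<lambda>h. h \<bullet> df (x - c))) (at (x - c))"
      using assms by (simp add: C1_gradient_def gderiv_def)
    ultimately show ?thesis
      unfolding gderiv_def using has_derivative_compose by blast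
  qed
  moreover have "continuous_on UNIV (\<lambda>x. df (x - c))"
    using assms unfolding C1_gradient_def
    by (auto intro: continuous_on_compose2[OF _ continuous_on_diff[OF continuous_on_id continuous_on_const]])
  ultimately show ?thesis by (simp add: C1_gradient_def)
qed

lemma C1_bump:
  fixes c :: "'a::euclidean_space"
  assumes "r > 0"
  shows "\<exists>b db. C1_gradient b db \<and> (\<forall>x. 0 \<le> b x) \<and> (\<forall>x. 0 < b x \<longleftrightarrow> x \<in> ball c r)"
proof (intro exI conjI)
  have "C1_gradient (\<lambda>x::'a. (x - c) \<bullet> (x - c)) (\<lambda>x. 2 *\<^sub>R (x - c))"
    unfolding C1_gradient_def gderiv_def
    by (intro conjI allI continuous_intros)
       (rule derivative_eq_intros refl | simp add: inner_commute fun_eq_iff)+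
  moreover have "DERIV (\<lambda>t. pos_square (r\<^sup>2 - t)) t :> - (2 * max 0 (r\<^sup>2 - t))" for t
  proof -
    have "DERIV (\<lambda>t. r\<^sup>2 - t) t :> -1" by (auto intro!: derivative_eq_intros)
    from DERIV_chain2[OF DERIV_pos_square this] show ?thesis by simp
  qed
  moreover have "continuous_on UNIV (\<lambda>t. - (2 * max 0 (r\<^sup>2 - t)))"
    by (intro continuous_intros)
  ultimately show "C1_gradient (\<lambda>x. pos_square (r\<^sup>2 - (x - c) \<bullet> (x - c)))
     (\<lambda>x. (- (2 * max 0 (r\<^sup>2 - (x - c) \<bullet> (x - c)))) *\<^sub>R (2 *\<^sub>R (x - c)))"
    by (rule C1_gradient_compose)
  show "\<forall>x. 0 \<le> pos_square (r\<^sup>2 - (x - c) \<bullet> (x - c))" by (simp add: pos_square_def)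
  have "norm (x - c) < r \<longleftrightarrow> (x - c) \<bullet> (x - c) < r\<^sup>2" for x
    using power_strict_mono[of "norm (x - c)" r 2] power_less_imp_less_base[of "norm (x - c)" 2 r] assms
    unfolding power2_norm_eq_inner by fastforce
  then show "\<forall>x. 0 < pos_square (r\<^sup>2 - (x - c) \<bullet> (x - c)) \<longleftrightarrow> x \<in> ball c r"
    by (simp add: pos_square_pos dist_norm norm_minus_commute[of c])
qed

text \<open>The open set is a union of countably many balls, and the cutoff saturates
  \<open>n\<close> times the sum of the first \<open>n\<close> bumps on such balls.\<close>

lemma C1_cutoffs:
  fixes U :: "'a::euclidean_space set"
  assumes "open U" "U \<noteq> {}"
  obtains \<eta> :: "nat \<Rightarrow> 'a \<Rightarrow> real" and d\<eta> L where
    "\<And>n. C1_gradient (\<eta> n) (d\<eta> n)"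
    "\<And>n. compact (L n)" "\<And>n. L n \<subseteq> U" "\<And>n x. x \<notin> L n \<Longrightarrow> \<eta> n x = 0"
    "\<And>n x. 0 \<le> \<eta> n x" "\<And>n x. \<eta> n x \<le> 1"
    "\<And>x. x \<in> U \<Longrightarrow> \<forall>\<^sub>F n in sequentially. \<eta> n x = 1"
proof -
  define F where "F = {ball c r |c r. 0 < r \<and> cball c r \<subseteq> U}"
  have UF: "\<Union>F = U"
  proof (intro equalityI subsetI)
    fix x assume "x \<in> U"
    then obtain r where "0 < r" "cball x r \<subseteq> U"
      using \<open>open U\<close> open_contains_cball by blast
    then show "x \<in> \<Union>F" by (auto simp: F_def intro!: exI[of _ "ball x r"])
  next
    fix x assume "x \<in> \<Union>F"
    then obtain c r where "x \<in> ball c r" "cball c r \<subseteq> U" unfolding F_def by blast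
    then show "x \<in> U" using ball_subset_cball by blast
  qed
  obtain F' where F': "F' \<subseteq> F" "countable F'" "\<Union>F' = U"
    using Lindelof[of F] UF unfolding F_def by (smt (verit, best) mem_Collect_eq open_ball)
  with \<open>U \<noteq> {}\<close> have "F' \<noteq> {}" by auto
  have "\<exists>c r. from_nat_into F' j = ball c r \<and> 0 < r \<and> cball c r \<subseteq> U" for j
    using from_nat_into[OF \<open>F' \<noteq> {}\<close>, of j] F'(1) unfolding F_def by blast
  then obtain c r where cr: "\<And>j. from_nat_into F' j = ball (c j) (r j)" "\<And>j. 0 < r j"
      "\<And>j. cball (c j) (r j) \<subseteq> U"
    by metis
  have "\<forall>j. \<exists>b. (\<exists>db. C1_gradient b db) \<and> (\<forall>x. 0 \<le> b x) \<and> (\<forall>x. 0 < b x \<longleftrightarrow> x \<in> ball (c j) (r j))"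
    using C1_bump[OF cr(2)] by blast
  then obtain b where b: "\<And>j. \<exists>db. C1_gradient (b j) db" "\<And>j x. 0 \<le> b j x"
      "\<And>j x. 0 < b j x \<longleftrightarrow> x \<in> ball (c j) (r j)"
    by (auto dest!: choice)
  have "\<forall>j. \<exists>d. C1_gradient (b j) d" using b(1) by blast
  then obtain db where db: "\<And>j. C1_gradient (b j) (db j)" by (auto dest!: choice)
  \<comment> \<open>The factor \<open>n\<close> makes \<open>s n x\<close> exceed 1 as soon as one bump is positive at \<open>x\<close> and \<open>n\<close> is large.\<close>
  define s where "s n x = real n * (\<Sum>j<n. b j x)" for n x
  have "\<exists>d. C1_gradient (s n) d" for n
  proof -
    have "C1_gradient (\<lambda>x. \<Sum>j<n. b j x) (\<lambda>x. \<Sum>j<n. db j x)"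
      by (rule C1_gradient_sum) (simp_all add: db)
    then have "C1_gradient (s n) (\<lambda>x. real n *\<^sub>R (\<Sum>j<n. db j x) + (\<Sum>j<n. b j x) *\<^sub>R 0)"
      unfolding s_def by (rule C1_gradient_mult[OF C1_gradient_const])
    then show ?thesis by (intro exI)
  qed
  then have "\<forall>n. \<exists>d. C1_gradient (s n) d" by (rule allI)
  then obtain ds where ds: "\<And>n. C1_gradient (s n) (ds n)" by (auto dest!: choice)
  show thesis
  proof (rule that[of "\<lambda>n x. smooth_step (s n x)" "\<lambda>n x. tent (s n x) *\<^sub>R ds n x" "\<lambda>n. \<Union>j<n. cball (c j) (r j)"])
    show "C1_gradient (\<lambda>x. smooth_step (s n x)) (\<lambda>x. tent (s n x) *\<^sub>R ds n x)" for n
      by (rule C1_gradient_compose[OF ds DERIV_smooth_step]) (intro continuous_intros)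
    show "smooth_step (s n x) = 0" if "x \<notin> (\<Union>j<n. cball (c j) (r j))" for n x
    proof -
      have "b j x = 0" if "j < n" for j
        using b(2)[of j x] b(3)[of j x] \<open>x \<notin> _\<close> that by (fastforce simp: less_le)
      then show ?thesis by (simp add: s_def smooth_step_eq_0)
    qed
    show "\<forall>\<^sub>F n in sequentially. smooth_step (s n x) = 1" if "x \<in> U" for x
    proof -
      from that F' obtain i where "x \<in> from_nat_into F' i"
        by (metis UnionE from_nat_into_surj)
      then have "b i x > 0" using cr b by auto
      then obtain m :: nat where m: "1 / b i x < real m" using reals_Archimedean2 by blast
      have "smooth_step (s n x) = 1" if n: "n \<ge> max (Suc i) m" for n
      proof -
        have "1 \<le> real m * b i x" using m \<open>b i x > 0\<close> by (simp add: field_simps)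
        also have "\<dots> \<le> real n * (\<Sum>j<n. b j x)"
          using n b(2) by (intro mult_mono member_le_sum) (auto intro: sum_nonneg)
        finally show ?thesis by (simp add: s_def smooth_step_eq_1)
      qed
      then show ?thesis by (auto simp: eventually_sequentially intro!: exI[of _ "max (Suc i) m"])
    qed
    show "(\<Union>j<n. cball (c j) (r j)) \<subseteq> U" for n
      using cr(3) by blast
  qed (use smooth_step_bounds in \<open>auto intro!: compact_UN\<close>)
qed

text \<open>The derivative of $y \mapsto y/|y|$ is the projection onto the tangent space of the sphere, divided by
  the norm of \<open>y\<close>.\<close>

lemma GDERIV_homogeneous:
  fixes y :: "'a::euclidean_space"
  assumes f: "GDERIV f (sgn y) :> d" and y: "y \<noteq> 0"
  shows "GDERIV (\<lambda>y. f (sgn y)) y :> (d - (sgn y \<bullet> d) *\<^sub>R sgn y) /\<^sub>R norm y"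
proof -
  have 1: "(sgn has_derivative (\<lambda>h. (h - (h \<bullet> sgn y) *\<^sub>R sgn y) /\<^sub>R norm y)) (at y)"
  proof -
    have "norm y \<noteq> 0" using y by simp
    note inv = Deriv.has_derivative_inverse[OF this has_derivative_norm[OF y]]
    note der = has_derivative_scaleR[OF inv has_derivative_ident]
    show ?thesis
      unfolding sgn_div_norm[abs_def]
      by (rule has_derivative_eq_rhs[OF der])
         (simp add: fun_eq_iff sgn_div_norm algebra_simps)
  qed
  have "((\<lambda>y. f (sgn y)) has_derivative
     (\<lambda>h. ((h - (h \<bullet> sgn y) *\<^sub>R sgn y) /\<^sub>R norm y) \<bullet> d)) (at y)"
    using has_derivative_compose[OF 1 f[unfolded gderiv_def]] .
  moreover have "((h - (h \<bullet> sgn y) *\<^sub>R sgn y) /\<^sub>R norm y) \<bullet> d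
      = h \<bullet> ((d - (sgn y \<bullet> d) *\<^sub>R sgn y) /\<^sub>R norm y)" for h
    by (simp add: inner_diff_left inner_diff_right mult_ac)
  ultimately show ?thesis by (simp only: gderiv_def)
qed

lemma continuous_on_sgn [continuous_intros]:
  fixes f :: "'b::topological_space \<Rightarrow> 'a::real_normed_vector"
  shows "continuous_on S f \<Longrightarrow> \<forall>x\<in>S. f x \<noteq> 0 \<Longrightarrow> continuous_on S (\<lambda>x. sgn (f x))"
  unfolding sgn_div_norm by (intro continuous_on_scaleR continuous_on_inverse continuous_on_norm) auto

text \<open>The angular factor is homogeneous of degree zero, so its gradient is orthogonal to \<open>y\<close>: the derivative in
  the radial direction involves the values of \<open>f\<close> but not its gradient. Near the origin, where
  $y/|y|$ is singular, the radial factor is zero.\<close>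

lemma C1_radial_times_angular:
  fixes f :: "'a::euclidean_space \<Rightarrow> real"
  assumes A: "\<And>\<rho>. DERIV A \<rho> :> A' \<rho>" "continuous_on UNIV A'"
    and s: "0 < s" "\<And>\<rho>. \<rho> \<le> s \<Longrightarrow> A \<rho> = 0" "\<And>\<rho>. \<rho> \<le> s \<Longrightarrow> A' \<rho> = 0"
    and f: "C1_gradient f df"
  obtains dq where "C1_gradient (\<lambda>y. A (norm y) * f (sgn y)) dq"
    "\<And>y. y \<bullet> dq y = norm y * A' (norm y) * f (sgn y)"
proof
  let ?T = "\<lambda>y. (df (sgn y) - (sgn y \<bullet> df (sgn y)) *\<^sub>R sgn y) /\<^sub>R norm y"
  let ?dq = "\<lambda>y. if y = 0 then 0 else A (norm y) *\<^sub>R ?T y + f (sgn y) *\<^sub>R (A' (norm y) *\<^sub>R sgn y)"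
  have contA: "continuous_on UNIV A"
    using A(1) by (meson DERIV_continuous_on DERIV_subset subset_UNIV)
  have contf: "continuous_on UNIV f" "continuous_on UNIV df"
    using f C1_gradient_continuous[OF f] by (auto simp: C1_gradient_def)
  have "GDERIV (\<lambda>y. A (norm y) * f (sgn y)) y :> ?dq y" for y
  proof (cases "y = 0")
    case True
    have "GDERIV (\<lambda>y. A (norm y) * f (sgn y)) y :> 0"
      by (rule GDERIV_transform[OF GDERIV_const[of 0], of "ball 0 s"]) (use s True in auto)
    then show ?thesis using True by simp
  next
    case False
    have "GDERIV (\<lambda>y. A (norm y)) y :> A' (norm y) *\<^sub>R sgn y"
      using False by (intro GDERIV_DERIV_compose[where f=norm] GDERIV_norm A)
    moreover have "GDERIV (\<lambda>y. f (sgn y)) y :> ?T y"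
      using f False by (intro GDERIV_homogeneous) (auto simp: C1_gradient_def)
    ultimately have "GDERIV (\<lambda>y. A (norm y) * f (sgn y)) y :>
       A (norm y) *\<^sub>R ?T y + f (sgn y) *\<^sub>R (A' (norm y) *\<^sub>R sgn y)"
      by (rule GDERIV_mult)
    then show ?thesis using False by simp
  qed
  moreover have "continuous_on UNIV ?dq"
  proof -
    have "continuous_on (- {0}) ?dq"
    proof (rule continuous_on_eq)
      show "continuous_on (- {0}) (\<lambda>y. A (norm y) *\<^sub>R ?T y + f (sgn y) *\<^sub>R (A' (norm y) *\<^sub>R sgn y))"
        by (intro continuous_intros continuous_on_compose2[OF contA] continuous_on_compose2[OF A(2)]
            continuous_on_compose2[OF contf(1)] continuous_on_compose2[OF contf(2)]) auto
    qed auto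
    \<comment> \<open>The ball fills the puncture at the origin, where the formula for \<open>?dq\<close> is singular.\<close>
    moreover have "continuous_on (ball 0 s) ?dq"
      by (rule continuous_on_eq[where f="\<lambda>y. 0"]) (use s in auto)
    ultimately have "continuous_on (- {0} \<union> ball 0 s) ?dq"
      by (intro continuous_on_open_Un) auto
    moreover have "- {0} \<union> ball (0::'a) s = UNIV" using s by auto
    ultimately show ?thesis by simp
  qed
  ultimately show "C1_gradient (\<lambda>y. A (norm y) * f (sgn y)) ?dq"
    unfolding C1_gradient_def by blast
  show "y \<bullet> ?dq y = norm y * A' (norm y) * f (sgn y)" for y
  proof (cases "y = 0")
    case False
    have y: "y = norm y *\<^sub>R sgn y" using False by (simp add: sgn_div_norm)
    have 1: "sgn y \<bullet> sgn y = 1" using False by (simp add: dot_square_norm norm_sgn)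
    have 2: "y \<bullet> d = norm y * (sgn y \<bullet> d)" for d by (subst y) simp
    show ?thesis using False
      by (simp add: 2 1 inner_add_right inner_diff_right)
  qed simp
qed

text \<open>A radial multiple of \<open>y\<close> is always a gradient, namely that of an antiderivative of $\rho A(\rho)$
  evaluated at the norm; the constant of integration makes it vanish outside the ball.\<close>

lemma C1_radial:
  fixes A :: "real \<Rightarrow> real"
  assumes A: "continuous_on UNIV A" and s: "0 < s" "\<And>\<rho>. \<rho> \<le> s \<Longrightarrow> A \<rho> = 0"
    and t: "s \<le> t" "\<And>\<rho>. \<rho> \<ge> t \<Longrightarrow> A \<rho> = 0"
  obtains \<phi> where "C1_gradient \<phi> (\<lambda>y::'a::euclidean_space. A (norm y) *\<^sub>R y)"
    "\<And>y. norm y \<ge> t \<Longrightarrow> \<phi> y = 0"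
proof
  let ?B = "\<lambda>\<tau>. \<tau> * A \<tau>"
  define \<Phi> where "\<Phi> \<rho> = integral {0..\<rho>} ?B - integral {0..t} ?B" for \<rho>
  have contB: "continuous_on S ?B" for S
    by (rule continuous_on_mult[OF continuous_on_id continuous_on_subset[OF A subset_UNIV]])
  have int: "?B integrable_on {a..b}" for a b
    by (rule integrable_continuous_real[OF contB])
  have DERIV: "DERIV \<Phi> \<rho> :> ?B \<rho>" if "\<rho> > 0" for \<rho>
  proof -
    have "((\<lambda>\<rho>. integral {0..\<rho>} ?B) has_real_derivative ?B \<rho>) (at \<rho> within {0..\<rho>+1})"
      using that contB by (intro integral_has_real_derivative) auto
    then have "((\<lambda>\<rho>. integral {0..\<rho>} ?B) has_real_derivative ?B \<rho>) (at \<rho>)"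
      using that at_within_Icc_at[of 0 \<rho> "\<rho>+1"] by simp
    from DERIV_diff[OF this DERIV_const[of "integral {0..t} ?B"]] show ?thesis
      unfolding \<Phi>_def by simp
  qed
  have small: "\<Phi> \<rho> = - integral {0..t} ?B" if "\<rho> \<le> s" for \<rho>
  proof -
    have "integral {0..\<rho>} ?B = integral {0..\<rho>} (\<lambda>_. 0)"
      using that s by (intro integral_cong) auto
    then show ?thesis by (simp add: \<Phi>_def)
  qed
  have "GDERIV (\<lambda>y::'a. \<Phi> (norm y)) y :> A (norm y) *\<^sub>R y" for y
  proof (cases "y = 0")
    case True
    have "GDERIV (\<lambda>y. \<Phi> (norm y)) y :> 0"
      by (rule GDERIV_transform[OF GDERIV_const[of "- integral {0..t} ?B"], of "ball 0 s"])
         (use s True small in auto)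
    then show ?thesis using True by simp
  next
    case False
    then have "GDERIV (\<lambda>y. \<Phi> (norm y)) y :> ?B (norm y) *\<^sub>R sgn y"
      by (intro GDERIV_DERIV_compose[where f=norm] GDERIV_norm DERIV) auto
    moreover have "?B (norm y) *\<^sub>R sgn y = A (norm y) *\<^sub>R y"
      using False by (simp add: sgn_div_norm)
    ultimately show ?thesis by (simp only:)
  qed
  moreover have "continuous_on UNIV (\<lambda>y::'a. A (norm y) *\<^sub>R y)"
    by (intro continuous_intros continuous_on_compose2[OF A]) auto
  ultimately show "C1_gradient (\<lambda>y::'a. \<Phi> (norm y)) (\<lambda>y. A (norm y) *\<^sub>R y)"
    by (simp add: C1_gradient_def)
  show "\<Phi> (norm y) = 0" if "norm y \<ge> t" for y :: 'a
  proof -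
    have "integral {0..norm y} ?B = integral {0..t} ?B + integral {t..norm y} ?B"
      using that s t int by (intro Henstock_Kurzweil_Integration.integral_combine[symmetric]) auto
    moreover have "integral {t..norm y} ?B = integral {t..norm y} (\<lambda>_. 0)"
      using t by (intro integral_cong) auto
    ultimately show ?thesis by (simp add: \<Phi>_def)
  qed
qed

section \<open>Integrability\<close>

lemma bounded_of_compact_support:
  fixes h :: "'a::topological_space \<Rightarrow> real"
  assumes "continuous_on UNIV h" "compact K" "\<And>x. x \<notin> K \<Longrightarrow> h x = 0"
  obtains B where "0 \<le> B" "\<And>x. \<bar>h x\<bar> \<le> B"
proof -
  have "bounded (h ` K)"
    using assms by (intro compact_imp_bounded compact_continuous_image) (auto intro: continuous_on_subset)
  then obtain B where B: "\<And>x. x \<in> K \<Longrightarrow> \<bar>h x\<bar> \<le> B" by (auto simp: bounded_iff)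
  show thesis
  proof (rule that[of "max 0 B"])
    show "\<bar>h x\<bar> \<le> max 0 B" for x using B[of x] assms(3)[of x] by (cases "x \<in> K") auto
  qed auto
qed

lemma borel_measurable_lebesgue_of_borel:
  "f \<in> borel_measurable borel \<Longrightarrow> f \<in> borel_measurable (lebesgue :: 'a::euclidean_space measure)"
  by (simp add: measurable_completion)

lemma absolutely_integrable_compact_product:
  fixes w :: "'a::euclidean_space \<Rightarrow> 'b::euclidean_space" and g :: "'a \<Rightarrow> 'c::euclidean_space"
    and p :: "'b \<Rightarrow> 'c \<Rightarrow> 'd::euclidean_space"
  assumes "bounded_bilinear p" "compact K" "continuous_on K w" "g absolutely_integrable_on K"
  shows "(\<lambda>x. p (w x) (g x)) absolutely_integrable_on K"
proof -
  have K: "K \<in> sets lebesgue" using \<open>compact K\<close> by (simp add: borel_compact)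
  show ?thesis
  proof (rule absolutely_integrable_bounded_measurable_product[where h=p])
    show "bilinear p" using assms by (simp add: bilinear_conv_bounded_bilinear)
    show "w \<in> borel_measurable (lebesgue_on K)"
      by (rule continuous_imp_measurable_on_sets_lebesgue[OF assms(3) K])
    show "bounded (w ` K)"
      using assms by (intro compact_imp_bounded compact_continuous_image)
  qed (use assms K in auto)
qed

lemma set_lebesgue_integral_shrink:
  assumes "K \<subseteq> D" "\<And>x. x \<in> D \<Longrightarrow> x \<notin> K \<Longrightarrow> F x = 0"
  shows "set_lebesgue_integral M D F = set_lebesgue_integral M K F"
proof -
  have "(\<lambda>x. indicat_real D x *\<^sub>R F x) = (\<lambda>x. indicat_real K x *\<^sub>R F x)"
    using assms by (force simp: indicator_def)
  then show ?thesis by (simp add: set_lebesgue_integral_def)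
qed

lemma set_integral_sum_inner:
  fixes F :: "'b::euclidean_space \<Rightarrow> 'a \<Rightarrow> 'b"
  assumes "\<And>b. b \<in> Basis \<Longrightarrow> set_integrable M K (F b)"
  shows "(LINT x:K|M. (\<Sum>b\<in>Basis. F b x \<bullet> b)) = (\<Sum>b\<in>Basis. (LINT x:K|M. F b x) \<bullet> b)"
proof -
  have 1: "integrable M (\<lambda>x. indicator K x *\<^sub>R F b x)" if "b \<in> Basis" for b
    using assms[OF that] by (simp add: set_integrable_def)
  have "(LINT x:K|M. (\<Sum>b\<in>Basis. F b x \<bullet> b)) = (LINT x|M. (\<Sum>b\<in>Basis. (indicator K x *\<^sub>R F b x) \<bullet> b))"
    by (simp add: set_lebesgue_integral_def sum_distrib_left)
  also have "\<dots> = (\<Sum>b\<in>Basis. (LINT x|M. (indicator K x *\<^sub>R F b x) \<bullet> b))"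
    using 1 by (intro Bochner_Integration.integral_sum integrable_inner_left) auto
  also have "\<dots> = (\<Sum>b\<in>Basis. (LINT x:K|M. F b x) \<bullet> b)"
    unfolding set_lebesgue_integral_def
    using 1 by (intro sum.cong refl integral_inner_left) auto
  finally show ?thesis .
qed

text \<open>Since $t \le 1 + t^2$ and the set has finite measure.\<close>

lemma L2_on_imp_absolutely_integrable:
  fixes f :: "'a::euclidean_space \<Rightarrow> 'b::euclidean_space"
  assumes f: "L2_on S f" and S: "S \<in> sets lebesgue" "bounded S"
  shows "f absolutely_integrable_on S"
  unfolding set_integrable_def
proof (rule Bochner_Integration.integrable_bound)
  have "emeasure lebesgue S < \<infinity>"
    using fmeasurableD2[OF bounded_set_imp_lmeasurable[OF S(2,1)]] by (simp only: less_top infinity_ennreal_def)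
  then have "integrable lebesgue (indicator S :: 'a \<Rightarrow> real)" using S(1) by (rule integrable_real_indicator[rotated])
  moreover have "integrable lebesgue (\<lambda>x. indicator S x *\<^sub>R (norm (f x))\<^sup>2)"
    using f by (simp add: L2_on_def set_integrable_def)
  ultimately show "integrable lebesgue (\<lambda>x. indicator S x + indicator S x *\<^sub>R (norm (f x))\<^sup>2 :: real)"
    by (rule Bochner_Integration.integrable_add)
  show "(\<lambda>x. indicat_real S x *\<^sub>R f x) \<in> borel_measurable lebesgue"
    using f by (simp add: L2_on_def set_borel_measurable_def)
  have "t \<le> 1 + t\<^sup>2" for t :: real
  proof -
    have "0 \<le> (t - 1)\<^sup>2" "0 \<le> t\<^sup>2" by simp_all
    moreover have "(t - 1)\<^sup>2 = t\<^sup>2 - 2 * t + 1" by (simp add: power2_eq_square algebra_simps)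
    ultimately show ?thesis by linarith
  qed
  then show "AE x in lebesgue. norm (indicat_real S x *\<^sub>R f x) \<le> norm (indicator S x + indicator S x *\<^sub>R (norm (f x))\<^sup>2 :: real)"
    by (intro AE_I2) (auto simp: indicator_def)
qed

section \<open>Weak solutions near the vertex of a cone\<close>

text \<open>The situation around the vertex: up to distance \<open>\<delta>\<close> from \<open>x0\<close> the domain \<open>D\<close> is the cone \<open>C\<close>, moved
  to \<open>x0\<close>. The test functions in the Neumann condition may be nonzero on the lateral boundary of the
  cone. Near that boundary \<open>v\<close> is only known to be integrable.\<close>

locale neumann_cone =
  fixes C D :: "'a::euclidean_space set" and x0 :: 'a and \<delta> :: real
    and v :: "'a \<Rightarrow> real" and g :: "'a \<Rightarrow> 'a"
  assumes open_C: "open C" and cone: "\<And>t x. 0 < t \<Longrightarrow> x \<in> C \<Longrightarrow> t *\<^sub>R x \<in> C"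
    and C_nonempty: "C \<noteq> {}" and zero_notin_C: "0 \<notin> C" and \<delta>_pos: "0 < \<delta>"
    and open_D: "open D" and D_iff: "\<And>y. norm y < \<delta> \<Longrightarrow> x0 + y \<in> D \<longleftrightarrow> y \<in> C"
    and cont: "continuous_on D v"
    and vertex_limit: "(v \<longlongrightarrow> v x0) (at x0 within D)"
    and v_L1: "\<And>r. r < \<delta> \<Longrightarrow> v absolutely_integrable_on (D \<inter> ball x0 r)"
    and g_L1: "\<And>r. r < \<delta> \<Longrightarrow> g absolutely_integrable_on (D \<inter> ball x0 r)"
    and gradient: "weak_gradient D v g"
    and neumann: "\<And>r \<phi> d\<phi>. r < \<delta> \<Longrightarrow> C1_gradient \<phi> d\<phi> \<Longrightarrow> (\<And>x. x \<notin> ball x0 r \<Longrightarrow> \<phi> x = 0) \<Longrightarrow>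
       (LINT x:D|lebesgue. g x \<bullet> d\<phi> x) = 0"
begin

text \<open>The vector field $A(|y|)\,f(y/|y|)\,y$ with $y = x - x_0$ has compact support in \<open>D\<close>, since \<open>f\<close> cuts off the
  directions near the lateral boundary. Yet its divergence $(N A + |y| A')\,f$ contains no derivative of
  \<open>f\<close>, because the field is radial. This is the weak counterpart of the fact that rays do not cross
  the boundary of a cone; \<open>f\<close> may therefore later be replaced by 1.\<close>

lemma weak_gradient_product:
  fixes A A' :: "real \<Rightarrow> real"
  assumes A: "\<And>\<rho>. DERIV A \<rho> :> A' \<rho>" "continuous_on UNIV A'"
    and s: "0 < s" "\<And>\<rho>. \<rho> \<le> s \<Longrightarrow> A \<rho> = 0" "\<And>\<rho>. \<rho> \<le> s \<Longrightarrow> A' \<rho> = 0"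
    and t: "s \<le> t" "t < \<delta>" "\<And>\<rho>. \<rho> \<ge> t \<Longrightarrow> A \<rho> = 0"
    and f: "C1_gradient f df" and L: "compact L" "L \<subseteq> C" "\<And>x. x \<notin> L \<Longrightarrow> f x = 0"
  shows "(LINT x:D|lebesgue. v x * ((real DIM('a) * A (norm (x - x0)) + norm (x - x0) * A' (norm (x - x0))) * f (sgn (x - x0))))
     = - (LINT x:D|lebesgue. A (norm (x - x0)) * f (sgn (x - x0)) * (g x \<bullet> (x - x0)))"
proof -
  obtain dq where dq: "C1_gradient (\<lambda>y. A (norm y) * f (sgn y)) dq"
    "\<And>y. y \<bullet> dq y = norm y * A' (norm y) * f (sgn y)"
    using C1_radial_times_angular[OF A s f] by blast
  define q where "q y = A (norm y) * f (sgn y)" for y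
  define K where "K = (\<lambda>(\<rho>, \<theta>). x0 + \<rho> *\<^sub>R \<theta>) ` ({s..t} \<times> (L \<inter> sphere 0 1))"
  have "compact K"
    unfolding K_def case_prod_unfold using L(1)
    by (intro compact_continuous_image continuous_intros compact_Times compact_Int_closed) auto
  have "K \<subseteq> D"
  proof
    fix x assume "x \<in> K"
    then obtain \<rho> \<theta> where x: "x = x0 + \<rho> *\<^sub>R \<theta>" "s \<le> \<rho>" "\<rho> \<le> t" "\<theta> \<in> L" "norm \<theta> = 1"
      by (auto simp: K_def)
    then show "x \<in> D" using L(2) cone[of \<rho> \<theta>] s(1) t by (auto simp: D_iff)
  qed
  have q_0: "q (x - x0) = 0" if "x \<notin> K" for x
  proof (rule ccontr)
    assume "q (x - x0) \<noteq> 0"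
    then have ne: "A (norm (x - x0)) \<noteq> 0" "sgn (x - x0) \<in> L" using L(3) by (auto simp: q_def)
    then have st: "s < norm (x - x0)" "norm (x - x0) < t"
      using s(2) t(3) by (meson not_le)+
    then have "x - x0 \<noteq> 0" using s(1) by auto
    then have "x = x0 + norm (x - x0) *\<^sub>R sgn (x - x0)" "norm (sgn (x - x0)) = 1"
      by (simp_all add: sgn_div_norm)
    with ne st have "x \<in> K" unfolding K_def
      by (intro image_eqI[where x="(norm (x - x0), sgn (x - x0))"]) auto
    with that show False by simp
  qed
  \<comment> \<open>The components of the field; each of them is a scalar test function.\<close>
  define \<phi> where "\<phi> b x = ((x - x0) \<bullet> b) * q (x - x0)" for b x
  define d\<phi> where "d\<phi> b x = ((x - x0) \<bullet> b) *\<^sub>R dq (x - x0) + q (x - x0) *\<^sub>R b" for b x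
  have C1: "C1_gradient (\<phi> b) (d\<phi> b)" for b
  proof -
    have "C1_gradient (\<lambda>y. y \<bullet> b) (\<lambda>y. b)"
      by (auto simp: C1_gradient_def gderiv_def intro!: derivative_eq_intros)
    from C1_gradient_shift[OF C1_gradient_mult[OF this dq(1)], of x0]
    show ?thesis by (simp add: \<phi>_def[abs_def] d\<phi>_def[abs_def] q_def)
  qed
  have \<phi>_0: "\<phi> b x = 0" if "x \<notin> K" for b x using q_0[OF that] by (simp add: \<phi>_def)
  have d\<phi>_0: "d\<phi> b x = 0" if "x \<notin> K" for b x
  proof (rule GDERIV_eq_0)
    show "GDERIV (\<phi> b) x :> d\<phi> b x" using C1[of b] by (simp add: C1_gradient_def)
    show "open (- K)" using \<open>compact K\<close> by (simp add: compact_imp_closed open_Compl)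
  qed (use that \<phi>_0 in auto)
  have L1: "v absolutely_integrable_on K" "g absolutely_integrable_on K"
    using gradient \<open>compact K\<close> \<open>K \<subseteq> D\<close> by (auto simp: weak_gradient_def)
  have eq: "(LINT x:K|lebesgue. v x *\<^sub>R d\<phi> b x) = - (LINT x:K|lebesgue. \<phi> b x *\<^sub>R g x)" for b
  proof -
    have sub: "closure {x \<in> D. \<phi> b x \<noteq> 0} \<subseteq> K"
      by (rule closure_minimal) (use \<phi>_0 \<open>compact K\<close> compact_imp_closed in auto)
    then have "compact (closure {x \<in> D. \<phi> b x \<noteq> 0})"
      using compact_Int_closed[OF \<open>compact K\<close> closed_closure[of "{x \<in> D. \<phi> b x \<noteq> 0}"]]
      by (simp only: Int_absorb1)
    with sub \<open>K \<subseteq> D\<close> C1[of b] have "C1_test D (\<phi> b) (d\<phi> b)"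
      unfolding C1_test_def C1_gradient_def by blast
    with gradient have "(LINT x:D|lebesgue. v x *\<^sub>R d\<phi> b x) = - (LINT x:D|lebesgue. \<phi> b x *\<^sub>R g x)"
      unfolding weak_gradient_def by simp
    moreover have "(LINT x:D|lebesgue. v x *\<^sub>R d\<phi> b x) = (LINT x:K|lebesgue. v x *\<^sub>R d\<phi> b x)"
      by (rule set_lebesgue_integral_shrink[OF \<open>K \<subseteq> D\<close>]) (simp add: d\<phi>_0)
    moreover have "(LINT x:D|lebesgue. \<phi> b x *\<^sub>R g x) = (LINT x:K|lebesgue. \<phi> b x *\<^sub>R g x)"
      by (rule set_lebesgue_integral_shrink[OF \<open>K \<subseteq> D\<close>]) (simp add: \<phi>_0)
    ultimately show ?thesis by simp
  qed
  have int1: "set_integrable lebesgue K (\<lambda>x. v x *\<^sub>R d\<phi> b x)" for b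
  proof (rule absolutely_integrable_compact_product[where p="\<lambda>y x. x *\<^sub>R y" and w="d\<phi> b", OF _ \<open>compact K\<close> _ L1(1)])
    show "bounded_bilinear (\<lambda>(y::'a) (x::real). x *\<^sub>R y)"
      by (rule bounded_bilinear.flip[OF bounded_bilinear_scaleR])
    show "continuous_on K (d\<phi> b)"
      using C1[of b] by (auto simp: C1_gradient_def intro: continuous_on_subset)
  qed
  have int2: "set_integrable lebesgue K (\<lambda>x. \<phi> b x *\<^sub>R g x)" for b
    by (rule absolutely_integrable_compact_product[where p=scaleR and w="\<phi> b", OF bounded_bilinear_scaleR \<open>compact K\<close> _ L1(2)])
       (rule continuous_on_subset[OF C1_gradient_continuous[OF C1[of b]] subset_UNIV])
  have div: "v x * ((real DIM('a) * A (norm (x - x0)) + norm (x - x0) * A' (norm (x - x0))) * f (sgn (x - x0)))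
      = (\<Sum>b\<in>Basis. (v x *\<^sub>R d\<phi> b x) \<bullet> b)" for x
  proof -
    have "(\<Sum>b\<in>Basis. d\<phi> b x \<bullet> b) = (x - x0) \<bullet> dq (x - x0) + real DIM('a) * q (x - x0)"
      by (simp add: d\<phi>_def inner_add_left sum.distrib euclidean_inner[of "x - x0" "dq (x - x0)"])
    then show ?thesis
      by (simp add: sum_distrib_left[symmetric] dq(2) q_def algebra_simps)
  qed
  have flux: "A (norm (x - x0)) * f (sgn (x - x0)) * (g x \<bullet> (x - x0)) = (\<Sum>b\<in>Basis. (\<phi> b x *\<^sub>R g x) \<bullet> b)" for x
    by (simp add: \<phi>_def q_def euclidean_inner[of "g x" "x - x0"] sum_distrib_left sum_distrib_right mult_ac)
  have "(LINT x:K|lebesgue. (\<Sum>b\<in>Basis. (v x *\<^sub>R d\<phi> b x) \<bullet> b)) =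
      - (LINT x:K|lebesgue. (\<Sum>b\<in>Basis. (\<phi> b x *\<^sub>R g x) \<bullet> b))"
    by (simp only: set_integral_sum_inner[OF int1] set_integral_sum_inner[OF int2] eq inner_minus_left sum_negf)
  moreover have "(LINT x:D|lebesgue. (\<Sum>b\<in>Basis. (v x *\<^sub>R d\<phi> b x) \<bullet> b)) = (LINT x:K|lebesgue. (\<Sum>b\<in>Basis. (v x *\<^sub>R d\<phi> b x) \<bullet> b))"
    by (rule set_lebesgue_integral_shrink[OF \<open>K \<subseteq> D\<close>]) (simp add: d\<phi>_0)
  moreover have "(LINT x:D|lebesgue. (\<Sum>b\<in>Basis. (\<phi> b x *\<^sub>R g x) \<bullet> b)) = (LINT x:K|lebesgue. (\<Sum>b\<in>Basis. (\<phi> b x *\<^sub>R g x) \<bullet> b))"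
    by (rule set_lebesgue_integral_shrink[OF \<open>K \<subseteq> D\<close>]) (simp add: \<phi>_0)
  ultimately show ?thesis unfolding div flux by simp
qed

text \<open>A radial test function is admissible for the Neumann condition without any cutoff near the lateral
  boundary, and every \<open>A(|y|) y\<close> is the gradient of one.\<close>

lemma neumann_radial:
  fixes A :: "real \<Rightarrow> real"
  assumes A: "continuous_on UNIV A" and s: "0 < s" "\<And>\<rho>. \<rho> \<le> s \<Longrightarrow> A \<rho> = 0"
    and t: "s \<le> t" "t < \<delta>" "\<And>\<rho>. \<rho> \<ge> t \<Longrightarrow> A \<rho> = 0"
  shows "(LINT x:D|lebesgue. A (norm (x - x0)) * (g x \<bullet> (x - x0))) = 0"
proof -
  obtain \<phi> where \<phi>: "C1_gradient \<phi> (\<lambda>y::'a. A (norm y) *\<^sub>R y)" "\<And>y. norm y \<ge> t \<Longrightarrow> \<phi> y = 0"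
    using C1_radial[OF A s t(1,3)] by blast
  have "(LINT x:D|lebesgue. g x \<bullet> (A (norm (x - x0)) *\<^sub>R (x - x0))) = 0"
    by (rule neumann[OF t(2) C1_gradient_shift[OF \<phi>(1)]])
      (auto intro!: \<phi>(2) simp: dist_norm norm_minus_commute)
  then show ?thesis by simp
qed

section \<open>Spherical integrals and radial flux\<close>

lemma in_D_iff: "norm \<theta> = 1 \<Longrightarrow> 0 < \<rho> \<Longrightarrow> \<rho> < \<delta> \<Longrightarrow> x0 + \<rho> *\<^sub>R \<theta> \<in> D \<longleftrightarrow> \<theta> \<in> C"
  using D_iff[of "\<rho> *\<^sub>R \<theta>"] cone[of "inverse \<rho>" "\<rho> *\<^sub>R \<theta>"] cone[of \<rho> \<theta>] by auto

text \<open>The extension of \<open>v\<close> by zero, which is Borel measurable on the whole space.\<close>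

definition vD :: "'a \<Rightarrow> real" where "vD x = indicator D x * v x"

lemma vD_measurable [measurable]: "vD \<in> borel_measurable borel"
  using borel_measurable_continuous_on_indicator[OF _ cont] open_D by (simp add: vD_def[abs_def])

lemma vD_outside: "norm \<theta> = 1 \<Longrightarrow> 0 < \<rho> \<Longrightarrow> \<rho> < \<delta> \<Longrightarrow> \<theta> \<notin> C \<Longrightarrow> vD (x0 + \<rho> *\<^sub>R \<theta>) = 0"
  by (simp add: vD_def in_D_iff)

lemma vD_L1:
  assumes "r < \<delta>" shows "integrable lborel (\<lambda>x. indicator (ball x0 r) x * vD x)"
proof -
  have "integrable lebesgue (\<lambda>x. indicator (D \<inter> ball x0 r) x *\<^sub>R v x)"
    using v_L1[OF assms] by (simp add: set_integrable_def)
  also have "(\<lambda>x. indicator (D \<inter> ball x0 r) x *\<^sub>R v x) = (\<lambda>x. indicator (ball x0 r) x * vD x)"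
    by (auto simp: vD_def indicator_def)
  finally have int: "integrable lebesgue (\<lambda>x. indicator (ball x0 r) x * vD x)" .
  have "(\<lambda>x. indicator (ball x0 r) x * vD x) \<in> borel_measurable borel"
    by (intro borel_measurable_times borel_measurable_indicator vD_measurable) simp
  with int show ?thesis by (simp add: integrable_completion)
qed

lemma g_integrable:
  assumes "r < \<delta>" shows "integrable lebesgue (\<lambda>x. indicator (D \<inter> ball x0 r) x *\<^sub>R g x)"
  using g_L1[OF assms] by (simp add: set_integrable_def)

text \<open>A compact set of directions inside the cone keeps away from the lateral boundary, near which \<open>v\<close> may
  be unbounded.\<close>

lemma vD_bounded_on_sector:
  assumes L: "compact L" "L \<subseteq> C" and ab: "0 < a" "b < \<delta>"
  obtains B where "0 \<le> B"
    "\<And>\<rho> \<theta>. \<rho> \<in> {a..b} \<Longrightarrow> \<theta> \<in> L \<Longrightarrow> norm \<theta> = 1 \<Longrightarrow> x0 + \<rho> *\<^sub>R \<theta> \<in> D \<and> \<bar>vD (x0 + \<rho> *\<^sub>R \<theta>)\<bar> \<le> B"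
proof -
  define K where "K = (\<lambda>(\<rho>, \<theta>). x0 + \<rho> *\<^sub>R \<theta>) ` ({a..b} \<times> (L \<inter> sphere 0 1))"
  have "compact K"
    unfolding K_def case_prod_unfold using L(1)
    by (intro compact_continuous_image continuous_intros compact_Times compact_Int_closed) auto
  have in_D: "x0 + \<rho> *\<^sub>R \<theta> \<in> D" if "\<rho> \<in> {a..b}" "\<theta> \<in> L" "norm \<theta> = 1" for \<rho> \<theta>
    using that ab L cone[of \<rho> \<theta>] by (subst D_iff) auto
  then have "K \<subseteq> D" by (auto simp: K_def)
  then have "bounded (v ` K)"
    using \<open>compact K\<close> cont by (intro compact_imp_bounded compact_continuous_image) (auto intro: continuous_on_subset)
  then obtain B where B: "\<forall>x\<in>K. \<bar>v x\<bar> \<le> B" by (auto simp: bounded_iff)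
  show thesis
  proof (rule that[of "max 0 B"])
    fix \<rho> \<theta> assume *: "\<rho> \<in> {a..b}" "\<theta> \<in> L" "norm \<theta> = 1"
    then have "x0 + \<rho> *\<^sub>R \<theta> \<in> K" by (auto simp: K_def)
    with B have "\<bar>v (x0 + \<rho> *\<^sub>R \<theta>)\<bar> \<le> B" by blast
    with in_D[OF *] show "x0 + \<rho> *\<^sub>R \<theta> \<in> D \<and> \<bar>vD (x0 + \<rho> *\<^sub>R \<theta>)\<bar> \<le> max 0 B"
      by (simp add: vD_def)
  qed simp
qed

lemma vD_continuous_on_sector:
  assumes "0 < \<rho>" "\<rho> < \<delta>"
  shows "continuous_on (C \<inter> sphere 0 1) (\<lambda>\<theta>. vD (x0 + \<rho> *\<^sub>R \<theta>))"
proof (rule continuous_on_eq)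
  have in_D: "x0 + \<rho> *\<^sub>R \<theta> \<in> D" if "\<theta> \<in> C \<inter> sphere 0 1" for \<theta>
    using that assms cone[of \<rho> \<theta>] by (subst D_iff) auto
  then show "continuous_on (C \<inter> sphere 0 1) (\<lambda>\<theta>. v (x0 + \<rho> *\<^sub>R \<theta>))"
    by (intro continuous_on_compose2[OF cont] continuous_intros) auto
  show "v (x0 + \<rho> *\<^sub>R \<theta>) = vD (x0 + \<rho> *\<^sub>R \<theta>)" if "\<theta> \<in> C \<inter> sphere 0 1" for \<theta>
    using in_D[OF that] by (simp add: vD_def)
qed

definition weighted_sphere_integral :: "('a \<Rightarrow> real) \<Rightarrow> real \<Rightarrow> real" where
  "weighted_sphere_integral f \<rho> = (LINT \<theta>|unit_sphere_measure. vD (x0 + \<rho> *\<^sub>R \<theta>) * f \<theta>)"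

lemma weighted_sphere_integral_measurable [measurable]:
  assumes [measurable]: "f \<in> borel_measurable borel"
  shows "weighted_sphere_integral f \<in> borel_measurable borel"
proof -
  interpret finite_measure "unit_sphere_measure :: 'a measure" by (rule finite_unit_sphere_measure)
  have "(\<lambda>\<rho>::real. LINT \<theta>|unit_sphere_measure. vD (x0 + \<rho> *\<^sub>R \<theta>) * f \<theta>) \<in> borel_measurable borel"
    by (rule borel_measurable_lebesgue_integral) measurable
  then show ?thesis by (simp add: weighted_sphere_integral_def[abs_def])
qed

lemma sphere_product_integrable:
  assumes f: "continuous_on UNIV f" and L: "compact L" "L \<subseteq> C" "\<And>x. x \<notin> L \<Longrightarrow> f x = 0"
    and \<rho>: "0 < \<rho>" "\<rho> < \<delta>"
  shows "integrable unit_sphere_measure (\<lambda>\<theta>. vD (x0 + \<rho> *\<^sub>R \<theta>) * f \<theta>)"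
proof -
  interpret finite_measure "unit_sphere_measure :: 'a measure" by (rule finite_unit_sphere_measure)
  have [measurable]: "f \<in> borel_measurable borel" by (rule borel_measurable_continuous_onI[OF f])
  obtain Bf where Bf: "0 \<le> Bf" "\<And>x. \<bar>f x\<bar> \<le> Bf" using bounded_of_compact_support[OF f L(1,3)] by blast
  obtain B where B: "0 \<le> B"
    "\<And>\<theta>. \<theta> \<in> L \<Longrightarrow> norm \<theta> = 1 \<Longrightarrow> \<bar>vD (x0 + \<rho> *\<^sub>R \<theta>)\<bar> \<le> B"
    using vD_bounded_on_sector[OF L(1,2) \<rho>] by (metis atLeastAtMost_iff order_refl)
  show ?thesis
  proof (rule integrable_const_bound[where B="B * Bf"])
    show "AE \<theta> in unit_sphere_measure. norm (vD (x0 + \<rho> *\<^sub>R \<theta>) * f \<theta>) \<le> B * Bf"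
      using AE_unit_sphere_measure
    proof eventually_elim
      fix \<theta> :: 'a assume "norm \<theta> = 1"
      then show "norm (vD (x0 + \<rho> *\<^sub>R \<theta>) * f \<theta>) \<le> B * Bf"
        using B Bf L(3)[of \<theta>] by (cases "\<theta> \<in> L") (simp_all add: abs_mult mult_mono)
    qed
  qed auto
qed

lemma weighted_sphere_integral_continuous:
  assumes f: "continuous_on UNIV f" and L: "compact L" "L \<subseteq> C" "\<And>x. x \<notin> L \<Longrightarrow> f x = 0"
    and ab: "0 < a" "b < \<delta>"
  shows "continuous_on {a..b} (weighted_sphere_integral f)"
proof -
  interpret finite_measure "unit_sphere_measure :: 'a measure" by (rule finite_unit_sphere_measure)
  have [measurable]: "f \<in> borel_measurable borel" by (rule borel_measurable_continuous_onI[OF f])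
  obtain B where B: "0 \<le> B"
    "\<And>\<rho> \<theta>. \<rho> \<in> {a..b} \<Longrightarrow> \<theta> \<in> L \<Longrightarrow> norm \<theta> = 1 \<Longrightarrow> x0 + \<rho> *\<^sub>R \<theta> \<in> D \<and> \<bar>vD (x0 + \<rho> *\<^sub>R \<theta>)\<bar> \<le> B"
    using vD_bounded_on_sector[OF L(1,2) ab] by blast
  obtain Bf where Bf: "0 \<le> Bf" "\<And>x. \<bar>f x\<bar> \<le> Bf" using bounded_of_compact_support[OF f L(1,3)] by blast
  show ?thesis
    unfolding continuous_on_sequentially
  proof (intro allI ballI impI, elim conjE)
    fix X \<rho> assume \<rho>: "\<rho> \<in> {a..b}" and X: "\<forall>n::nat. X n \<in> {a..b}" "X \<longlonglongrightarrow> \<rho>"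
    have "(\<lambda>n. weighted_sphere_integral f (X n)) \<longlonglongrightarrow> weighted_sphere_integral f \<rho>"
      unfolding weighted_sphere_integral_def
    proof (rule integral_dominated_convergence[where w="\<lambda>_. B * Bf"])
      show "AE \<theta> in unit_sphere_measure. (\<lambda>n. vD (x0 + X n *\<^sub>R \<theta>) * f \<theta>) \<longlonglongrightarrow> vD (x0 + \<rho> *\<^sub>R \<theta>) * f \<theta>"
        using AE_unit_sphere_measure
      proof eventually_elim
        fix \<theta> :: 'a assume \<theta>: "norm \<theta> = 1"
        show "(\<lambda>n. vD (x0 + X n *\<^sub>R \<theta>) * f \<theta>) \<longlonglongrightarrow> vD (x0 + \<rho> *\<^sub>R \<theta>) * f \<theta>"
        proof (cases "\<theta> \<in> L")
          case True
          have "(\<lambda>n. v (x0 + X n *\<^sub>R \<theta>)) \<longlonglongrightarrow> v (x0 + \<rho> *\<^sub>R \<theta>)"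
          proof (rule continuous_on_tendsto_compose[OF cont])
            show "(\<lambda>n. x0 + X n *\<^sub>R \<theta>) \<longlonglongrightarrow> x0 + \<rho> *\<^sub>R \<theta>" by (intro tendsto_intros X)
          qed (use B True \<theta> X \<rho> in auto)
          then show ?thesis using B(2)[OF \<rho> True \<theta>] B(2)[OF _ True \<theta>] X(1)
            by (simp add: vD_def tendsto_mult_right)
        qed (use L in auto)
      qed
      show "AE \<theta> in unit_sphere_measure. norm (vD (x0 + X n *\<^sub>R \<theta>) * f \<theta>) \<le> B * Bf" for n
        using AE_unit_sphere_measure
      proof eventually_elim
        fix \<theta> :: 'a assume \<theta>: "norm \<theta> = 1"
        show "norm (vD (x0 + X n *\<^sub>R \<theta>) * f \<theta>) \<le> B * Bf"
          using B(1) B(2)[of "X n" \<theta>] X(1) \<theta> Bf L(3)[of \<theta>]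
          by (cases "\<theta> \<in> L") (simp_all add: abs_mult mult_mono)
      qed
    qed auto
    then show "(weighted_sphere_integral f \<circ> X) \<longlonglongrightarrow> weighted_sphere_integral f \<rho>" by (simp add: o_def)
  qed
qed

text \<open>With $A(\rho) = k(\rho)/\rho^N$ the factor $N A + \rho A'$ of the divergence is $k'(\rho)/\rho^{N-1}$, which
  cancels the Jacobian of polar coordinates. The identity says, in weak form, that the spherical
  integral has the flux of \<open>g\<close> through the sphere, scaled to radius 1, as its derivative in the radius.\<close>

lemma radial_test:
  fixes k k' :: "real \<Rightarrow> real"
  assumes k: "\<And>\<rho>. DERIV k \<rho> :> k' \<rho>" "continuous_on UNIV k'"
    and s: "0 < s" "\<And>\<rho>. \<rho> \<le> s \<Longrightarrow> k \<rho> = 0" "\<And>\<rho>. \<rho> \<le> s \<Longrightarrow> k' \<rho> = 0"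
    and t: "s \<le> t" "t < \<delta>" "\<And>\<rho>. \<rho> \<ge> t \<Longrightarrow> k \<rho> = 0" "\<And>\<rho>. \<rho> \<ge> t \<Longrightarrow> k' \<rho> = 0"
    and f: "C1_gradient f df" and L: "compact L" "L \<subseteq> C" "\<And>x. x \<notin> L \<Longrightarrow> f x = 0"
  shows "(LINT \<rho>|lborel. k' \<rho> * weighted_sphere_integral f \<rho>) =
     - (LINT x:D|lebesgue. k (norm (x - x0)) / norm (x - x0) ^ DIM('a) * (f (sgn (x - x0)) * (g x \<bullet> (x - x0))))"
proof -
  define A where "A \<rho> = k \<rho> / \<rho> ^ DIM('a)" for \<rho>
  define A' where "A' \<rho> = k' \<rho> / \<rho> ^ DIM('a) - real DIM('a) * k \<rho> / \<rho> ^ Suc DIM('a)" for \<rho>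
  define W where "W \<rho> = real DIM('a) * A \<rho> + \<rho> * A' \<rho>" for \<rho>
  have contk: "continuous_on UNIV k"
    using k(1) by (meson DERIV_continuous_on DERIV_subset subset_UNIV)
  have A: "DERIV A \<rho> :> A' \<rho>" for \<rho>
    unfolding A_def[abs_def] A'_def by (rule DERIV_divide_power[OF k(1) s])
  have contA: "continuous_on UNIV A" using A by (meson DERIV_continuous_on DERIV_subset subset_UNIV)
  have contA': "continuous_on UNIV A'"
  proof -
    have "continuous_on {0<..} A'"
      unfolding A'_def
      by (intro continuous_intros continuous_on_subset[OF k(2)] continuous_on_subset[OF contk]) auto
    moreover have "continuous_on {..<s} A'"
      by (rule continuous_on_eq[where f="\<lambda>_. 0"]) (use s in \<open>auto simp: A'_def\<close>)
    ultimately have "continuous_on ({0<..} \<union> {..<s}) A'"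
      by (intro continuous_on_open_Un) auto
    moreover have "{0<..} \<union> {..<s} = UNIV" using s(1) by auto
    ultimately show ?thesis by simp
  qed
  have W: "W \<rho> * \<rho> ^ (DIM('a) - 1) = k' \<rho>" if "\<rho> > 0" for \<rho>
  proof -
    have "W \<rho> = k' \<rho> * \<rho> / \<rho> ^ DIM('a)" using that by (simp add: W_def A_def A'_def field_simps)
    moreover have "\<rho> ^ DIM('a) = \<rho> * \<rho> ^ (DIM('a) - 1)" by (metis DIM_positive power_eq_if neq0_conv)
    ultimately show ?thesis using that by simp
  qed
  have contf: "continuous_on UNIV f" by (rule C1_gradient_continuous[OF f])
  have contW: "continuous_on UNIV W"
    unfolding W_def by (intro continuous_intros contA contA')
  have [measurable]: "W \<in> borel_measurable borel" "f \<in> borel_measurable borel" "k' \<in> borel_measurable borel"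
    using contW contf k(2) by (auto intro: borel_measurable_continuous_onI)
  have W_0: "W \<rho> = 0" if "\<rho> \<notin> {s..t}" for \<rho>
    using that s t by (auto simp: W_def A_def A'_def)
  obtain BW where BW: "0 \<le> BW" "\<And>x. \<bar>W x\<bar> \<le> BW" using bounded_of_compact_support[OF contW compact_Icc W_0] by blast
  obtain Bf where Bf: "0 \<le> Bf" "\<And>x. \<bar>f x\<bar> \<le> Bf" using bounded_of_compact_support[OF contf L(1,3)] by blast
  define F where "F x = vD x * (W (norm (x - x0)) * f (sgn (x - x0)))" for x
  have [measurable]: "F \<in> borel_measurable borel" unfolding F_def by measurable
  \<comment> \<open>A ball slightly larger than the support, on which \<open>v\<close> is integrable.\<close>
  obtain r where r: "t < r" "r < \<delta>" using dense[OF t(2)] by blast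
  have F: "integrable lborel F"
  proof (rule Bochner_Integration.integrable_bound)
    show "integrable lborel (\<lambda>x. (BW * Bf) * (indicator (ball x0 r) x * vD x))"
      by (intro integrable_mult_right vD_L1 r)
    show "AE x in lborel. norm (F x) \<le> norm ((BW * Bf) * (indicator (ball x0 r) x * vD x))"
    proof (intro AE_I2)
      fix x
      have "\<bar>W (norm (x - x0)) * f (sgn (x - x0))\<bar> \<le> (BW * Bf) * indicator (ball x0 r) x"
      proof (cases "x \<in> ball x0 r")
        case True
        then show ?thesis using BW Bf by (simp add: abs_mult mult_mono)
      next
        case False
        then have "W (norm (x - x0)) = 0" using r by (intro W_0) (auto simp: dist_norm norm_minus_commute)
        then show ?thesis using BW(1) Bf(1) by simp
      qed
      then have "\<bar>vD x\<bar> * \<bar>W (norm (x - x0)) * f (sgn (x - x0))\<bar> \<le> \<bar>vD x\<bar> * ((BW * Bf) * indicator (ball x0 r) x)"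
        by (rule mult_left_mono) simp
      then show "norm (F x) \<le> norm ((BW * Bf) * (indicator (ball x0 r) x * vD x))"
        using BW(1) Bf(1) by (simp add: F_def abs_mult mult_ac)
    qed
  qed auto
  have "(LINT x:D|lebesgue. v x * ((real DIM('a) * A (norm (x - x0)) + norm (x - x0) * A' (norm (x - x0))) * f (sgn (x - x0))))
     = (LINT x|lebesgue. F x)"
    unfolding set_lebesgue_integral_def
    by (intro Bochner_Integration.integral_cong) (auto simp: F_def W_def vD_def)
  also have "\<dots> = integral\<^sup>L lborel F" by (rule integral_completion) simp
  also have "\<dots> = (LINT \<rho>|radial_measure DIM('a). (LINT \<theta>|unit_sphere_measure. F (x0 + \<rho> *\<^sub>R \<theta>)))"
    by (rule polar_integral[OF F])
  also have "\<dots> = (LINT \<rho>|lborel. (indicator {0<..} \<rho> * \<rho> ^ (DIM('a) - 1)) * (LINT \<theta>|unit_sphere_measure. F (x0 + \<rho> *\<^sub>R \<theta>)))"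
    using polar_integral(2)[OF F, of x0] by (intro integral_radial_measure) (auto dest: borel_measurable_integrable)
  also have "\<dots> = (LINT \<rho>|lborel. k' \<rho> * weighted_sphere_integral f \<rho>)"
  proof (rule Bochner_Integration.integral_cong)
    fix \<rho> :: real
    show "(indicator {0<..} \<rho> * \<rho> ^ (DIM('a) - 1)) * (LINT \<theta>|unit_sphere_measure. F (x0 + \<rho> *\<^sub>R \<theta>)) = k' \<rho> * weighted_sphere_integral f \<rho>"
    proof (cases "\<rho> > 0")
      case True
      have "(LINT \<theta>|unit_sphere_measure. F (x0 + \<rho> *\<^sub>R \<theta>)) = (LINT \<theta>|unit_sphere_measure. W \<rho> * (vD (x0 + \<rho> *\<^sub>R \<theta>) * f \<theta>))"
      proof (rule integral_cong_AE)
        show "AE \<theta> in unit_sphere_measure. F (x0 + \<rho> *\<^sub>R \<theta>) = W \<rho> * (vD (x0 + \<rho> *\<^sub>R \<theta>) * f \<theta>)"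
          using AE_unit_sphere_measure
        proof eventually_elim
          fix \<theta> :: 'a assume "norm \<theta> = 1"
          then have "norm (\<rho> *\<^sub>R \<theta>) = \<rho>" "sgn (\<rho> *\<^sub>R \<theta>) = \<theta>"
            using True by (simp_all add: sgn_div_norm)
          then show "F (x0 + \<rho> *\<^sub>R \<theta>) = W \<rho> * (vD (x0 + \<rho> *\<^sub>R \<theta>) * f \<theta>)"
            by (simp add: F_def)
        qed
      qed auto
      also have "\<dots> = W \<rho> * weighted_sphere_integral f \<rho>" by (simp add: weighted_sphere_integral_def)
      finally show ?thesis using True W[OF True] by (simp add: mult_ac flip: W[OF True])
    next
      case False
      then show ?thesis using s by simp
    qed
  qed simp
  finally have "(LINT \<rho>|lborel. k' \<rho> * weighted_sphere_integral f \<rho>) =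
      (LINT x:D|lebesgue. v x * ((real DIM('a) * A (norm (x - x0)) + norm (x - x0) * A' (norm (x - x0))) * f (sgn (x - x0))))"
    by simp
  also have "\<dots> = - (LINT x:D|lebesgue. A (norm (x - x0)) * f (sgn (x - x0)) * (g x \<bullet> (x - x0)))"
    by (rule weak_gradient_product[OF A contA' s(1) _ _ t(1,2) _ f L]) (use s t in \<open>auto simp: A_def A'_def\<close>)
  finally show ?thesis by (simp add: A_def mult.assoc)
qed

text \<open>The integrand of the radial flux of \<open>g\<close>, weighted by \<open>h\<close> in the direction and by \<open>k\<close> in the radius. Of the
  power $|y|^{-N}$, one factor normalises \<open>y\<close> and the others scale the sphere to radius 1.\<close>

definition flux_density :: "('a \<Rightarrow> real) \<Rightarrow> (real \<Rightarrow> real) \<Rightarrow> 'a \<Rightarrow> real" where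
  "flux_density h k x = indicator D x * (k (norm (x - x0)) / norm (x - x0) ^ DIM('a) *
     (h (sgn (x - x0)) * (g x \<bullet> (x - x0))))"

lemma flux_bound:
  assumes s: "0 < s" and t: "0 \<le> t" "t < r" and k: "\<And>\<rho>. \<bar>k \<rho>\<bar> \<le> 1" "\<And>\<rho>. \<rho> \<notin> {s..t} \<Longrightarrow> k \<rho> = 0"
    and h: "\<And>\<theta>. norm \<theta> = 1 \<Longrightarrow> \<bar>h \<theta>\<bar> \<le> B" "0 \<le> B"
  shows "norm (flux_density h k x) \<le> B * ((t / s ^ DIM('a)) * norm (indicator (D \<inter> ball x0 r) x *\<^sub>R g x))"
proof (cases "x \<in> D \<and> norm (x - x0) \<in> {s..t}")
  case True
  let ?\<rho> = "norm (x - x0)"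
  from True have \<rho>: "s \<le> ?\<rho>" "?\<rho> \<le> t" "x \<in> D" and ball: "x \<in> ball x0 r"
    using t by (auto simp: dist_norm norm_minus_commute)
  have "\<bar>k ?\<rho> / ?\<rho> ^ DIM('a)\<bar> \<le> 1 / s ^ DIM('a)"
    using k(1) s \<rho> by (simp add: abs_div_pos frac_le power_mono)
  moreover have "\<bar>h (sgn (x - x0))\<bar> \<le> B"
  proof (rule h(1))
    have "x - x0 \<noteq> 0" using s \<rho> by auto
    then show "norm (sgn (x - x0)) = 1" by (simp add: norm_sgn)
  qed
  moreover have "\<bar>g x \<bullet> (x - x0)\<bar> \<le> norm (g x) * t"
    using Cauchy_Schwarz_ineq2[of "g x" "x - x0"] \<rho>(2) by (meson mult_left_mono norm_ge_zero order_trans)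
  ultimately have "\<bar>k ?\<rho> / ?\<rho> ^ DIM('a)\<bar> * (\<bar>h (sgn (x - x0))\<bar> * \<bar>g x \<bullet> (x - x0)\<bar>)
      \<le> (1 / s ^ DIM('a)) * (B * (norm (g x) * t))"
    using s h(2) by (intro mult_mono) auto
  then show ?thesis using \<rho>(3) ball by (simp add: flux_density_def abs_mult mult_ac)
next
  case False
  then have "flux_density h k x = 0" using k(2) by (auto simp: flux_density_def)
  then show ?thesis using s t h(2) by simp
qed

lemma flux_measurable:
  assumes [measurable]: "h \<in> borel_measurable borel" "k \<in> borel_measurable borel"
    and k: "\<And>\<rho>. \<rho> \<notin> {s..t} \<Longrightarrow> k \<rho> = 0" and t: "t < r" "r < \<delta>"
  shows "flux_density h k \<in> borel_measurable lebesgue"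
proof -
  have g: "(\<lambda>x. indicator (D \<inter> ball x0 r) x *\<^sub>R g x) \<in> borel_measurable lebesgue"
    using g_integrable[OF t(2)] by auto
  have 1: "(\<lambda>x. k (norm (x - x0)) / norm (x - x0) ^ DIM('a) * h (sgn (x - x0))) \<in> borel_measurable lebesgue"
    by (rule borel_measurable_lebesgue_of_borel) measurable
  have 2: "(\<lambda>x. x - x0) \<in> borel_measurable lebesgue"
    by (rule borel_measurable_lebesgue_of_borel) measurable
  have eq: "flux_density h k = (\<lambda>x. (k (norm (x - x0)) / norm (x - x0) ^ DIM('a) * h (sgn (x - x0))) *
      ((indicator (D \<inter> ball x0 r) x *\<^sub>R g x) \<bullet> (x - x0)))"
  proof
    fix x
    show "flux_density h k x = (k (norm (x - x0)) / norm (x - x0) ^ DIM('a) * h (sgn (x - x0))) *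
      ((indicator (D \<inter> ball x0 r) x *\<^sub>R g x) \<bullet> (x - x0))"
    proof (cases "x \<in> ball x0 r")
      case True
      then show ?thesis by (simp add: flux_density_def indicator_def)
    next
      case False
      then have "k (norm (x - x0)) = 0" using t by (intro k) (auto simp: dist_norm norm_minus_commute)
      then show ?thesis by (simp add: flux_density_def)
    qed
  qed
  show ?thesis unfolding eq by (intro borel_measurable_times borel_measurable_inner 1 2 g)
qed

text \<open>Dominated convergence: on a shell the power of the norm is bounded, and \<open>g\<close> is integrable.\<close>

lemma flux_limit:
  assumes s: "0 < s" "s < r" "r < \<delta>" and h: "\<And>\<theta>. norm \<theta> = 1 \<Longrightarrow> \<bar>h \<theta>\<bar> \<le> B"
    and [measurable]: "h \<in> borel_measurable borel"
  shows "(\<lambda>n. integral\<^sup>L lebesgue (flux_density h (shell_cutoff s r n))) \<longlonglongrightarrow>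
     integral\<^sup>L lebesgue (flux_density h (indicator {s<..r}))"
proof -
  obtain t where t: "r < t" "t < \<delta>" using dense[OF s(3)] by blast
  obtain r' where r': "t < r'" "r' < \<delta>" using dense[OF t(2)] by blast
  \<comment> \<open>From the index \<open>m\<close> on, the cutoffs are supported in \<open>{s..t}\<close>.\<close>
  obtain m :: nat where m: "1 / (t - r) < real m" using reals_Archimedean2 by blast
  have "0 < 1 / (t - r)" using t by simp
  then have "m > 0" using m by (cases m) auto
  have m': "1 / real (n + m) \<le> t - r" for n
  proof -
    have "1 / real (n + m) \<le> 1 / real m" using \<open>m > 0\<close> by (intro frac_le) auto
    also have "\<dots> \<le> t - r" using m \<open>m > 0\<close> t by (simp add: field_simps)
    finally show ?thesis .
  qed
  define B' where "B' = max 0 B"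
  have B': "\<And>\<theta>. norm \<theta> = 1 \<Longrightarrow> \<bar>h \<theta>\<bar> \<le> B'" "0 \<le> B'" using h by (auto simp: B'_def intro: max.coboundedI2)
  have k_0: "shell_cutoff s r (n + m) \<rho> = 0" if "\<rho> \<notin> {s..t}" for n \<rho>
    using that s \<open>m > 0\<close> m'[of n] by (intro shell_cutoff_eq_0) auto
  have k_abs: "\<bar>shell_cutoff s r (n + m) \<rho>\<bar> \<le> 1" for n \<rho>
    using shell_cutoff_bounds[OF s(2), of "n + m" \<rho>] by simp
  have [measurable]: "shell_cutoff s r n \<in> borel_measurable borel" for n
    by (rule borel_measurable_continuous_onI[OF continuous_shell_cutoff])
  have "(\<lambda>n. integral\<^sup>L lebesgue (flux_density h (shell_cutoff s r (n + m)))) \<longlonglongrightarrow>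
     integral\<^sup>L lebesgue (flux_density h (indicator {s<..r}))"
  proof (rule integral_dominated_convergence)
    show "flux_density h (indicator {s<..r}) \<in> borel_measurable lebesgue"
      by (rule flux_measurable[where s=s and t=r and r=t]) (use t in \<open>auto simp: indicator_def\<close>)
    show "flux_density h (shell_cutoff s r (n + m)) \<in> borel_measurable lebesgue" for n
      by (rule flux_measurable[where s=s and t=t and r=r']) (use r' k_0 in auto)
    show "integrable lebesgue (\<lambda>x. B' * ((t / s ^ DIM('a)) * norm (indicator (D \<inter> ball x0 r') x *\<^sub>R g x)))"
      by (intro integrable_mult_right integrable_norm g_integrable r')
    show "AE x in lebesgue. norm (flux_density h (shell_cutoff s r (n + m)) x) \<le>
        B' * ((t / s ^ DIM('a)) * norm (indicator (D \<inter> ball x0 r') x *\<^sub>R g x))" for n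
      using s t r' k_abs k_0 B' by (intro AE_I2 flux_bound) auto
    show "AE x in lebesgue. (\<lambda>n. flux_density h (shell_cutoff s r (n + m)) x) \<longlonglongrightarrow> flux_density h (indicator {s<..r}) x"
    proof (intro AE_I2)
      fix x
      have flux: "flux_density h k x = k (norm (x - x0)) *
          (indicator D x * (h (sgn (x - x0)) * (g x \<bullet> (x - x0))) / norm (x - x0) ^ DIM('a))" for k
        by (simp add: flux_density_def)
      show "(\<lambda>n. flux_density h (shell_cutoff s r (n + m)) x) \<longlonglongrightarrow> flux_density h (indicator {s<..r}) x"
        unfolding flux
        by (intro tendsto_mult_right LIMSEQ_ignore_initial_segment[OF shell_cutoff_tendsto[OF s(2)]])
    qed
  qed
  then show ?thesis by (rule LIMSEQ_offset)
qed

lemma flux_integrable: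
  assumes s: "0 < s" "s < r" "r < \<delta>" and h: "\<And>\<theta>. norm \<theta> = 1 \<Longrightarrow> \<bar>h \<theta>\<bar> \<le> B" "0 \<le> B"
    and [measurable]: "h \<in> borel_measurable borel"
  shows "integrable lebesgue (flux_density h (indicator {s<..r}))"
proof -
  obtain t where t: "r < t" "t < \<delta>" using dense[OF s(3)] by blast
  show ?thesis
  proof (rule Bochner_Integration.integrable_bound)
    show "integrable lebesgue (\<lambda>x. B * ((r / s ^ DIM('a)) * norm (indicator (D \<inter> ball x0 t) x *\<^sub>R g x)))"
      by (intro integrable_mult_right integrable_norm g_integrable t)
    show "flux_density h (indicator {s<..r}) \<in> borel_measurable lebesgue"
      by (rule flux_measurable[where s=s and t=r and r=t]) (use t in \<open>auto simp: indicator_def\<close>)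
    have "norm (flux_density h (indicator {s<..r}) x) \<le> B * ((r / s ^ DIM('a)) * norm (indicator (D \<inter> ball x0 t) x *\<^sub>R g x))" for x
      using s t h by (intro flux_bound) (auto simp: indicator_def)
    then show "AE x in lebesgue. norm (flux_density h (indicator {s<..r}) x) \<le>
       norm (B * ((r / s ^ DIM('a)) * norm (indicator (D \<inter> ball x0 t) x *\<^sub>R g x)))"
      by (intro AE_I2) (metis abs_ge_self order_trans real_norm_def)
  qed
qed

lemma flux_integral_bound:
  assumes s: "0 < s" "s < r" "r < \<delta>" and h: "\<And>\<theta>. norm \<theta> = 1 \<Longrightarrow> \<bar>h \<theta>\<bar> \<le> B" "0 \<le> B"
    and [measurable]: "h \<in> borel_measurable borel"
  shows "integral\<^sup>L lebesgue (flux_density h (indicator {s<..r})) \<le>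
     B * (LINT x|lebesgue. \<bar>flux_density (\<lambda>_. 1) (indicator {s<..r}) x\<bar>)"
proof -
  have 1: "integrable lebesgue (flux_density (\<lambda>_. 1) (indicator {s<..r}))"
    by (rule flux_integrable[OF s, where B=1]) auto
  have "integral\<^sup>L lebesgue (flux_density h (indicator {s<..r})) \<le>
     (LINT x|lebesgue. B * \<bar>flux_density (\<lambda>_. 1) (indicator {s<..r}) x\<bar>)"
  proof (rule integral_mono)
    show "integrable lebesgue (flux_density h (indicator {s<..r}))"
      by (rule flux_integrable[OF s h]) auto
    show "integrable lebesgue (\<lambda>x. B * \<bar>flux_density (\<lambda>_. 1) (indicator {s<..r}) x\<bar>)"
      by (intro integrable_mult_right integrable_abs 1)
    fix x
    let ?c = "indicator D x * (indicator {s<..r} (norm (x - x0)) / norm (x - x0) ^ DIM('a)) * (g x \<bullet> (x - x0))"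
    have eq: "flux_density h (indicator {s<..r}) x = h (sgn (x - x0)) * ?c" "flux_density (\<lambda>_. 1) (indicator {s<..r}) x = ?c"
      by (simp_all add: flux_density_def)
    show "flux_density h (indicator {s<..r}) x \<le> B * \<bar>flux_density (\<lambda>_. 1) (indicator {s<..r}) x\<bar>"
    proof (cases "x = x0")
      case False
      then have "\<bar>h (sgn (x - x0))\<bar> \<le> B" by (intro h) (simp add: norm_sgn)
      then have "\<bar>h (sgn (x - x0))\<bar> * \<bar>?c\<bar> \<le> B * \<bar>?c\<bar>" by (rule mult_right_mono) simp
      then show ?thesis unfolding eq abs_mult[symmetric] by linarith
    qed (simp add: flux_density_def)
  qed
  then show ?thesis by simp
qed

text \<open>When \<open>k\<close> tends to the indicator of \<open>{s<..r}\<close>, its derivative concentrates at the radii \<open>s\<close> and \<open>r\<close>: the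
  weak derivative of the spherical integral is integrated.\<close>

lemma weighted_sphere_integral_difference:
  assumes s: "0 < s" "s < r" "r < \<delta>"
    and f: "C1_gradient f df" and L: "compact L" "L \<subseteq> C" "\<And>x. x \<notin> L \<Longrightarrow> f x = 0"
  shows "weighted_sphere_integral f r - weighted_sphere_integral f s = integral\<^sup>L lebesgue (flux_density f (indicator {s<..r}))"
proof -
  have contf: "continuous_on UNIV f" by (rule C1_gradient_continuous[OF f])
  have [measurable]: "f \<in> borel_measurable borel" by (rule borel_measurable_continuous_onI[OF contf])
  obtain B where B: "0 \<le> B" "\<And>x. \<bar>f x\<bar> \<le> B" using bounded_of_compact_support[OF contf L(1,3)] by blast
  obtain t where t: "r < t" "t < \<delta>" using dense[OF s(3)] by blast
  have cont: "continuous_on {a..t} (weighted_sphere_integral f)" if "0 < a" for a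
    by (rule weighted_sphere_integral_continuous[OF contf L that t(2)])
  \<comment> \<open>From the index \<open>m\<close> on, the cutoffs are supported in \<open>{s..t}\<close>.\<close>
  obtain m :: nat where m: "1 / (t - r) < real m" using reals_Archimedean2 by blast
  have "0 < 1 / (t - r)" using t by simp
  then have "m > 0" using m by (cases m) auto
  have m': "r + 1 / real n \<le> t" if "n \<ge> m" for n
  proof -
    have "1 / real n \<le> 1 / real m" using \<open>m > 0\<close> that by (intro frac_le) auto
    also have "\<dots> \<le> t - r" using m \<open>m > 0\<close> t by (simp add: field_simps)
    finally show ?thesis by simp
  qed
  let ?T = "\<lambda>n a \<rho>. (real n * tent (real n * (\<rho> - a))) * weighted_sphere_integral f \<rho>"
  have tent_s: "integrable lborel (?T n s)" if "n \<ge> m" for n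
    using m'[of m] s that \<open>m > 0\<close>
    by (intro tent_average_limit(1)[where m=m and b=t] cont) auto
  have tent_r: "integrable lborel (?T n r)" if "n \<ge> m" for n
    using m'[of m] s that \<open>m > 0\<close>
    by (intro tent_average_limit(1)[where m=m and b=t] cont) auto
  have "(\<lambda>n. integral\<^sup>L lborel (?T n s) - integral\<^sup>L lborel (?T n r)) \<longlonglongrightarrow> weighted_sphere_integral f s - weighted_sphere_integral f r"
    using m'[of m] s \<open>m > 0\<close>
    by (intro tendsto_diff tent_average_limit(2)[where m=m and b=t] cont) auto
  moreover have "\<forall>\<^sub>F n in sequentially. integral\<^sup>L lborel (?T n s) - integral\<^sup>L lborel (?T n r) =
      - integral\<^sup>L lebesgue (flux_density f (shell_cutoff s r n))"
  proof (rule eventually_sequentiallyI[of m])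
    fix n assume n: "n \<ge> m"
    then have "n > 0" using \<open>m > 0\<close> by simp
    have k': "real n * tent (real n * (\<rho> - s)) - real n * tent (real n * (\<rho> - r)) = 0"
      if "\<rho> \<le> s \<or> \<rho> \<ge> t" for \<rho>
      using that
    proof
      assume "\<rho> \<le> s"
      then have "real n * (\<rho> - s) \<le> 0" "real n * (\<rho> - r) \<le> 0"
        using s by (auto intro: mult_nonneg_nonpos)
      then show ?thesis by (simp add: tent_eq_0)
    next
      assume "\<rho> \<ge> t"
      then have "1 / real n \<le> \<rho> - r" using m'[OF n] by linarith
      then have "1 \<le> real n * (\<rho> - r)" using \<open>n > 0\<close> by (simp add: field_simps)
      moreover have "real n * (\<rho> - r) \<le> real n * (\<rho> - s)" using s by (intro mult_left_mono) auto
      ultimately show ?thesis by (simp add: tent_eq_0)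
    qed
    have "integral\<^sup>L lborel (?T n s) - integral\<^sup>L lborel (?T n r) = (LINT \<rho>|lborel. ?T n s \<rho> - ?T n r \<rho>)"
      using tent_s[OF n] tent_r[OF n] by (rule Bochner_Integration.integral_diff[symmetric])
    also have "\<dots> = (LINT \<rho>|lborel. (real n * tent (real n * (\<rho> - s)) - real n * tent (real n * (\<rho> - r))) * weighted_sphere_integral f \<rho>)"
      by (simp add: left_diff_distrib)
    also have "\<dots> = - (LINT x:D|lebesgue. shell_cutoff s r n (norm (x - x0)) / norm (x - x0) ^ DIM('a) * (f (sgn (x - x0)) * (g x \<bullet> (x - x0))))"
    proof (rule radial_test[OF DERIV_shell_cutoff])
      show "continuous_on UNIV (\<lambda>\<rho>. real n * tent (real n * (\<rho> - s)) - real n * tent (real n * (\<rho> - r)))"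
        by (intro continuous_intros)
      show "0 < s" "s \<le> t" "t < \<delta>" using s t by auto
      show "shell_cutoff s r n \<rho> = 0" if "\<rho> \<le> s" for \<rho>
        using that s \<open>n > 0\<close> by (intro shell_cutoff_eq_0) auto
      show "shell_cutoff s r n \<rho> = 0" if "t \<le> \<rho>" for \<rho>
        using that s \<open>n > 0\<close> m'[OF n] by (intro shell_cutoff_eq_0) auto
    qed (use k' f L in auto)
    also have "\<dots> = - integral\<^sup>L lebesgue (flux_density f (shell_cutoff s r n))"
      by (simp add: set_lebesgue_integral_def flux_density_def[abs_def])
    finally show "integral\<^sup>L lborel (?T n s) - integral\<^sup>L lborel (?T n r) =
      - integral\<^sup>L lebesgue (flux_density f (shell_cutoff s r n))" .
  qed
  ultimately have "(\<lambda>n. - integral\<^sup>L lebesgue (flux_density f (shell_cutoff s r n))) \<longlonglongrightarrow> weighted_sphere_integral f s - weighted_sphere_integral f r"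
    by (rule Lim_transform_eventually)
  moreover have "(\<lambda>n. - integral\<^sup>L lebesgue (flux_density f (shell_cutoff s r n))) \<longlonglongrightarrow>
      - integral\<^sup>L lebesgue (flux_density f (indicator {s<..r}))"
    by (intro tendsto_minus flux_limit s) (use B in auto)
  ultimately show ?thesis using LIMSEQ_unique by force
qed

text \<open>With the constant weight the field is the gradient of a radial function, which the Neumann condition
  can be tested with.\<close>

lemma flux_one:
  assumes s: "0 < s" "s < r" "r < \<delta>"
  shows "integral\<^sup>L lebesgue (flux_density (\<lambda>_. 1) (indicator {s<..r})) = 0"
proof -
  obtain t where t: "r < t" "t < \<delta>" using dense[OF s(3)] by blast
  obtain m :: nat where m: "1 / (t - r) < real m" using reals_Archimedean2 by blast
  have "0 < 1 / (t - r)" using t by simp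
  then have "m > 0" using m by (cases m) auto
  have "integral\<^sup>L lebesgue (flux_density (\<lambda>_. 1) (shell_cutoff s r n)) = 0" if n: "n \<ge> m" for n
  proof -
    have "n > 0" using n \<open>m > 0\<close> by simp
    have "1 / real n \<le> 1 / real m" using \<open>m > 0\<close> n by (intro frac_le) auto
    also have "\<dots> \<le> t - r" using m \<open>m > 0\<close> t by (simp add: field_simps)
    finally have le_t: "r + 1 / real n \<le> t" by simp
    let ?A = "\<lambda>\<rho>. shell_cutoff s r n \<rho> / \<rho> ^ DIM('a)"
    have A0: "?A \<rho> = 0" if "\<rho> \<le> s" for \<rho>
      using that s \<open>n > 0\<close> by (simp add: shell_cutoff_eq_0)
    have "continuous_on ({0<..} \<union> {..<s}) ?A"
    proof (rule continuous_on_open_Un)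
      show "continuous_on {0<..} ?A"
        by (intro continuous_intros continuous_on_subset[OF continuous_shell_cutoff]) auto
      show "continuous_on {..<s} ?A"
        by (rule continuous_on_eq[where f="\<lambda>_. 0"]) (use A0 in auto)
    qed auto
    moreover have "{0<..} \<union> {..<s} = UNIV" using s(1) by auto
    ultimately have "continuous_on UNIV ?A" by simp
    moreover have "?A \<rho> = 0" if "t \<le> \<rho>" for \<rho>
      using that s \<open>n > 0\<close> le_t by (simp add: shell_cutoff_eq_0)
    ultimately have "(LINT x:D|lebesgue. ?A (norm (x - x0)) * (g x \<bullet> (x - x0))) = 0"
      using s t A0 by (intro neumann_radial[where s=s and t=t]) auto
    then show ?thesis by (simp add: set_lebesgue_integral_def flux_density_def[abs_def])
  qed
  then have "(\<lambda>n. integral\<^sup>L lebesgue (flux_density (\<lambda>_. 1) (shell_cutoff s r n))) \<longlonglongrightarrow> 0"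
    by (intro tendsto_eventually eventually_sequentiallyI[of m])
  moreover have "(\<lambda>n. integral\<^sup>L lebesgue (flux_density (\<lambda>_. 1) (shell_cutoff s r n))) \<longlonglongrightarrow>
      integral\<^sup>L lebesgue (flux_density (\<lambda>_. 1) (indicator {s<..r}))"
    by (intro flux_limit[where B=1] s) auto
  ultimately show ?thesis using LIMSEQ_unique by blast
qed

section \<open>Integrability on every sphere\<close>

definition shell_gap :: "real \<Rightarrow> real \<Rightarrow> 'a \<Rightarrow> real" where
  "shell_gap s r \<theta> = vD (x0 + r *\<^sub>R \<theta>) - vD (x0 + s *\<^sub>R \<theta>)"

lemma shell_gap_measurable [measurable]: "shell_gap s r \<in> borel_measurable borel"
  unfolding shell_gap_def[abs_def] by measurable

lemma shell_gap_test:
  assumes s: "0 < s" "s < r" "r < \<delta>"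
    and f: "C1_gradient f df" and L: "compact L" "L \<subseteq> C" "\<And>x. x \<notin> L \<Longrightarrow> f x = 0"
  shows "integrable unit_sphere_measure (\<lambda>\<theta>. shell_gap s r \<theta> * f \<theta>)"
    and "(LINT \<theta>|unit_sphere_measure. shell_gap s r \<theta> * f \<theta>) = integral\<^sup>L lebesgue (flux_density f (indicator {s<..r}))"
proof -
  have contf: "continuous_on UNIV f" by (rule C1_gradient_continuous[OF f])
  have r: "integrable unit_sphere_measure (\<lambda>\<theta>. vD (x0 + r *\<^sub>R \<theta>) * f \<theta>)"
    by (rule sphere_product_integrable[OF contf L]) (use s in auto)
  have s': "integrable unit_sphere_measure (\<lambda>\<theta>. vD (x0 + s *\<^sub>R \<theta>) * f \<theta>)"
    by (rule sphere_product_integrable[OF contf L]) (use s in auto)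
  have eq: "(\<lambda>\<theta>. shell_gap s r \<theta> * f \<theta>) = (\<lambda>\<theta>. vD (x0 + r *\<^sub>R \<theta>) * f \<theta> - vD (x0 + s *\<^sub>R \<theta>) * f \<theta>)"
    by (simp add: shell_gap_def left_diff_distrib)
  show "integrable unit_sphere_measure (\<lambda>\<theta>. shell_gap s r \<theta> * f \<theta>)"
    unfolding eq by (rule Bochner_Integration.integrable_diff[OF r s'])
  show "(LINT \<theta>|unit_sphere_measure. shell_gap s r \<theta> * f \<theta>) = integral\<^sup>L lebesgue (flux_density f (indicator {s<..r}))"
    unfolding eq Bochner_Integration.integral_diff[OF r s']
    using weighted_sphere_integral_difference[OF s f L] by (simp add: weighted_sphere_integral_def)
qed

text \<open>By duality, with \<open>w\<close> for the gap: the integral of \<open>|w| \<eta>\<close> is approached by integrals of \<open>w f\<close> with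
  $|f| \le (1 + \varepsilon)\eta$, and these are fluxes with a bounded weight. As \<open>f\<close> has to be $C^1$, the
  sign of \<open>w\<close> is replaced by polynomials close to $w/(|w| + \varepsilon)$.\<close>

lemma shell_gap_weighted_bound:
  assumes s: "0 < s" "s < r" "r < \<delta>"
    and \<eta>: "C1_gradient \<eta> d\<eta>" "\<And>x. 0 \<le> \<eta> x" "\<And>x. \<eta> x \<le> 1"
    and L: "compact L" "L \<subseteq> C" "\<And>x. x \<notin> L \<Longrightarrow> \<eta> x = 0"
  shows "integrable unit_sphere_measure (\<lambda>\<theta>. \<bar>shell_gap s r \<theta>\<bar> * \<eta> \<theta>)"
    and "(LINT \<theta>|unit_sphere_measure. \<bar>shell_gap s r \<theta>\<bar> * \<eta> \<theta>) \<le>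
      (LINT x|lebesgue. \<bar>flux_density (\<lambda>_. 1) (indicator {s<..r}) x\<bar>)"
proof -
  let ?w = "shell_gap s r" and ?\<sigma> = "unit_sphere_measure :: 'a measure"
  interpret finite_measure ?\<sigma> by (rule finite_unit_sphere_measure)
  define G where "G = (LINT x|lebesgue. \<bar>flux_density (\<lambda>_. 1) (indicator {s<..r}) x\<bar>)"
  define X where "X = (LINT \<theta>|?\<sigma>. \<bar>?w \<theta>\<bar> * \<eta> \<theta>)"
  define c where "c = measure ?\<sigma> UNIV"
  have cont_\<eta>: "continuous_on UNIV \<eta>" by (rule C1_gradient_continuous[OF \<eta>(1)])
  have [measurable]: "\<eta> \<in> borel_measurable borel"
    by (rule borel_measurable_continuous_onI[OF cont_\<eta>])
  have int_w: "integrable ?\<sigma> (\<lambda>\<theta>. \<bar>?w \<theta>\<bar> * \<eta> \<theta>)"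
    using integrable_abs[OF shell_gap_test(1)[OF s \<eta>(1) L]] \<eta>(2) by (simp add: abs_mult)
  then show "integrable ?\<sigma> (\<lambda>\<theta>. \<bar>?w \<theta>\<bar> * \<eta> \<theta>)" .
  have int_\<eta>: "integrable ?\<sigma> \<eta>"
    by (rule integrable_const_bound[where B=1]) (use \<eta> in auto)
  have "(LINT \<theta>|?\<sigma>. \<eta> \<theta>) \<le> (LINT \<theta>|?\<sigma>. 1)"
    by (rule integral_mono) (use int_\<eta> \<eta> in auto)
  then have \<eta>_le: "integral\<^sup>L ?\<sigma> \<eta> \<le> c" by (simp add: c_def)
  have cont_w: "continuous_on (L \<inter> sphere 0 1) ?w"
    unfolding shell_gap_def
    by (intro continuous_on_diff continuous_on_subset[OF vD_continuous_on_sector]) (use s L in auto)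
  \<comment> \<open>Every inequality below loses at most a multiple of \<open>\<epsilon>\<close>, which tends to 0 in the end.\<close>
  have step: "X - G \<le> \<epsilon> * (X + G + c)" if \<epsilon>: "0 < \<epsilon>" "\<epsilon> < 1" for \<epsilon>
  proof -
    have "continuous_on (L \<inter> sphere 0 1) (\<lambda>\<theta>. ?w \<theta> / (\<bar>?w \<theta>\<bar> + \<epsilon>))"
      using \<epsilon> by (intro continuous_on_divide continuous_on_add continuous_on_rabs cont_w continuous_on_const) auto
    moreover have "compact (L \<inter> sphere 0 1)" using L(1) by (intro compact_Int_closed) auto
    ultimately obtain p where p: "real_polynomial_function p"
      "\<And>\<theta>. \<theta> \<in> L \<inter> sphere 0 1 \<Longrightarrow> \<bar>?w \<theta> / (\<bar>?w \<theta>\<bar> + \<epsilon>) - p \<theta>\<bar> < \<epsilon>"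
      using Stone_Weierstrass_real_polynomial_function[of "L \<inter> sphere 0 1" "\<lambda>\<theta>. ?w \<theta> / (\<bar>?w \<theta>\<bar> + \<epsilon>)" \<epsilon>] \<epsilon>(1)
      by metis
    obtain dp where dp: "C1_gradient p dp" using C1_gradient_polynomial[OF p(1)] by blast
    define \<psi> where "\<psi> x = p x * \<eta> x" for x
    obtain d\<psi> where \<psi>: "C1_gradient \<psi> d\<psi>"
      using C1_gradient_mult[OF dp \<eta>(1)] unfolding \<psi>_def[abs_def] by blast
    have \<psi>_0: "\<psi> x = 0" if "x \<notin> L" for x using L(3)[OF that] by (simp add: \<psi>_def)
    have [measurable]: "\<psi> \<in> borel_measurable borel"
      by (rule borel_measurable_continuous_onI[OF C1_gradient_continuous[OF \<psi>]])
    have \<psi>_bound: "\<bar>\<psi> \<theta>\<bar> \<le> 1 + \<epsilon>" if "norm \<theta> = 1" for \<theta>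
    proof (cases "\<theta> \<in> L")
      case True
      have "\<bar>?w \<theta> / (\<bar>?w \<theta>\<bar> + \<epsilon>)\<bar> \<le> 1" using \<epsilon> by (simp add: abs_divide)
      moreover have "\<bar>?w \<theta> / (\<bar>?w \<theta>\<bar> + \<epsilon>) - p \<theta>\<bar> < \<epsilon>" using p(2)[of \<theta>] True that by simp
      ultimately have "\<bar>p \<theta>\<bar> \<le> 1 + \<epsilon>" by linarith
      with \<eta>(2,3)[of \<theta>] \<epsilon> have "\<bar>p \<theta>\<bar> * \<bar>\<eta> \<theta>\<bar> \<le> (1 + \<epsilon>) * 1" by (intro mult_mono) auto
      then show ?thesis by (simp add: \<psi>_def abs_mult)
    qed (use \<psi>_0 \<epsilon> in auto)
    have lower: "(1 - \<epsilon>) * (\<bar>?w \<theta>\<bar> * \<eta> \<theta>) - \<epsilon> * \<eta> \<theta> \<le> ?w \<theta> * \<psi> \<theta>" if "norm \<theta> = 1" for \<theta>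
    proof (cases "\<theta> \<in> L")
      case True
      let ?a = "?w \<theta>" let ?u = "?a / (\<bar>?a\<bar> + \<epsilon>)"
      \<comment> \<open>\<open>?u\<close> is nearly the sign of \<open>?a\<close>, and \<open>p \<theta>\<close> is nearly \<open>?u\<close>.\<close>
      have "\<bar>?a\<bar> - \<epsilon> \<le> ?a * ?u"
      proof -
        have "(\<bar>?a\<bar> - \<epsilon>) * (\<bar>?a\<bar> + \<epsilon>) \<le> ?a * ?a"
          using \<epsilon> by (simp add: algebra_simps flip: power2_eq_square)
        then show ?thesis using \<epsilon> by (simp add: pos_le_divide_eq add_nonneg_pos)
      qed
      moreover have "\<bar>?a * (?u - p \<theta>)\<bar> \<le> \<bar>?a\<bar> * \<epsilon>"
        unfolding abs_mult using p(2)[of \<theta>] True that by (intro mult_left_mono) auto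
      ultimately have "(1 - \<epsilon>) * \<bar>?a\<bar> - \<epsilon> \<le> ?a * p \<theta>"
        by (simp add: algebra_simps)
      then have "((1 - \<epsilon>) * \<bar>?a\<bar> - \<epsilon>) * \<eta> \<theta> \<le> (?a * p \<theta>) * \<eta> \<theta>"
        using \<eta>(2) by (rule mult_right_mono)
      then show ?thesis by (simp add: \<psi>_def algebra_simps)
    qed (use L \<psi>_0 in auto)
    have "(1 - \<epsilon>) * X - \<epsilon> * integral\<^sup>L ?\<sigma> \<eta> = (LINT \<theta>|?\<sigma>. (1 - \<epsilon>) * (\<bar>?w \<theta>\<bar> * \<eta> \<theta>) - \<epsilon> * \<eta> \<theta>)"
      using int_w int_\<eta> by (simp add: X_def)
    also have "\<dots> \<le> (LINT \<theta>|?\<sigma>. ?w \<theta> * \<psi> \<theta>)"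
    proof (rule integral_mono_AE)
      show "AE \<theta> in ?\<sigma>. (1 - \<epsilon>) * (\<bar>?w \<theta>\<bar> * \<eta> \<theta>) - \<epsilon> * \<eta> \<theta> \<le> ?w \<theta> * \<psi> \<theta>"
        using AE_unit_sphere_measure by eventually_elim (rule lower)
    qed (use int_w int_\<eta> shell_gap_test(1)[OF s \<psi> L(1,2) \<psi>_0] in auto)
    also have "\<dots> = integral\<^sup>L lebesgue (flux_density \<psi> (indicator {s<..r}))"
      by (rule shell_gap_test(2)[OF s \<psi> L(1,2) \<psi>_0])
    also have "\<dots> \<le> (1 + \<epsilon>) * G"
      unfolding G_def using \<epsilon> by (intro flux_integral_bound[OF s] \<psi>_bound) auto
    finally have "(1 - \<epsilon>) * X - \<epsilon> * integral\<^sup>L ?\<sigma> \<eta> \<le> (1 + \<epsilon>) * G" .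
    moreover have "\<epsilon> * integral\<^sup>L ?\<sigma> \<eta> \<le> \<epsilon> * c" using \<eta>_le \<epsilon> by (intro mult_left_mono) auto
    ultimately show ?thesis by (simp add: algebra_simps)
  qed
  have "((\<lambda>\<epsilon>. \<epsilon> * (X + G + c)) \<longlongrightarrow> 0 * (X + G + c)) (at_right 0)"
    by (intro tendsto_intros)
  moreover have "\<forall>\<^sub>F \<epsilon> in at_right 0. X - G \<le> \<epsilon> * (X + G + c)"
    unfolding eventually_at_right_field by (intro exI[of _ 1]) (use step in auto)
  ultimately have "X - G \<le> 0 * (X + G + c)"
    by (rule tendsto_lowerbound) simp
  then show "(LINT \<theta>|?\<sigma>. \<bar>?w \<theta>\<bar> * \<eta> \<theta>) \<le> (LINT x|lebesgue. \<bar>flux_density (\<lambda>_. 1) (indicator {s<..r}) x\<bar>)"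
    by (simp add: X_def G_def)
qed

text \<open>The bound does not depend on the cutoff, so Fatou's lemma extends it to the whole sphere.\<close>

lemma shell_gap_integrable:
  assumes s: "0 < s" "s < r" "r < \<delta>"
  shows "integrable unit_sphere_measure (shell_gap s r)"
proof -
  let ?w = "shell_gap s r" and ?\<sigma> = "unit_sphere_measure :: 'a measure"
  define G where "G = (LINT x|lebesgue. \<bar>flux_density (\<lambda>_. 1) (indicator {s<..r}) x\<bar>)"
  obtain \<eta> d\<eta> L where \<eta>: "\<And>n. C1_gradient (\<eta> n) (d\<eta> n)"
    "\<And>n. compact (L n)" "\<And>n. L n \<subseteq> C" "\<And>n x. x \<notin> L n \<Longrightarrow> \<eta> n x = 0"
    "\<And>n x. 0 \<le> \<eta> n x" "\<And>n x. \<eta> n x \<le> 1"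
    "\<And>x. x \<in> C \<Longrightarrow> \<forall>\<^sub>F n in sequentially. \<eta> n x = 1"
    using C1_cutoffs[OF open_C C_nonempty] by metis
  have [measurable]: "\<eta> n \<in> borel_measurable borel" for n
    by (rule borel_measurable_continuous_onI[OF C1_gradient_continuous[OF \<eta>(1)]])
  have le_G: "(\<integral>\<^sup>+\<theta>. ennreal (\<bar>?w \<theta>\<bar> * \<eta> n \<theta>) \<partial>?\<sigma>) \<le> ennreal G" for n
  proof -
    note * = shell_gap_weighted_bound[OF s \<eta>(1) \<eta>(5,6) \<eta>(2,3) \<eta>(4), of n n]
    have "(\<integral>\<^sup>+\<theta>. ennreal (\<bar>?w \<theta>\<bar> * \<eta> n \<theta>) \<partial>?\<sigma>) = ennreal (LINT \<theta>|?\<sigma>. \<bar>?w \<theta>\<bar> * \<eta> n \<theta>)"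
      by (rule nn_integral_eq_integral) (use * \<eta>(5) in auto)
    also have "\<dots> \<le> ennreal G" unfolding G_def by (intro ennreal_leI *)
    finally show ?thesis .
  qed
  have "(\<integral>\<^sup>+\<theta>. ennreal \<bar>?w \<theta>\<bar> \<partial>?\<sigma>) \<le> (\<integral>\<^sup>+\<theta>. liminf (\<lambda>n. ennreal (\<bar>?w \<theta>\<bar> * \<eta> n \<theta>)) \<partial>?\<sigma>)"
  proof (rule nn_integral_mono_AE)
    show "AE \<theta> in ?\<sigma>. ennreal \<bar>?w \<theta>\<bar> \<le> liminf (\<lambda>n. ennreal (\<bar>?w \<theta>\<bar> * \<eta> n \<theta>))"
      using AE_unit_sphere_measure
    proof eventually_elim
      fix \<theta> :: 'a assume \<theta>: "norm \<theta> = 1"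
      show "ennreal \<bar>?w \<theta>\<bar> \<le> liminf (\<lambda>n. ennreal (\<bar>?w \<theta>\<bar> * \<eta> n \<theta>))"
      proof (cases "\<theta> \<in> C")
        case True
        have "\<forall>\<^sub>F n in sequentially. ennreal \<bar>?w \<theta>\<bar> \<le> ennreal (\<bar>?w \<theta>\<bar> * \<eta> n \<theta>)"
          using \<eta>(7)[OF True] by eventually_elim simp
        then show ?thesis by (rule Liminf_bounded)
      next
        case False
        then show ?thesis using s \<theta> by (simp add: shell_gap_def vD_outside)
      qed
    qed
  qed
  also have "\<dots> \<le> liminf (\<lambda>n. \<integral>\<^sup>+\<theta>. ennreal (\<bar>?w \<theta>\<bar> * \<eta> n \<theta>) \<partial>?\<sigma>)"
    by (rule nn_integral_liminf) auto
  also have "\<dots> \<le> ennreal G"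
  proof -
    have "liminf (\<lambda>n. \<integral>\<^sup>+\<theta>. ennreal (\<bar>?w \<theta>\<bar> * \<eta> n \<theta>) \<partial>?\<sigma>) \<le> liminf (\<lambda>n. ennreal G)"
      by (rule Liminf_mono) (use le_G in auto)
    then show ?thesis by (simp add: Liminf_const)
  qed
  also have "\<dots> < \<infinity>" by simp
  finally show ?thesis by (intro integrableI_bounded) auto
qed

text \<open>Polar coordinates make \<open>v\<close> integrable on almost every sphere, hence on one of radius \<open>s\<close> below \<open>r\<close>; the
  integrability of the gap carries this over to the sphere of radius \<open>r\<close>.\<close>

lemma sphere_integrable:
  assumes r: "0 < r" "r < \<delta>"
  shows "integrable unit_sphere_measure (\<lambda>\<theta>. vD (x0 + r *\<^sub>R \<theta>))"
proof -
  define P where "P \<rho> \<longleftrightarrow> integrable (unit_sphere_measure :: 'a measure)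
    (\<lambda>\<theta>. indicator (ball x0 r) (x0 + \<rho> *\<^sub>R \<theta>) * vD (x0 + \<rho> *\<^sub>R \<theta>))" for \<rho>
  have P: "AE \<rho> in radial_measure DIM('a). P \<rho>"
    unfolding P_def by (rule polar_integral(3)[OF vD_L1[OF r(2)]])
  \<comment> \<open>The radii below \<open>r\<close> have positive measure, so one of them is not exceptional.\<close>
  have *: "\<not> (AE \<rho> in radial_measure DIM('a). \<rho> \<notin> {0<..<r})"
  proof
    assume ae: "AE \<rho> in radial_measure DIM('a). \<rho> \<notin> {0<..<r}"
    have "AE \<rho> in radial_measure DIM('a). \<rho> > 0"
      unfolding radial_measure_def by (subst AE_density) (auto simp: indicator_def)
    with ae have "AE \<rho> in radial_measure DIM('a). \<rho> \<notin> {..<r}"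
      by eventually_elim auto
    then have "emeasure (radial_measure DIM('a)) {..<r} = 0"
      by (subst (asm) AE_iff_measurable[of "{..<r}"]) auto
    then show False using r(1) by (simp add: emeasure_radial_measure)
  qed
  have "\<exists>s. P s \<and> 0 < s \<and> s < r"
  proof (rule ccontr)
    assume "\<not> ?thesis"
    then have "\<rho> \<notin> {0<..<r}" if "P \<rho>" for \<rho> using that by auto
    with P have "AE \<rho> in radial_measure DIM('a). \<rho> \<notin> {0<..<r}" by (rule eventually_mono)
    with * show False by contradiction
  qed
  then obtain s where s: "0 < s" "s < r" and "P s" by blast
  then have int: "integrable unit_sphere_measure (\<lambda>\<theta>. indicator (ball x0 r) (x0 + s *\<^sub>R \<theta>) * vD (x0 + s *\<^sub>R \<theta>))"
    by (simp add: P_def)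
  have "integrable unit_sphere_measure (\<lambda>\<theta>. vD (x0 + s *\<^sub>R \<theta>))"
  proof (rule integrable_cong_AE_imp[OF int])
    show "AE \<theta> in unit_sphere_measure. indicator (ball x0 r) (x0 + s *\<^sub>R \<theta>) * vD (x0 + s *\<^sub>R \<theta>) = vD (x0 + s *\<^sub>R \<theta>)"
      using AE_unit_sphere_measure
      by eventually_elim (use s in \<open>auto simp: indicator_def dist_norm\<close>)
  qed auto
  from Bochner_Integration.integrable_add[OF shell_gap_integrable[OF s r(2)] this]
  show ?thesis by (simp add: shell_gap_def)
qed

section \<open>Mean values over spheres and balls\<close>

text \<open>The difference is the limit of the fluxes with cutoffs as weights, that is, the flux with
  weight 1, which is 0.\<close>

lemma sphere_integral_constant:
  assumes s: "0 < s" "s < r" "r < \<delta>"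
  shows "(LINT \<theta>|unit_sphere_measure. vD (x0 + r *\<^sub>R \<theta>)) = (LINT \<theta>|unit_sphere_measure. vD (x0 + s *\<^sub>R \<theta>))"
proof -
  let ?w = "shell_gap s r" and ?\<sigma> = "unit_sphere_measure :: 'a measure"
  obtain \<eta> d\<eta> L where \<eta>: "\<And>n. C1_gradient (\<eta> n) (d\<eta> n)"
    "\<And>n. compact (L n)" "\<And>n. L n \<subseteq> C" "\<And>n x. x \<notin> L n \<Longrightarrow> \<eta> n x = 0"
    "\<And>n x. 0 \<le> \<eta> n x" "\<And>n x. \<eta> n x \<le> 1"
    "\<And>x. x \<in> C \<Longrightarrow> \<forall>\<^sub>F n in sequentially. \<eta> n x = 1"
    using C1_cutoffs[OF open_C C_nonempty] by metis
  have [measurable]: "\<eta> n \<in> borel_measurable borel" for n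
    by (rule borel_measurable_continuous_onI[OF C1_gradient_continuous[OF \<eta>(1)]])
  have "(\<lambda>n. LINT \<theta>|?\<sigma>. ?w \<theta> * \<eta> n \<theta>) \<longlonglongrightarrow> integral\<^sup>L ?\<sigma> ?w"
  proof (rule integral_dominated_convergence[where w="\<lambda>\<theta>. \<bar>?w \<theta>\<bar>"])
    show "integrable ?\<sigma> (\<lambda>\<theta>. \<bar>?w \<theta>\<bar>)" by (intro integrable_abs shell_gap_integrable s)
    show "AE \<theta> in ?\<sigma>. norm (?w \<theta> * \<eta> n \<theta>) \<le> \<bar>?w \<theta>\<bar>" for n
      using \<eta>(5,6) by (intro AE_I2) (auto simp: abs_mult intro: mult_left_le)
    show "AE \<theta> in ?\<sigma>. (\<lambda>n. ?w \<theta> * \<eta> n \<theta>) \<longlonglongrightarrow> ?w \<theta>"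
      using AE_unit_sphere_measure
    proof eventually_elim
      fix \<theta> :: 'a assume \<theta>: "norm \<theta> = 1"
      show "(\<lambda>n. ?w \<theta> * \<eta> n \<theta>) \<longlonglongrightarrow> ?w \<theta>"
      proof (cases "\<theta> \<in> C")
        case True
        show ?thesis
          by (rule tendsto_eventually, rule eventually_mono[OF \<eta>(7)[OF True]]) simp
      next
        case False
        then show ?thesis using s \<theta> by (simp add: shell_gap_def vD_outside)
      qed
    qed
  qed auto
  moreover have "(\<lambda>n. LINT \<theta>|?\<sigma>. ?w \<theta> * \<eta> n \<theta>) \<longlonglongrightarrow> 0"
  proof -
    have "(\<lambda>n. integral\<^sup>L lebesgue (flux_density (\<eta> n) (indicator {s<..r}))) \<longlonglongrightarrow>
        integral\<^sup>L lebesgue (flux_density (\<lambda>_. 1) (indicator {s<..r}))"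
    proof (rule integral_dominated_convergence[where w="\<lambda>x. \<bar>flux_density (\<lambda>_. 1) (indicator {s<..r}) x\<bar>"])
      have 1: "integrable lebesgue (flux_density (\<lambda>_. 1) (indicator {s<..r}))"
        by (rule flux_integrable[OF s, where B=1]) auto
      show "integrable lebesgue (\<lambda>x. \<bar>flux_density (\<lambda>_. 1) (indicator {s<..r}) x\<bar>)"
        by (intro integrable_abs 1)
      show "flux_density (\<lambda>_. 1) (indicator {s<..r}) \<in> borel_measurable lebesgue" using 1 by auto
      have "integrable lebesgue (flux_density (\<eta> n) (indicator {s<..r}))" for n
        by (rule flux_integrable[OF s, where B=1]) (use \<eta>(5,6) in auto)
      then show "flux_density (\<eta> n) (indicator {s<..r}) \<in> borel_measurable lebesgue" for n by auto
      have flux: "flux_density h (indicator {s<..r}) x = h (sgn (x - x0)) * flux_density (\<lambda>_. 1) (indicator {s<..r}) x" for h x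
        by (simp add: flux_density_def)
      show "AE x in lebesgue. norm (flux_density (\<eta> n) (indicator {s<..r}) x) \<le> \<bar>flux_density (\<lambda>_. 1) (indicator {s<..r}) x\<bar>" for n
        unfolding flux[of "\<eta> n"] using \<eta>(5,6) by (intro AE_I2) (auto simp: abs_mult intro: mult_left_le_one_le)
      show "AE x in lebesgue. (\<lambda>n. flux_density (\<eta> n) (indicator {s<..r}) x) \<longlonglongrightarrow> flux_density (\<lambda>_. 1) (indicator {s<..r}) x"
      proof (intro AE_I2)
        fix x
        show "(\<lambda>n. flux_density (\<eta> n) (indicator {s<..r}) x) \<longlonglongrightarrow> flux_density (\<lambda>_. 1) (indicator {s<..r}) x"
        proof (cases "x \<in> D \<and> norm (x - x0) \<in> {s<..r}")
          case True
          then have "x - x0 \<in> C" using D_iff[of "x - x0"] s by auto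
          moreover have "x \<noteq> x0" using True s by auto
          ultimately have "sgn (x - x0) \<in> C"
            using cone[of "inverse (norm (x - x0))" "x - x0"] by (simp add: sgn_div_norm)
          from \<eta>(7)[OF this] show ?thesis
            by (intro tendsto_eventually) (auto simp: flux_density_def elim: eventually_mono)
        next
          case False
          then show ?thesis by (auto simp: flux_density_def)
        qed
      qed
    qed
    then show ?thesis
      using shell_gap_test(2)[OF s \<eta>(1) \<eta>(2) \<eta>(3) \<eta>(4)] flux_one[OF s] by simp
  qed
  ultimately have "integral\<^sup>L ?\<sigma> ?w = 0" using LIMSEQ_unique by blast
  then show ?thesis
    unfolding shell_gap_def
    using sphere_integrable[of r] sphere_integrable[of s] s by simp
qed

text \<open>The spherical integral does not change when the radius shrinks to 0, and there \<open>v\<close> tends to its value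
  at the vertex uniformly in the direction.\<close>

lemma sphere_integral_eq:
  assumes r: "0 < r" "r < \<delta>"
  shows "(LINT \<theta>|unit_sphere_measure. vD (x0 + r *\<^sub>R \<theta>)) = v x0 * measure unit_sphere_measure C"
proof -
  let ?\<sigma> = "unit_sphere_measure :: 'a measure"
  interpret finite_measure ?\<sigma> by (rule finite_unit_sphere_measure)
  have [measurable]: "C \<in> sets borel" using open_C by simp
  have "\<forall>\<^sub>F x in at x0 within D. dist (v x) (v x0) < 1"
    using vertex_limit by (rule tendstoD) simp
  then obtain e where e: "0 < e" "\<And>x. x \<in> D \<Longrightarrow> x \<noteq> x0 \<Longrightarrow> dist x x0 < e \<Longrightarrow> dist (v x) (v x0) < 1"
    unfolding eventually_at by blast
  define d where "d = min e r"
  define X where "X n = d / real (n + 2)" for n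
  have d: "0 < d" "d \<le> r" "d \<le> e" using e r by (auto simp: d_def)
  have X: "0 < X n" "X n < r" "X n < e" for n
  proof -
    have "X n \<le> d / 2" unfolding X_def using d(1) by (intro frac_le) auto
    then have "X n < d" using d(1) by linarith
    then show "0 < X n" "X n < r" "X n < e" using d by (auto simp: X_def)
  qed
  have X_lim: "X \<longlonglongrightarrow> 0"
    unfolding X_def[abs_def] by (rule LIMSEQ_ignore_initial_segment[OF lim_const_over_n])
  have in_D: "x0 + X n *\<^sub>R \<theta> \<in> D \<longleftrightarrow> \<theta> \<in> C" if "norm \<theta> = 1" for n \<theta>
    using D_iff[of "X n *\<^sub>R \<theta>"] cone[of "X n" \<theta>] cone[of "inverse (X n)" "X n *\<^sub>R \<theta>"] that X[of n] r by auto
  have ne: "x0 + X n *\<^sub>R \<theta> \<noteq> x0" if "norm \<theta> = 1" for n \<theta> using that X(1)[of n] by auto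
  have "(\<lambda>n. LINT \<theta>|?\<sigma>. vD (x0 + X n *\<^sub>R \<theta>)) \<longlonglongrightarrow> (LINT \<theta>|?\<sigma>. v x0 * indicator C \<theta>)"
  proof (rule integral_dominated_convergence[where w="\<lambda>_. \<bar>v x0\<bar> + 1"])
    show "AE \<theta> in ?\<sigma>. norm (vD (x0 + X n *\<^sub>R \<theta>)) \<le> \<bar>v x0\<bar> + 1" for n
      using AE_unit_sphere_measure
    proof eventually_elim
      fix \<theta> :: 'a assume \<theta>: "norm \<theta> = 1"
      show "norm (vD (x0 + X n *\<^sub>R \<theta>)) \<le> \<bar>v x0\<bar> + 1"
      proof (cases "x0 + X n *\<^sub>R \<theta> \<in> D")
        case True
        from e(2)[OF this ne[OF \<theta>]] \<theta> X[of n] have "\<bar>v (x0 + X n *\<^sub>R \<theta>) - v x0\<bar> < 1"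
          by (simp add: dist_norm)
        then show ?thesis using True by (simp add: vD_def)
      qed (simp add: vD_def)
    qed
    show "AE \<theta> in ?\<sigma>. (\<lambda>n. vD (x0 + X n *\<^sub>R \<theta>)) \<longlonglongrightarrow> v x0 * indicator C \<theta>"
      using AE_unit_sphere_measure
    proof eventually_elim
      fix \<theta> :: 'a assume \<theta>: "norm \<theta> = 1"
      show "(\<lambda>n. vD (x0 + X n *\<^sub>R \<theta>)) \<longlonglongrightarrow> v x0 * indicator C \<theta>"
      proof (cases "\<theta> \<in> C")
        case True
        have "(\<lambda>n. x0 + X n *\<^sub>R \<theta>) \<longlonglongrightarrow> x0 + 0 *\<^sub>R \<theta>" by (intro tendsto_intros X_lim)
        then have "filterlim (\<lambda>n. x0 + X n *\<^sub>R \<theta>) (at x0 within D) sequentially"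
          using in_D[OF \<theta>] ne[OF \<theta>] True by (auto simp: filterlim_at)
        from filterlim_compose[OF vertex_limit this]
        have "(\<lambda>n. v (x0 + X n *\<^sub>R \<theta>)) \<longlonglongrightarrow> v x0" .
        then show ?thesis using in_D[OF \<theta>] True by (simp add: vD_def)
      next
        case False
        then show ?thesis using in_D[OF \<theta>] by (simp add: vD_def)
      qed
    qed
  qed auto
  moreover have "(LINT \<theta>|?\<sigma>. vD (x0 + X n *\<^sub>R \<theta>)) = (LINT \<theta>|?\<sigma>. vD (x0 + r *\<^sub>R \<theta>))" for n
    using sphere_integral_constant[OF X(1,2) r(2)] by simp
  ultimately have "(\<lambda>n::nat. LINT \<theta>|?\<sigma>. vD (x0 + r *\<^sub>R \<theta>)) \<longlonglongrightarrow> (LINT \<theta>|?\<sigma>. v x0 * indicator C \<theta>)"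
    by simp
  then have "(LINT \<theta>|?\<sigma>. vD (x0 + r *\<^sub>R \<theta>)) = (LINT \<theta>|?\<sigma>. v x0 * indicator C \<theta>)"
    by (simp add: LIMSEQ_const_iff)
  then show ?thesis by simp
qed

lemma sphere_mean_value:
  assumes r: "0 < r" "r < \<delta>"
  shows "set_integrable (sphere_measure x0 r) (D \<inter> sphere x0 r) v"
    and "v x0 = 1 / measure (sphere_measure x0 r) (D \<inter> sphere x0 r) *
       (LINT y:D \<inter> sphere x0 r|sphere_measure x0 r. v y)"
proof -
  let ?\<sigma> = "unit_sphere_measure :: 'a measure"
  interpret finite_measure ?\<sigma> by (rule finite_unit_sphere_measure)
  have [measurable]: "C \<in> sets borel" "D \<in> sets borel" using open_C open_D by auto
  have [measurable]: "D \<inter> sphere x0 r \<in> sets borel" by (intro sets.Int) auto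
  have eq: "(\<lambda>x. indicator (D \<inter> sphere x0 r) x *\<^sub>R v x) = (\<lambda>x. indicator (sphere x0 r) x * vD x)"
    by (auto simp: vD_def indicator_def)
  have [measurable]: "(\<lambda>x. indicator (sphere x0 r) x * vD x) \<in> borel_measurable borel"
    by (intro borel_measurable_times borel_measurable_indicator vD_measurable) simp
  have on_sphere: "AE \<theta> in ?\<sigma>. indicator (sphere x0 r) (x0 + r *\<^sub>R \<theta>) * vD (x0 + r *\<^sub>R \<theta>) = vD (x0 + r *\<^sub>R \<theta>)"
    using AE_unit_sphere_measure by eventually_elim (use r in \<open>auto simp: dist_norm\<close>)
  have "integrable ?\<sigma> (\<lambda>\<theta>. indicator (sphere x0 r) (x0 + r *\<^sub>R \<theta>) * vD (x0 + r *\<^sub>R \<theta>))"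
    by (rule integrable_cong_AE_imp[OF sphere_integrable[OF r]])
      (use on_sphere in \<open>auto elim!: eventually_mono\<close>)
  then show "set_integrable (sphere_measure x0 r) (D \<inter> sphere x0 r) v"
    unfolding set_integrable_def eq by (simp add: integral_sphere_measure(2)[OF r(1)])
  have "(LINT y:D \<inter> sphere x0 r|sphere_measure x0 r. v y) =
      r ^ (DIM('a) - 1) * (LINT \<theta>|?\<sigma>. indicator (sphere x0 r) (x0 + r *\<^sub>R \<theta>) * vD (x0 + r *\<^sub>R \<theta>))"
    unfolding set_lebesgue_integral_def eq by (rule integral_sphere_measure(1)[OF r(1)]) simp
  also have "(LINT \<theta>|?\<sigma>. indicator (sphere x0 r) (x0 + r *\<^sub>R \<theta>) * vD (x0 + r *\<^sub>R \<theta>)) = (LINT \<theta>|?\<sigma>. vD (x0 + r *\<^sub>R \<theta>))"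
    by (rule integral_cong_AE) (use on_sphere in auto)
  finally have int: "(LINT y:D \<inter> sphere x0 r|sphere_measure x0 r. v y) = r ^ (DIM('a) - 1) * (v x0 * measure ?\<sigma> C)"
    by (simp add: sphere_integral_eq[OF r])
  have "measure (sphere_measure x0 r) (D \<inter> sphere x0 r) = integral\<^sup>L (sphere_measure x0 r) (indicator (D \<inter> sphere x0 r))"
    by simp
  also have "\<dots> = r ^ (DIM('a) - 1) * (LINT \<theta>|?\<sigma>. indicator (D \<inter> sphere x0 r) (x0 + r *\<^sub>R \<theta>))"
    by (rule integral_sphere_measure(1)[OF r(1)]) (rule borel_measurable_indicator, measurable)
  also have "(LINT \<theta>|?\<sigma>. indicator (D \<inter> sphere x0 r) (x0 + r *\<^sub>R \<theta>)) = (LINT \<theta>|?\<sigma>. (indicator C \<theta> :: real))"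
  proof (rule integral_cong_AE)
    show "AE \<theta> in ?\<sigma>. indicator (D \<inter> sphere x0 r) (x0 + r *\<^sub>R \<theta>) = (indicator C \<theta> :: real)"
      using AE_unit_sphere_measure
    proof eventually_elim
      fix \<theta> :: 'a assume "norm \<theta> = 1"
      then show "indicator (D \<inter> sphere x0 r) (x0 + r *\<^sub>R \<theta>) = (indicator C \<theta> :: real)"
        using r in_D_iff[of \<theta> r] by (simp add: indicator_def dist_norm)
    qed
  qed auto
  finally have "measure (sphere_measure x0 r) (D \<inter> sphere x0 r) = r ^ (DIM('a) - 1) * measure ?\<sigma> C"
    by simp
  then show "v x0 = 1 / measure (sphere_measure x0 r) (D \<inter> sphere x0 r) *
       (LINT y:D \<inter> sphere x0 r|sphere_measure x0 r. v y)"
    using int r measure_unit_sphere_pos[OF open_C C_nonempty cone zero_notin_C] by simp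
qed

lemma ball_volume:
  assumes r: "0 < r" "r \<le> \<delta>"
  shows "measure lebesgue (D \<inter> ball x0 r) = measure unit_sphere_measure C * (r ^ DIM('a) / real DIM('a))"
proof -
  let ?\<sigma> = "unit_sphere_measure :: 'a measure"
  interpret finite_measure ?\<sigma> by (rule finite_unit_sphere_measure)
  have [measurable]: "C \<in> sets borel" "D \<in> sets borel" using open_C open_D by auto
  have eq: "(\<lambda>x. indicator (ball x0 r) x * indicator D x) = (indicator (D \<inter> ball x0 r) :: 'a \<Rightarrow> real)"
    by (auto simp: indicator_def)
  have "emeasure lborel (D \<inter> ball x0 r) \<le> emeasure lborel (ball x0 r)" by (intro emeasure_mono) auto
  also have "\<dots> < \<infinity>" using emeasure_lborel_ball_finite by simp
  finally have fin: "emeasure lborel (D \<inter> ball x0 r) < \<infinity>" .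
  have "(LINT x|lborel. indicator (ball x0 r) x * indicator D x) = measure ?\<sigma> C * (r ^ DIM('a) / real DIM('a))"
  proof (rule ball_integral_of_constant_spheres[where F="indicator D", OF r(1)])
    show "integrable lborel (\<lambda>x. indicator (ball x0 r) x * (indicator D x :: real))"
      unfolding eq by (rule integrable_real_indicator[OF _ fin]) auto
    show "(indicator D :: 'a \<Rightarrow> real) \<in> borel_measurable borel" by simp
    fix \<rho> :: real assume \<rho>: "0 < \<rho>" "\<rho> < r"
    have "(LINT \<theta>|?\<sigma>. indicator D (x0 + \<rho> *\<^sub>R \<theta>)) = (LINT \<theta>|?\<sigma>. (indicator C \<theta> :: real))"
    proof (rule integral_cong_AE)
      show "AE \<theta> in ?\<sigma>. indicator D (x0 + \<rho> *\<^sub>R \<theta>) = (indicator C \<theta> :: real)"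
        using AE_unit_sphere_measure
        by eventually_elim (use \<rho> r in_D_iff in \<open>auto simp: indicator_def\<close>)
    qed auto
    then show "(LINT \<theta>|?\<sigma>. indicator D (x0 + \<rho> *\<^sub>R \<theta>)) = measure ?\<sigma> C" by simp
  qed
  then show ?thesis unfolding eq by (simp add: measure_completion)
qed

lemma ball_volume_pos:
  assumes r: "0 < r" "r \<le> \<delta>"
  shows "0 < measure lebesgue (D \<inter> ball x0 r)"
  using measure_unit_sphere_pos[OF open_C C_nonempty cone zero_notin_C] r by (simp add: ball_volume)

lemma ball_integral:
  assumes r: "0 < r" "r \<le> \<delta>" and L1: "v absolutely_integrable_on (D \<inter> ball x0 r)"
  shows "(LINT y:D \<inter> ball x0 r|lebesgue. v y) = v x0 * measure lebesgue (D \<inter> ball x0 r)"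
proof -
  have eq: "(\<lambda>x. indicator (D \<inter> ball x0 r) x *\<^sub>R v x) = (\<lambda>x. indicator (ball x0 r) x * vD x)"
    by (auto simp: vD_def indicator_def)
  have [measurable]: "(\<lambda>x. indicator (ball x0 r) x * vD x) \<in> borel_measurable borel"
    by (intro borel_measurable_times borel_measurable_indicator vD_measurable) simp
  have int: "integrable lborel (\<lambda>x. indicator (ball x0 r) x * vD x)"
    using L1 unfolding set_integrable_def eq by (simp add: integrable_completion)
  have "(LINT y:D \<inter> ball x0 r|lebesgue. v y) = (LINT x|lborel. indicator (ball x0 r) x * vD x)"
    unfolding set_lebesgue_integral_def eq by (rule integral_completion) simp
  also have "\<dots> = (v x0 * measure unit_sphere_measure C) * (r ^ DIM('a) / real DIM('a))"
    by (rule ball_integral_of_constant_spheres[OF r(1) vD_measurable int]) (use r sphere_integral_eq in auto)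
  finally show ?thesis by (simp add: ball_volume[OF r])
qed

text \<open>The integrals over smaller balls are proportional to $r^N$, which is continuous up to \<open>\<delta>\<close>.\<close>

lemma improper_ball_mean_value:
  "((\<lambda>r. 1 / measure lebesgue (D \<inter> ball x0 \<delta>) * (LINT y:D \<inter> ball x0 r|lebesgue. v y)) \<longlongrightarrow> v x0) (at_left \<delta>)"
proof (rule Lim_transform_eventually)
  let ?V = "\<lambda>r. measure lebesgue (D \<inter> ball x0 r)"
  have "((\<lambda>r. v x0 * (r ^ DIM('a) / \<delta> ^ DIM('a))) \<longlongrightarrow> v x0 * (\<delta> ^ DIM('a) / \<delta> ^ DIM('a))) (at_left \<delta>)"
    using \<delta>_pos by (intro tendsto_intros) auto
  then show "((\<lambda>r. v x0 * (r ^ DIM('a) / \<delta> ^ DIM('a))) \<longlongrightarrow> v x0) (at_left \<delta>)"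
    using \<delta>_pos by simp
  show "\<forall>\<^sub>F r in at_left \<delta>. v x0 * (r ^ DIM('a) / \<delta> ^ DIM('a)) = 1 / ?V \<delta> * (LINT y:D \<inter> ball x0 r|lebesgue. v y)"
    unfolding eventually_at_left_field
  proof (intro exI[of _ 0] conjI allI impI)
    fix r :: real assume r: "0 < r" "r < \<delta>"
    show "v x0 * (r ^ DIM('a) / \<delta> ^ DIM('a)) = 1 / ?V \<delta> * (LINT y:D \<inter> ball x0 r|lebesgue. v y)"
      using r \<delta>_pos measure_unit_sphere_pos[OF open_C C_nonempty cone zero_notin_C]
      by (simp add: ball_integral[OF r(1) _ v_L1] ball_volume)
  qed (use \<delta>_pos in auto)
qed

end

section \<open>The mean value property on convex cones\<close>

lemma convex_cone_at_origin_facts: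
  assumes "convex_cone_at_origin K"
  shows "open K" "K \<noteq> {}" "0 \<notin> K" "\<And>t x. 0 < t \<Longrightarrow> x \<in> K \<Longrightarrow> t *\<^sub>R x \<in> K" "\<not> bounded K"
proof -
  obtain \<omega> where \<omega>: "openin (top_of_set (sphere 0 1)) \<omega>" "\<omega> \<noteq> {}"
    "K = {t *\<^sub>R x |t x. x \<in> \<omega> \<and> 0 < t}"
    using assms unfolding convex_cone_at_origin_def by blast
  have sphere: "norm x = 1" if "x \<in> \<omega>" for x using openin_imp_subset[OF \<omega>(1)] that by auto
  have K: "x \<in> K \<longleftrightarrow> x \<noteq> 0 \<and> sgn x \<in> \<omega>" for x
  proof
    assume "x \<in> K"
    then obtain t y where x: "x = t *\<^sub>R y" "y \<in> \<omega>" "0 < t" using \<omega>(3) by blast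
    then have "sgn x = y" using sphere[OF x(2)] by (simp add: sgn_div_norm)
    then show "x \<noteq> 0 \<and> sgn x \<in> \<omega>" using x sphere[OF x(2)] by auto
  next
    assume *: "x \<noteq> 0 \<and> sgn x \<in> \<omega>"
    then have "x = norm x *\<^sub>R sgn x" "0 < norm x" by (simp_all add: sgn_div_norm)
    then show "x \<in> K" using * \<omega>(3) by blast
  qed
  obtain T where T: "open T" "\<omega> = sphere 0 1 \<inter> T" using \<omega>(1) by (auto simp: openin_open)
  have "continuous_on (- {0}) (sgn :: 'a \<Rightarrow> 'a)"
    by (rule continuous_on_sgn[OF continuous_on_id]) simp
  then have "open (- {0} \<inter> sgn -` T)"
    by (rule continuous_open_preimage) (simp_all add: open_Compl T(1))
  moreover have "K = - {0} \<inter> sgn -` T"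
  proof (rule set_eqI)
    have "sgn x \<in> \<omega> \<longleftrightarrow> sgn x \<in> T" if "x \<noteq> 0" for x
      using that unfolding T(2) by (simp add: norm_sgn)
    then show "x \<in> K \<longleftrightarrow> x \<in> - {0} \<inter> sgn -` T" for x
      unfolding K by auto
  qed
  ultimately show "open K" by simp
  obtain y where y: "y \<in> \<omega>" using \<omega>(2) by blast
  show "0 \<notin> K" using K by simp
  show scale: "t *\<^sub>R x \<in> K" if "0 < t" "x \<in> K" for t x
    using that by (simp add: K sgn_scaleR)
  have y': "t *\<^sub>R y \<in> K" if "0 < t" for t using y that \<omega>(3) by blast
  show "K \<noteq> {}" using y'[of 1] by auto
  show "\<not> bounded K"
  proof
    assume "bounded K"
    then obtain B where "\<And>x. x \<in> K \<Longrightarrow> norm x \<le> B" by (auto simp: bounded_iff)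
    from this[OF y'[of "\<bar>B\<bar> + 1"]] have "\<bar>B\<bar> + 1 \<le> B" using sphere[OF y] by simp
    then show False by linarith
  qed
qed

theorem theorem4p1:
  fixes \<Sigma> \<Omega> \<Gamma>0 \<Gamma>1 :: "'a::euclidean_space set"
    and v :: "'a \<Rightarrow> real" and x0 :: 'a and \<delta> :: real
  assumes cone: "convex_cone_at_origin \<Sigma>"
    and Omega: "smooth_domain \<Omega>" "bounded \<Omega>"
    and sector: "open_domain (\<Sigma> \<inter> \<Omega>)" "bounded (\<Sigma> \<inter> \<Omega>)"
    and Gamma0: "\<Gamma>0 = \<Sigma> \<inter> frontier \<Omega>" "smooth_hypersurface \<Gamma>0"
    and Gamma1: "\<Gamma>1 = frontier (\<Sigma> \<inter> \<Omega>) - closure \<Gamma>0"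
    and vertex: "cone_vertex \<Sigma> x0" "x0 \<in> \<Gamma>1"
    and delta: "\<delta> = infdist x0 \<Gamma>0"
    \<comment> \<open>The vertex normally lies in \<open>\<Omega>\<close>, and then \<open>insert x0\<close> is void. In the degenerate case
       where it lies on the boundary of \<open>\<Omega>\<close>, it gives \<open>v x0\<close> its meaning.\<close>
    and cont: "continuous_on (insert x0 (closure \<Sigma> \<inter> \<Omega>)) v"
    and weak: "weak_harmonic_neumann (\<Sigma> \<inter> \<Omega>) \<Gamma>1 v"
  shows
    "(\<forall>r. 0 < r \<and> r < \<delta> \<longrightarrow>
        set_integrable (sphere_measure x0 r) (\<Sigma> \<inter> sphere x0 r) v \<and>
        v x0 = 1 / measure (sphere_measure x0 r) (\<Sigma> \<inter> sphere x0 r) *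
               (LINT y:\<Sigma> \<inter> sphere x0 r|sphere_measure x0 r. v y)) \<and>
     (\<forall>r. 0 < r \<and> r < \<delta> \<longrightarrow> v absolutely_integrable_on (\<Sigma> \<inter> ball x0 r)) \<and>
     (\<forall>r. 0 < r \<and> r \<le> \<delta> \<and> v absolutely_integrable_on (\<Sigma> \<inter> ball x0 r) \<longrightarrow>
        v x0 = 1 / measure lebesgue (\<Sigma> \<inter> ball x0 r) *
               (LINT y:\<Sigma> \<inter> ball x0 r|lebesgue. v y)) \<and>
     \<comment> \<open>For \<open>r = \<delta>\<close> the integral need not converge absolutely, since \<open>v\<close> is not controlled
        near \<open>\<Gamma>0\<close>; as an improper integral it always exists.\<close>
     ((\<lambda>r. 1 / measure lebesgue (\<Sigma> \<inter> ball x0 \<delta>) *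
            (LINT y:\<Sigma> \<inter> ball x0 r|lebesgue. v y)) \<longlongrightarrow> v x0) (at_left \<delta>)"
proof -
  define D where "D = \<Sigma> \<inter> \<Omega>"
  define C where "C = (\<lambda>x. x - x0) ` \<Sigma>"
  obtain g where W12: "W12_loc D \<Gamma>1 v g"
    and neumann: "\<And>\<phi> d\<phi>. C1_test (D \<union> \<Gamma>1) \<phi> d\<phi> \<Longrightarrow> (LINT x:D|lebesgue. g x \<bullet> d\<phi> x) = 0"
    using weak unfolding weak_harmonic_neumann_def D_def by blast
  have C: "convex_cone_at_origin C" using vertex(1) by (simp add: cone_vertex_def C_def)
  have C_iff: "x0 + y \<in> \<Sigma> \<longleftrightarrow> y \<in> C" for y by (force simp: C_def)
  have "convex \<Sigma>" using cone by (simp add: convex_cone_at_origin_def)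
  have open_D: "open D" and D_ne: "D \<noteq> {}" using sector(1) by (auto simp: open_domain_def D_def)
  \<comment> \<open>Since \<open>infdist\<close> to the empty set is 0, a positive \<open>\<delta>\<close> requires \<open>\<Gamma>0\<close> to be nonempty: otherwise the unbounded
    cone would be contained in \<open>\<Omega>\<close>.\<close>
  have \<Gamma>0_ne: "\<Gamma>0 \<noteq> {}"
  proof
    assume "\<Gamma>0 = {}"
    then have "\<Sigma> - \<Omega> = {}"
      using connected_Int_frontier[OF convex_connected[OF \<open>convex \<Sigma>\<close>], of \<Omega>] D_ne
      by (auto simp: Gamma0(1) D_def)
    then have "bounded \<Sigma>" using Omega(2) bounded_subset by blast
    then show False using convex_cone_at_origin_facts(5)[OF cone] by simp
  qed
  have far: "\<delta> \<le> dist x0 p" if "p \<in> closure \<Gamma>0" for p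
    using that infdist_triangle[of x0 \<Gamma>0 p] in_closure_iff_infdist_zero[OF \<Gamma>0_ne, of p] by (simp add: delta)
  have \<delta>_pos: "0 < \<delta>"
    using vertex(2) in_closure_iff_infdist_zero[OF \<Gamma>0_ne, of x0] infdist_nonneg[of x0 \<Gamma>0]
    by (simp add: Gamma1 delta)
  \<comment> \<open>The convex set \<open>\<Sigma> \<inter> ball x0 \<delta>\<close> meets \<open>\<Omega>\<close> near \<open>x0\<close>, and it could leave \<open>\<Omega>\<close> only through \<open>\<Gamma>0\<close>.\<close>
  have ball_sub: "\<Sigma> \<inter> ball x0 \<delta> \<subseteq> \<Omega>"
  proof (rule ccontr)
    assume "\<not> ?thesis"
    then have 1: "(\<Sigma> \<inter> ball x0 \<delta>) - \<Omega> \<noteq> {}" by blast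
    have "x0 \<in> closure D" using vertex(2) by (simp add: Gamma1 D_def frontier_def)
    then obtain y where "y \<in> D" "dist y x0 < \<delta>" using \<delta>_pos closure_approachable by blast
    then have 2: "(\<Sigma> \<inter> ball x0 \<delta>) \<inter> \<Omega> \<noteq> {}" by (auto simp: D_def dist_commute)
    have "connected (\<Sigma> \<inter> ball x0 \<delta>)"
      by (intro convex_connected convex_Int \<open>convex \<Sigma>\<close> convex_ball)
    from connected_Int_frontier[OF this 2 1] obtain p where p: "p \<in> \<Sigma>" "p \<in> frontier \<Omega>" "dist x0 p < \<delta>"
      by auto
    then have "p \<in> closure \<Gamma>0" using closure_subset[of \<Gamma>0] by (auto simp: Gamma0(1))
    with far[of p] p(3) show False by simp
  qed
  \<comment> \<open>Square integrability and the test functions reach up to \<open>\<Gamma>1\<close>, hence up to the whole boundary of \<open>D\<close> at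
    distances below \<open>\<delta>\<close> from \<open>x0\<close>.\<close>
  have closed_part: "closure D \<inter> cball x0 r \<subseteq> D \<union> \<Gamma>1" if "r < \<delta>" for r
  proof
    fix p assume p: "p \<in> closure D \<inter> cball x0 r"
    then have "p \<notin> closure \<Gamma>0" using far[of p] that by auto
    then show "p \<in> D \<union> \<Gamma>1"
      using p open_D by (auto simp: Gamma1 D_def[symmetric] frontier_def interior_open)
  qed
  have compact_part: "compact (closure D \<inter> cball x0 r)" for r
    by (simp add: closed_Int_compact)
  have L1: "f absolutely_integrable_on (D \<inter> ball x0 r)"
    if "r < \<delta>" "\<And>K. compact K \<Longrightarrow> K \<subseteq> D \<union> \<Gamma>1 \<Longrightarrow> L2_on (K \<inter> D) f"
    for r and f :: "'a \<Rightarrow> 'c::euclidean_space"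
  proof -
    let ?K = "closure D \<inter> cball x0 r"
    have "L2_on (?K \<inter> D) f" by (rule that(2)[OF compact_part closed_part[OF that(1)]])
    moreover have "?K \<inter> D \<in> sets lebesgue" using open_D compact_part[of r] by (intro sets.Int) (auto simp: borel_compact)
    moreover have "bounded (?K \<inter> D)" using compact_part compact_imp_bounded bounded_subset by blast
    ultimately have "f absolutely_integrable_on (?K \<inter> D)" by (rule L2_on_imp_absolutely_integrable)
    then show ?thesis
    proof (rule set_integrable_subset)
      show "D \<inter> ball x0 r \<in> sets lebesgue" using open_D by (intro sets.Int) auto
      show "D \<inter> ball x0 r \<subseteq> ?K \<inter> D" using closure_subset by auto
    qed
  qed
  interpret neumann_cone C D x0 \<delta> v g
  proof
    show "open C" "C \<noteq> {}" "0 \<notin> C" using convex_cone_at_origin_facts[OF C] by auto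
    show "t *\<^sub>R x \<in> C" if "0 < t" "x \<in> C" for t x
      using convex_cone_at_origin_facts(4)[OF C that] .
    show "0 < \<delta>" "open D" by fact+
    show "x0 + y \<in> D \<longleftrightarrow> y \<in> C" if "norm y < \<delta>" for y
    proof -
      have "x0 + y \<in> ball x0 \<delta>" using that by (simp add: dist_norm)
      then show ?thesis using ball_sub C_iff[of y] by (auto simp: D_def)
    qed
    have D_sub: "D \<subseteq> insert x0 (closure \<Sigma> \<inter> \<Omega>)" using closure_subset by (auto simp: D_def)
    then show "continuous_on D v" by (rule continuous_on_subset[OF cont])
    have "(v \<longlongrightarrow> v x0) (at x0 within insert x0 (closure \<Sigma> \<inter> \<Omega>))"
      using cont by (simp add: continuous_on_def)
    then show "(v \<longlongrightarrow> v x0) (at x0 within D)" using D_sub by (rule tendsto_within_subset)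
    show "v absolutely_integrable_on (D \<inter> ball x0 r)" "g absolutely_integrable_on (D \<inter> ball x0 r)" if "r < \<delta>" for r
      using W12 that by (auto simp: W12_loc_def intro!: L1)
    show "weak_gradient D v g" using W12 by (simp add: W12_loc_def)
    show "(LINT x:D|lebesgue. g x \<bullet> d\<phi> x) = 0"
      if "r < \<delta>" "C1_gradient \<phi> d\<phi>" "\<And>x. x \<notin> ball x0 r \<Longrightarrow> \<phi> x = 0" for r \<phi> d\<phi>
    proof (rule neumann)
      let ?S = "closure {x \<in> D \<union> \<Gamma>1. \<phi> x \<noteq> 0}"
      have "{x \<in> D \<union> \<Gamma>1. \<phi> x \<noteq> 0} \<subseteq> closure D \<inter> cball x0 r"
        using that(3) closure_subset by (force simp: Gamma1 D_def[symmetric] frontier_def)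
      then have sub: "?S \<subseteq> closure D \<inter> cball x0 r" by (rule closure_minimal) (intro closed_Int closed_closure closed_cball)
      moreover have "compact ?S"
        using compact_Int_closed[OF compact_part closed_closure, of r "{x \<in> D \<union> \<Gamma>1. \<phi> x \<noteq> 0}"] sub
        by (simp only: Int_absorb1)
      ultimately show "C1_test (D \<union> \<Gamma>1) \<phi> d\<phi>"
        using that(2) closed_part[OF that(1)] unfolding C1_test_def C1_gradient_def by blast
    qed
  qed
  have ball_eq: "\<Sigma> \<inter> ball x0 r = D \<inter> ball x0 r" if "r \<le> \<delta>" for r
    using ball_sub that by (force simp: D_def)
  have sphere_eq: "\<Sigma> \<inter> sphere x0 r = D \<inter> sphere x0 r" if "r < \<delta>" for r
    using ball_sub that by (force simp: D_def)
  have "((\<lambda>r. 1 / measure lebesgue (\<Sigma> \<inter> ball x0 \<delta>) *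
            (LINT y:\<Sigma> \<inter> ball x0 r|lebesgue. v y)) \<longlongrightarrow> v x0) (at_left \<delta>)"
  proof (rule Lim_transform_eventually[OF improper_ball_mean_value])
    show "\<forall>\<^sub>F r in at_left \<delta>. 1 / measure lebesgue (D \<inter> ball x0 \<delta>) * (LINT y:D \<inter> ball x0 r|lebesgue. v y) =
        1 / measure lebesgue (\<Sigma> \<inter> ball x0 \<delta>) * (LINT y:\<Sigma> \<inter> ball x0 r|lebesgue. v y)"
      by (intro eventually_at_leftI[of 0]) (use \<delta>_pos in \<open>auto simp: ball_eq\<close>)
  qed
  moreover have "v x0 = 1 / measure lebesgue (\<Sigma> \<inter> ball x0 r) * (LINT y:\<Sigma> \<inter> ball x0 r|lebesgue. v y)"
    if "0 < r" "r \<le> \<delta>" "v absolutely_integrable_on (\<Sigma> \<inter> ball x0 r)" for r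
  proof -
    have "(LINT y:D \<inter> ball x0 r|lebesgue. v y) = v x0 * measure lebesgue (D \<inter> ball x0 r)"
      using that by (intro ball_integral) (simp_all add: ball_eq)
    then show ?thesis using ball_volume_pos[OF that(1,2)] by (simp add: ball_eq[OF that(2)])
  qed
  moreover have "set_integrable (sphere_measure x0 r) (\<Sigma> \<inter> sphere x0 r) v \<and>
      v x0 = 1 / measure (sphere_measure x0 r) (\<Sigma> \<inter> sphere x0 r) *
        (LINT y:\<Sigma> \<inter> sphere x0 r|sphere_measure x0 r. v y)" if "0 < r" "r < \<delta>" for r
    unfolding sphere_eq[OF that(2)] using sphere_mean_value[OF that] by (rule conjI)
  moreover have "v absolutely_integrable_on (\<Sigma> \<inter> ball x0 r)" if "r < \<delta>" for r
    unfolding ball_eq[OF less_imp_le[OF that]] by (rule v_L1[OF that])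
  ultimately show ?thesis by blast
qed

end
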